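(* Let $\psi$ be a waiting-time density on $\mathbb{N}=\{1,2,\dots\}$ with generating function $\bar\psi$, let $N(m)$, $m\in\mathbb{N}_0$, be the generator process with waiting-time density $\psi$, and let $M(t)$, $t\ge0$, be an independent continuous-time renewal counting process whose i.i.d. interarrival times have density $\eta$ with Laplace transform $\tilde\eta(s)$. For $|a|,|b|\le1$, $b\neq0$, set $$\Pi(a,b,t)=\sum_{m=0}^\infty\mathbb{P}(M(t)=m)\sum_{n=0}^m\mathbb{P}(N(m)=n)\,a^nb^{m-n}.$$ Let $\mathcal{K}(b,\cdot)$ and $\mathcal{R}(b,\cdot)$ be the inverse Laplace transforms $$\mathcal{K}(b,t)=\mathcal{L}^{-1}\left\{\frac{1-\bar\psi[b\tilde\eta(s)]}{s\,\bar\psi[b\tilde\eta(s)]}\right\}(t),\qquad \mathcal{R}(b,t)=\mathcal{L}^{-1}\left\{\frac{\tilde\eta(s)}{1-b\,\tilde\eta(s)}\right\}(t).$$ Then $\Pi(a,b,\cdot)$ solves the Cauchy problem $\Pi(a,b,0)=1$, $$\int_0^t\mathcal{K}(b,t-\tau)\,\frac{d}{d\tau}\Pi(a,b,\tau)\,d\tau=(b-1)\int_0^t\mathcal{K}(b,t-\tau)\,\mathcal{R}(b,\tau)\,d\tau+\left(\frac ab-1\right)\Pi(a,b,t),\qquad t>0.$$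
   Context: A waiting-time density is a function $\psi:\mathbb{N}\to[0,1]$ with $\sum_{t\ge1}\psi(t)=1$, with generating function $\bar\psi(u)=\sum_{t\ge1}\psi(t)u^t$, $|u|\le1$. The generator process with waiting-time density $\psi$ is the discrete-time renewal counting process $N(m)=\max\{n\ge0:\Delta t_1+\dots+\Delta t_n\le m\}$ with $\Delta t_1,\Delta t_2,\dots$ i.i.d., $\mathbb{P}(\Delta t_j=k)=\psi(k)$. The Laplace transform of a causal function $f$ on $[0,\infty)$ is $\tilde f(s)=\int_0^\infty e^{-st}f(t)\,dt$, and $\mathcal{L}^{-1}$ is its inverse. The kernels $\mathcal{K}$ and $\mathcal{R}$ are understood as the causal functions (or distributions) with the indicated Laplace transforms, and the integrals are the corresponding causal convolutions. $\Pi(a,b,t)$ is the scalar counterpart of the transition matrix of the asymmetric continuous-time random walk (ACTRW) $\mathcal{Y}(t)=Y_{M(t)}$, where $Y$ is the asymmetric discrete-time random walk making a jump governed by the positive-jump transition matrix $\mathbf{W}^+$ at arrivals of $N$ and by the negative-jump transition matrix $\mathbf{W}^-$ otherwise (the transition matrix is obtained by replacing $a\to\mathbf{W}^+$, $b\to\mathbf{W}^-$). *)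

theory Defs
  imports "HOL-Probability.Probability"
begin

section \<open>Renewal processes and the scalar transition function\<close>

text \<open>The index set of a waiting-time density is \<open>{1, 2, \<dots>}\<close>; the value \<open>\<psi> 0\<close> is never used.\<close>

definition waiting_time_density :: "(nat \<Rightarrow> real) \<Rightarrow> bool" where
  "waiting_time_density \<psi> \<longleftrightarrow>
     (\<forall>t\<ge>1. 0 \<le> \<psi> t \<and> \<psi> t \<le> 1) \<and> (\<lambda>t. \<psi> (Suc t)) sums 1"

definition gen_fun :: "(nat \<Rightarrow> real) \<Rightarrow> complex \<Rightarrow> complex" where
  "gen_fun \<psi> u = (\<Sum>t. of_real (\<psi> (Suc t)) * u ^ Suc t)"

text \<open>
  The interarrival times are \<open>X 0, X 1, \<dots>\<close>.  The definition is used both in discrete time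
  (\<open>'t = nat\<close>) and in continuous time (\<open>'t = real\<close>).  For \<open>t \<ge> 0\<close> the set contains 0, and for the
  interarrival laws considered here it is finite almost surely, so that the value of \<open>Max\<close> on
  infinite sets only matters on a null event.
\<close>

definition renewal_count :: "(nat \<Rightarrow> 'w \<Rightarrow> 't::{comm_monoid_add, ord}) \<Rightarrow> 't \<Rightarrow> 'w \<Rightarrow> nat" where
  "renewal_count X t \<omega> = Max {n. (\<Sum>j<n. X j \<omega>) \<le> t}"

definition transition_scalar ::
  "'w measure \<Rightarrow> (nat \<Rightarrow> 'w \<Rightarrow> nat) \<Rightarrow> (nat \<Rightarrow> 'w \<Rightarrow> real) \<Rightarrow> complex \<Rightarrow> complex \<Rightarrow> real \<Rightarrow> complex"
where
  "transition_scalar P \<Delta> T a b t =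
     (\<Sum>m. of_real (measure P {\<omega> \<in> space P. renewal_count T t \<omega> = m}) *
        (\<Sum>n\<le>m. of_real (measure P {\<omega> \<in> space P. renewal_count \<Delta> m \<omega> = n}) * a ^ n * b ^ (m - n)))"


section \<open>Causal distributions and their Laplace transforms\<close>

definition nth_deriv :: "nat \<Rightarrow> (real \<Rightarrow> complex) \<Rightarrow> real \<Rightarrow> complex" where
  "nth_deriv k \<phi> = ((\<lambda>f t. vector_derivative f (at t)) ^^ k) \<phi>"

definition smooth :: "(real \<Rightarrow> complex) \<Rightarrow> bool" where
  "smooth \<phi> \<longleftrightarrow> (\<forall>k t. nth_deriv k \<phi> differentiable (at t))"

definition test_functions :: "(real \<Rightarrow> complex) set" where
  "test_functions = {\<phi>. smooth \<phi> \<and> (\<exists>r. \<forall>t. r < \<bar>t\<bar> \<longrightarrow> \<phi> t = 0)}"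

text \<open>
  Laplace transformable distributions with support in \<open>[0, \<infinity>)\<close> are modelled, following Zemanian, as
  continuous functionals on test functions that decay exponentially towards \<open>+\<infinity>\<close> and are
  unrestricted towards \<open>-\<infinity>\<close>.  The functions \<open>exp (-s t)\<close> with \<open>Re s \<ge> a\<close> and all compactly supported
  smooth functions belong to \<open>exp_test_functions a\<close>.
\<close>

definition exp_test_functions :: "real \<Rightarrow> (real \<Rightarrow> complex) set" where
  "exp_test_functions a =
     {\<phi>. smooth \<phi> \<and> (\<forall>k. bdd_above ((\<lambda>t. exp (a * t) * norm (nth_deriv k \<phi> t)) ` {0..}))}"

definition exp_seminorm :: "real \<Rightarrow> nat \<Rightarrow> (real \<Rightarrow> complex) \<Rightarrow> real" where
  "exp_seminorm a n \<phi> = (\<Sum>k\<le>n. SUP t\<in>{0..}. exp (a * t) * norm (nth_deriv k \<phi> t))"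

text \<open>
  \<open>U\<close> is a distribution on the line with support in \<open>[0, \<infinity>)\<close> whose product with \<open>exp (-c t)\<close> is
  tempered for every \<open>c > \<sigma>\<close>.  Causality is built into the continuity estimate, because the seminorms
  see the test function on \<open>[0, \<infinity>)\<close> only.  The values of \<open>U\<close> outside the test spaces are irrelevant.
\<close>

definition causal_distribution :: "real \<Rightarrow> ((real \<Rightarrow> complex) \<Rightarrow> complex) \<Rightarrow> bool" where
  "causal_distribution \<sigma> U \<longleftrightarrow>
     (\<forall>a>\<sigma>.
        (\<forall>\<phi>\<in>exp_test_functions a. \<forall>\<theta>\<in>exp_test_functions a. U (\<lambda>t. \<phi> t + \<theta> t) = U \<phi> + U \<theta>) \<and>
        (\<forall>\<phi>\<in>exp_test_functions a. \<forall>c. U (\<lambda>t. c * \<phi> t) = c * U \<phi>) \<and>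
        (\<exists>C n. \<forall>\<phi>\<in>exp_test_functions a. norm (U \<phi>) \<le> C * exp_seminorm a n \<phi>))"

text \<open>The regular causal distribution given by a function, of which only the values on \<open>[0, \<infinity>)\<close> matter.\<close>

definition fun_distr :: "(real \<Rightarrow> complex) \<Rightarrow> (real \<Rightarrow> complex) \<Rightarrow> complex" where
  "fun_distr f \<phi> = (LINT t:{0..}|lebesgue. f t * \<phi> t)"

definition distr_conv ::
  "((real \<Rightarrow> complex) \<Rightarrow> complex) \<Rightarrow> ((real \<Rightarrow> complex) \<Rightarrow> complex) \<Rightarrow> (real \<Rightarrow> complex) \<Rightarrow> complex"
where
  "distr_conv U V \<phi> = U (\<lambda>x. V (\<lambda>y. \<phi> (x + y)))"

definition laplace :: "(real \<Rightarrow> complex) \<Rightarrow> complex \<Rightarrow> complex" where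
  "laplace f s = (LINT t:{0..}|lebesgue. exp (- (s * of_real t)) * f t)"

text \<open>
  Being an inverse Laplace transform of \<open>F\<close>: the Laplace transform exists and equals \<open>F\<close> on some right
  half-plane.
\<close>

definition inverse_laplace_fun :: "(real \<Rightarrow> complex) \<Rightarrow> (complex \<Rightarrow> complex) \<Rightarrow> bool" where
  "inverse_laplace_fun f F \<longleftrightarrow>
     (\<exists>\<sigma>. \<forall>s. \<sigma> < Re s \<longrightarrow>
        set_integrable lebesgue {0..} (\<lambda>t. exp (- (s * of_real t)) * f t) \<and> laplace f s = F s)"

definition inverse_laplace_distr ::
  "((real \<Rightarrow> complex) \<Rightarrow> complex) \<Rightarrow> (complex \<Rightarrow> complex) \<Rightarrow> bool" where
  "inverse_laplace_distr U F \<longleftrightarrow>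
     (\<exists>\<sigma>. causal_distribution \<sigma> U \<and> (\<forall>s. \<sigma> < Re s \<longrightarrow> U (\<lambda>t. exp (- (s * of_real t))) = F s))"


section \<open>The kernels and the Cauchy problem\<close>

text \<open>
  For \<open>b \<noteq> 0\<close>, all denominators are nonzero for large real \<open>s\<close>.  A Laplace transform is holomorphic, so
  the convention \<open>x / 0 = 0\<close> does not admit additional kernels.
\<close>

definition K_laplace :: "(nat \<Rightarrow> real) \<Rightarrow> (real \<Rightarrow> real) \<Rightarrow> complex \<Rightarrow> complex \<Rightarrow> complex" where
  "K_laplace \<psi> \<eta> b s =
     (1 - gen_fun \<psi> (b * laplace (\<lambda>t. of_real (\<eta> t)) s)) /
     (s * gen_fun \<psi> (b * laplace (\<lambda>t. of_real (\<eta> t)) s))"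

definition R_laplace :: "(real \<Rightarrow> real) \<Rightarrow> complex \<Rightarrow> complex \<Rightarrow> complex" where
  "R_laplace \<eta> b s =
     laplace (\<lambda>t. of_real (\<eta> t)) s / (1 - b * laplace (\<lambda>t. of_real (\<eta> t)) s)"

text \<open>
  Local absolute continuity on \<open>[0, \<infinity>)\<close>, which gives a meaning to \<open>d/d\<tau>\<close> under the integral: the
  classical derivative exists almost everywhere and is locally integrable, and its integral recovers
  the function.
\<close>

definition locally_abs_continuous :: "(real \<Rightarrow> complex) \<Rightarrow> bool" where
  "locally_abs_continuous f \<longleftrightarrow>
     (AE t in lebesgue. 0 < t \<longrightarrow> f differentiable (at t)) \<and>
     (\<forall>t\<ge>0. set_integrable lebesgue {0..t} (\<lambda>\<tau>. vector_derivative f (at \<tau>)) \<and>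
        f t = f 0 + (LINT \<tau>:{0..t}|lebesgue. vector_derivative f (at \<tau>)))"

text \<open>The evolution equation as an identity of causal distributions.\<close>

definition evolution_eq_distr ::
  "((real \<Rightarrow> complex) \<Rightarrow> complex) \<Rightarrow> ((real \<Rightarrow> complex) \<Rightarrow> complex) \<Rightarrow> complex \<Rightarrow> complex \<Rightarrow>
    (real \<Rightarrow> complex) \<Rightarrow> bool"
where
  "evolution_eq_distr K R a b f \<longleftrightarrow>
     (\<forall>\<phi>\<in>test_functions.
        distr_conv K (fun_distr (\<lambda>\<tau>. vector_derivative f (at \<tau>))) \<phi> =
          (b - 1) * distr_conv K R \<phi> + (a / b - 1) * fun_distr f \<phi>)"

text \<open>
  The evolution equation for kernels that are functions.  Such kernels, as well as the derivative of
  \<open>f\<close>, are determined almost everywhere only, and the convolution integrals of such functions converge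
  for almost every \<open>t\<close>.
\<close>

definition evolution_eq_fun ::
  "(real \<Rightarrow> complex) \<Rightarrow> (real \<Rightarrow> complex) \<Rightarrow> complex \<Rightarrow> complex \<Rightarrow> (real \<Rightarrow> complex) \<Rightarrow> bool"
where
  "evolution_eq_fun K R a b f \<longleftrightarrow>
     (AE t in lebesgue. 0 < t \<longrightarrow>
        set_integrable lebesgue {0..t} (\<lambda>\<tau>. K (t - \<tau>) * vector_derivative f (at \<tau>)) \<and>
        set_integrable lebesgue {0..t} (\<lambda>\<tau>. K (t - \<tau>) * R \<tau>) \<and>
        (LINT \<tau>:{0..t}|lebesgue. K (t - \<tau>) * vector_derivative f (at \<tau>)) =
          (b - 1) * (LINT \<tau>:{0..t}|lebesgue. K (t - \<tau>) * R \<tau>) + (a / b - 1) * f t)"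

end

theory Submission
  imports Defs
begin

text \<open>
  Laplace transformation turns the evolution equation into an identity between rational
  expressions.  Fix a large \<open>s\<close> and write \<open>e\<close> for the transform of \<open>\<eta>\<close> at \<open>s\<close> and \<open>p\<close> for the
  generating function of \<open>\<psi>\<close> at \<open>b * e\<close>.  Let \<open>c m\<close> be the expectation of
  \<open>a ^ N(m) * b ^ (m - N(m))\<close> and \<open>C = (\<Sum>m. c m * e ^ m)\<close>.  Conditioning on one waiting time of the
  discrete process gives a convolution recursion for \<open>c\<close>, hence
  \<open>(1 - b * e) * (b - a * p) * C = b * (1 - p)\<close> (\<open>jump_average_generating_function\<close>).  Abel summation
  in the mixture over \<open>M(t)\<close> shows that the transition function is \<open>1\<close> plus the integral of
  \<open>\<Sum>n. (c (n + 1) - c n) * g n\<close>, where \<open>g n\<close> is the density of the \<open>(n + 1)\<close>-st arrival time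
  (\<open>renewal_mixture_eq\<close>); the transform of this density is \<open>(1 - e) * C - 1\<close>.  Both facts together
  with the prescribed transforms of the kernels give the transformed equation
  (\<open>evolution_symbol_identity\<close>).

  Three analytic arguments lead back to the equation itself.  First, the density just described is
  the classical derivative almost everywhere, by Lebesgue's differentiation theorem
  (\<open>lebesgue_differentiation\<close>), obtained here from the Vitali covering theorem.  Second, transforms
  of causal convolutions are products, for functions (\<open>laplace_causal_convolution\<close>) as well as for
  distributions (\<open>distr_conv_exp\<close>).  Third, a causal object is determined by the values of its
  Laplace transform at all large integers.  Indeed \<open>x = exp (- t)\<close> turns the functions
  \<open>exp (- n * t)\<close> into the powers of \<open>x\<close>, so that sums of such exponentials approximate
  continuous functions of bounded support by the Weierstrass theorem
  (\<open>exponential_sum_approximation\<close>).  For functions this gives \<open>exponential_moments_zero_AE\<close>.  A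
  distribution also sees derivatives up to some order \<open>n\<close>; there the \<open>n\<close>-th derivative of the
  test function is approximated and the approximation is integrated \<open>n\<close> times from infinity, which
  keeps its exponential decay (\<open>exp_continuous_unique\<close>).  Only integers beyond an arbitrary bound
  are needed, so it does no harm that \<open>p\<close> may vanish for small \<open>s\<close>.
\<close>


section \<open>Lebesgue differentiation on the line\<close>

text \<open>
  The point may be an endpoint, so that averages over these intervals describe the difference quotients
  of an integral function from both sides.
\<close>

abbreviation near_intervals :: "real \<Rightarrow> (real \<Rightarrow> real \<Rightarrow> bool) \<Rightarrow> bool" where
  "near_intervals x Q \<equiv> \<exists>d>0. \<forall>u v. u \<le> x \<and> x \<le> v \<and> u < v \<and> v - u < d \<longrightarrow> Q u v"

text \<open>
  Since \<open>h\<close> vanishes on \<open>A\<close>, some open \<open>U\<close> around \<open>A\<close> carries less than any prescribed amount of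
  the mass of \<open>h\<close>.  Around every exceptional point there are arbitrarily short intervals inside \<open>U\<close>
  whose length is at most \<open>1 / e\<close> times their mass; by Vitali, disjoint ones among them cover almost
  the whole exceptional set, so that the measure of this set is at most \<open>1 / e\<close> times the mass of
  \<open>U\<close>.
\<close>

lemma vanishing_density_off_support:
  fixes h :: "real \<Rightarrow> real"
  assumes int: "integrable lborel h" and nn: "\<And>x. 0 \<le> h x"
    and A: "A \<in> sets borel" and z: "\<And>x. x \<in> A \<Longrightarrow> h x = 0" and e: "0 < e"
  shows "negligible {x\<in>A. \<forall>d>0. \<exists>u v. u \<le> x \<and> x \<le> v \<and> u < v \<and> v - u < d \<and>
           e * (v - u) < (LINT y:{u..v}|lborel. h y)}" (is "negligible ?E")
  unfolding negligible_outer_le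
proof (intro allI impI)
  fix \<epsilon> :: real assume "0 < \<epsilon>"
  define \<mu> where "\<mu> = density lborel (\<lambda>x. ennreal (h x))"
  have [measurable]: "h \<in> borel_measurable borel" using int by auto
  have mu_I: "emeasure \<mu> {u..v} = ennreal (LINT y:{u..v}|lborel. h y)" for u v
  proof -
    have "emeasure \<mu> {u..v} = (\<integral>\<^sup>+x. ennreal (indicator {u..v} x * h x) \<partial>lborel)"
      unfolding \<mu>_def by (subst emeasure_density) (auto intro!: nn_integral_cong split: split_indicator)
    also have "\<dots> = ennreal (\<integral>x. indicator {u..v} x * h x \<partial>lborel)"
      by (rule nn_integral_eq_integral)
         (use integrable_mult_indicator[OF _ int, of "{u..v}"] in \<open>auto simp: nn\<close>)
    finally show ?thesis by (simp add: set_lebesgue_integral_def)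
  qed
  have fin: "emeasure \<mu> (space \<mu>) \<noteq> \<infinity>"
  proof -
    have "emeasure \<mu> (space \<mu>) = (\<integral>\<^sup>+x. ennreal (h x) \<partial>lborel)"
      unfolding \<mu>_def by (subst emeasure_density) (auto intro!: nn_integral_cong)
    also have "\<dots> = ennreal (\<integral>x. h x \<partial>lborel)" by (rule nn_integral_eq_integral) (auto simp: nn int)
    finally show ?thesis by simp
  qed
  have "emeasure \<mu> A = 0"
    unfolding \<mu>_def using A z by (subst emeasure_density) (auto simp: nn_integral_0_iff_AE indicator_def)
  moreover have "emeasure \<mu> A = (INF U\<in>{U. A \<subseteq> U \<and> open U}. emeasure \<mu> U)"
    by (rule outer_regular) (use A fin in \<open>auto simp: \<mu>_def\<close>)
  ultimately have "(INF U\<in>{U. A \<subseteq> U \<and> open U}. emeasure \<mu> U) < ennreal (e * \<epsilon>)"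
    using \<open>0 < e\<close> \<open>0 < \<epsilon>\<close> by (metis ennreal_less_zero_iff mult_pos_pos)
  then obtain U where U: "A \<subseteq> U" "open U" and muU: "emeasure \<mu> U < ennreal (e * \<epsilon>)"
    unfolding INF_less_iff by auto
  \<comment> \<open>Intervals inside \<open>U\<close> that are short compared with their mass; they cover the exceptional set finely.\<close>
  define K where "K = {(u,v). u < v \<and> {u..v} \<subseteq> U \<and> e * (v - u) < (LINT y:{u..v}|lborel. h y)}"
  define a :: "real \<times> real \<Rightarrow> real" where "a = (\<lambda>(u,v). (u + v) / 2)"
  define r :: "real \<times> real \<Rightarrow> real" where "r = (\<lambda>(u,v). (v - u) / 2)"
  have cb: "cball (a p) (r p) = {fst p..snd p}" for p
    by (cases p) (auto simp: a_def r_def cball_eq_atLeastAtMost field_simps)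
  have rpos: "\<And>i. i \<in> K \<Longrightarrow> 0 < r i" by (auto simp: K_def r_def)
  have fine: "\<exists>i. i \<in> K \<and> x \<in> cball (a i) (r i) \<and> r i < d" if x: "x \<in> ?E" and d: "0 < d" for x d
  proof -
    from x U have "x \<in> U" by auto
    with U obtain \<delta> where \<delta>: "0 < \<delta>" "ball x \<delta> \<subseteq> U" by (meson openE)
    from x have "\<forall>d>0. \<exists>u v. u \<le> x \<and> x \<le> v \<and> u < v \<and> v - u < d \<and>
           e * (v - u) < (LINT y:{u..v}|lborel. h y)" by simp
    moreover have "min d \<delta> > 0" using d \<delta> by simp
    ultimately obtain u v where uv: "u \<le> x" "x \<le> v" "u < v" "v - u < min d \<delta>"
        "e * (v - u) < (LINT y:{u..v}|lborel. h y)" by blast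
    have "{u..v} \<subseteq> ball x \<delta>" using uv by (auto simp: dist_real_def)
    with \<delta> have "(u,v) \<in> K" using uv by (auto simp: K_def)
    moreover have "x \<in> cball (a (u,v)) (r (u,v))" using uv by (simp add: cb)
    moreover have "r (u,v) < d" using uv d by (auto simp: r_def)
    ultimately show ?thesis by blast
  qed
  obtain C where C: "countable C" "C \<subseteq> K"
     "pairwise (\<lambda>i j. disjnt (cball (a i) (r i)) (cball (a j) (r j))) C"
     "negligible(?E - (\<Union>i \<in> C. cball (a i) (r i)))"
    using Vitali_covering_theorem_cballs[of K r ?E a, OF rpos fine] by blast
  define T where "T = (\<Union>i \<in> C. cball (a i) (r i))"
  have Tb: "T \<in> sets borel" unfolding T_def using C(1) by auto
  have disj: "disjoint_family_on (\<lambda>i. cball (a i) (r i)) C"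
    using C(3) by (auto simp: disjoint_family_on_def pairwise_def disjnt_def)
  have "ennreal e * emeasure lborel T = ennreal e * (\<integral>\<^sup>+i. emeasure lborel (cball (a i) (r i)) \<partial>count_space C)"
    unfolding T_def using C(1) disj by (subst emeasure_UN_countable) auto
  also have "\<dots> = (\<integral>\<^sup>+i. ennreal e * emeasure lborel (cball (a i) (r i)) \<partial>count_space C)"
    by (rule nn_integral_cmult[symmetric]) auto
  also have "\<dots> \<le> (\<integral>\<^sup>+i. emeasure \<mu> (cball (a i) (r i)) \<partial>count_space C)"
  proof (rule nn_integral_mono)
    fix i assume "i \<in> space (count_space C)"
    then have "i \<in> K" using C by auto
    then show "ennreal e * emeasure lborel (cball (a i) (r i)) \<le> emeasure \<mu> (cball (a i) (r i))"
      using e by (cases i) (auto simp: cb mu_I K_def ennreal_mult[symmetric] intro!: ennreal_leI)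
  qed
  also have "\<dots> = emeasure \<mu> T"
    unfolding T_def using C(1) disj by (subst emeasure_UN_countable) (auto simp: \<mu>_def)
  also have "\<dots> \<le> emeasure \<mu> U"
  proof (rule emeasure_mono)
    have "{fst p..snd p} \<subseteq> U" if "p \<in> C" for p using C(2) that by (cases p) (auto simp: K_def)
    then show "T \<subseteq> U" unfolding T_def cb by blast
  qed (use U in \<open>auto simp: \<mu>_def\<close>)
  also have "\<dots> < ennreal (e * \<epsilon>)" by (rule muU)
  finally have "ennreal e * emeasure lborel T < ennreal e * ennreal \<epsilon>"
    using e \<open>0 < \<epsilon>\<close> by (simp add: ennreal_mult)
  then have Tm: "emeasure lborel T < ennreal \<epsilon>"
    by (meson linorder_not_le mult_left_mono zero_le)
  have Tl: "T \<in> lmeasurable"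
    using Tb Tm by (auto simp: fmeasurable_def less_top[symmetric] intro: less_trans[OF _ ennreal_less_top])
  have Tmeas: "measure lebesgue T \<le> \<epsilon>"
    using Tm Tb \<open>0 < \<epsilon>\<close> by (simp add: measure_def enn2real_leI)
  have N: "?E - T \<in> lmeasurable" "measure lebesgue (?E - T) = 0"
    using C(4) unfolding T_def[symmetric] by (auto simp: negligible_iff_measure)
  show "\<exists>T. ?E \<subseteq> T \<and> T \<in> lmeasurable \<and> measure lebesgue T \<le> \<epsilon>"
  proof (intro exI conjI)
    show "?E \<subseteq> (?E - T) \<union> T" by auto
    show "(?E - T) \<union> T \<in> lmeasurable" using N Tl by blast
    have "measure lebesgue ((?E - T) \<union> T) \<le> measure lebesgue (?E - T) + measure lebesgue T"
      by (rule measure_Un_le) (use N Tl in auto)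
    then show "measure lebesgue ((?E - T) \<union> T) \<le> \<epsilon>" using N Tmeas by linarith
  qed
qed
text \<open>
  On \<open>{x. g x < q}\<close> the positive part of \<open>g - q\<close> vanishes, so that its averages tend to \<open>0\<close> almost
  everywhere there, and averages of \<open>g\<close> eventually stay below \<open>q + e\<close>.  Letting \<open>q\<close> run through the
  rationals reaches every point.  The truncation to \<open>{- n..n}\<close> makes the positive part integrable
  when \<open>q\<close> is negative.
\<close>

lemma upper_average_le_AE:
  fixes g :: "real \<Rightarrow> real"
  assumes [measurable]: "g \<in> borel_measurable borel"
    and int: "\<And>n::nat. set_integrable lborel {-real n..real n} g"
  shows "AE x in lborel. \<forall>e>0. near_intervals x (\<lambda>u v. (LINT y:{u..v}|lborel. g y) \<le> (g x + e) * (v - u))"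
proof -
  define h where "h q n x = indicator {-real n..real n} x * max 0 (g x - q)" for q :: real and n :: nat and x
  define A where "A q n = {x. g x < q} \<inter> {-real n<..<real n}" for q :: real and n :: nat
  have hint: "integrable lborel (h q n)" for q n
  proof (rule Bochner_Integration.integrable_bound)
    show "integrable lborel (\<lambda>x. indicator {-real n..real n} x * \<bar>g x\<bar> + indicator {-real n..real n} x * \<bar>q\<bar>)"
      using integrable_norm[OF int[of n, unfolded set_integrable_def]]
      by (intro Bochner_Integration.integrable_add) (auto simp: abs_mult)
    show "h q n \<in> borel_measurable lborel" unfolding h_def[abs_def] by measurable
  qed (simp add: h_def indicator_def max_def abs_if)
  have neg: "negligible {x\<in>A q n. \<forall>d>0. \<exists>u v. u \<le> x \<and> x \<le> v \<and> u < v \<and> v - u < d \<and>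
           inverse (real (Suc k)) * (v - u) < (LINT y:{u..v}|lborel. h q n y)}" (is "negligible (?N q n k)") for q n k
    by (rule vanishing_density_off_support[OF hint]) (auto simp: h_def A_def)
  have "AE x in lborel. x \<notin> ?N (of_rat q) n k" for q n k
    using AE_not_in[OF neg[of "of_rat q" n k, unfolded negligible_iff_null_sets]] by (simp only: AE_completion_iff)
  then have "AE x in lborel. \<forall>q n k. x \<notin> ?N (of_rat q) n k"
    by (simp only: AE_all_countable) blast
  then show ?thesis
  proof eventually_elim
    case (elim x)
    show ?case
    proof (intro allI impI)
      fix e :: real assume e: "0 < e"
      obtain q :: rat where q: "g x < of_rat q" "of_rat q < g x + e / 2"
        using of_rat_dense[of "g x" "g x + e/2"] e by auto
      obtain n :: nat where n: "\<bar>x\<bar> < real n" using reals_Archimedean2 by blast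
      obtain k where k: "inverse (real (Suc k)) < e / 2" using reals_Archimedean[of "e/2"] e by auto
      have "x \<in> A (of_rat q) n" using q n by (auto simp: A_def)
      moreover have "x \<notin> ?N (of_rat q) n k" using elim by blast
      ultimately have "near_intervals x (\<lambda>u v. \<not> inverse (real (Suc k)) * (v - u) < (LINT y:{u..v}|lborel. h (of_rat q) n y))"
        by blast
      then obtain d where d: "0 < d"
        "\<And>u v. u \<le> x \<Longrightarrow> x \<le> v \<Longrightarrow> u < v \<Longrightarrow> v - u < d \<Longrightarrow>
           (LINT y:{u..v}|lborel. h (of_rat q) n y) \<le> inverse (real (Suc k)) * (v - u)"
        unfolding not_less by blast
      show "near_intervals x (\<lambda>u v. (LINT y:{u..v}|lborel. g y) \<le> (g x + e) * (v - u))"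
      proof (intro exI[of _ "min d (real n - \<bar>x\<bar>)"] conjI allI impI)
        show "0 < min d (real n - \<bar>x\<bar>)" using d n by simp
        fix u v assume uv: "u \<le> x \<and> x \<le> v \<and> u < v \<and> v - u < min d (real n - \<bar>x\<bar>)"
        then have sub: "{u..v} \<subseteq> {-real n..real n}" by auto
        have hi: "set_integrable lborel {u..v} (h (of_rat q) n)"
          unfolding set_integrable_def by (rule integrable_mult_indicator) (auto intro: hint)
        have gi: "set_integrable lborel {u..v} g"
          by (rule set_integrable_subset[OF int _ sub]) auto
        have ci: "set_integrable lborel {u..v} (\<lambda>_. of_rat q :: real)"
          unfolding set_integrable_def by (intro integrable_scaleR_left integrable_real_indicator) (use uv in auto)
        have "(LINT y:{u..v}|lborel. g y) \<le> (LINT y:{u..v}|lborel. of_rat q + h (of_rat q) n y)"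
          by (rule set_integral_mono[OF gi set_integral_add(1)[OF ci hi]]) (use sub in \<open>auto simp: h_def\<close>)
        also have "\<dots> = (LINT y:{u..v}|lborel. of_rat q) + (LINT y:{u..v}|lborel. h (of_rat q) n y)"
          by (rule set_integral_add(2)[OF ci hi])
        also have "(LINT y:{u..v}|lborel. of_rat q) = of_rat q * (v - u)"
          using uv by (simp add: set_lebesgue_integral_def)
        also have "(LINT y:{u..v}|lborel. h (of_rat q) n y) \<le> inverse (real (Suc k)) * (v - u)"
          using d uv by auto
        also have "of_rat q * (v - u) + inverse (real (Suc k)) * (v - u) \<le> (g x + e) * (v - u)"
          using uv k q unfolding distrib_right[symmetric] by (intro mult_right_mono) auto
        finally show "(LINT y:{u..v}|lborel. g y) \<le> (g x + e) * (v - u)" by simp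
      qed
    qed
  qed
qed

lemma real_average_tendsto_AE:
  fixes g :: "real \<Rightarrow> real"
  assumes [measurable]: "g \<in> borel_measurable borel"
    and int: "\<And>n::nat. set_integrable lborel {-real n..real n} g"
  shows "AE x in lborel. \<forall>e>0. near_intervals x (\<lambda>u v. \<bar>(LINT y:{u..v}|lborel. g y) - g x * (v - u)\<bar> \<le> e * (v - u))"
proof -
  have "AE x in lborel. \<forall>e>0. near_intervals x (\<lambda>u v. (LINT y:{u..v}|lborel. - g y) \<le> (- g x + e) * (v - u))"
    by (rule upper_average_le_AE) (use int in \<open>auto simp: set_integrable_def\<close>)
  with upper_average_le_AE[OF assms] show ?thesis
  proof eventually_elim
    case (elim x)
    show ?case
    proof (intro allI impI)
      fix e :: real assume e: "0 < e"
      obtain d1 where d1: "d1 > 0" "\<And>u v. u \<le> x \<and> x \<le> v \<and> u < v \<and> v - u < d1 \<Longrightarrow>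
           (LINT y:{u..v}|lborel. g y) \<le> (g x + e) * (v - u)" using elim(1) e by blast
      obtain d2 where d2: "d2 > 0" "\<And>u v. u \<le> x \<and> x \<le> v \<and> u < v \<and> v - u < d2 \<Longrightarrow>
           (LINT y:{u..v}|lborel. - g y) \<le> (- g x + e) * (v - u)" using elim(2) e by blast
      show "near_intervals x (\<lambda>u v. \<bar>(LINT y:{u..v}|lborel. g y) - g x * (v - u)\<bar> \<le> e * (v - u))"
      proof (intro exI[of _ "min d1 d2"] conjI allI impI)
        fix u v assume uv: "u \<le> x \<and> x \<le> v \<and> u < v \<and> v - u < min d1 d2"
        have "(LINT y:{u..v}|lborel. - g y) = - (LINT y:{u..v}|lborel. g y)"
          by (simp add: set_lebesgue_integral_def)
        with d1(2)[of u v] d2(2)[of u v] uv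
        show "\<bar>(LINT y:{u..v}|lborel. g y) - g x * (v - u)\<bar> \<le> e * (v - u)"
          by (auto simp: abs_le_iff algebra_simps)
      qed (use d1 d2 in auto)
    qed
  qed
qed

theorem lebesgue_differentiation:
  fixes g F :: "real \<Rightarrow> complex"
  assumes [measurable]: "g \<in> borel_measurable borel"
    and int: "\<And>n::nat. set_integrable lborel {-real n..real n} g"
    and F: "\<And>u v. 0 \<le> u \<Longrightarrow> u \<le> v \<Longrightarrow> F v - F u = (LINT y:{u..v}|lborel. g y)"
  shows "AE x in lborel. 0 < x \<longrightarrow> (F has_vector_derivative g x) (at x)"
proof -
  have intR: "set_integrable lborel {-real n..real n} (\<lambda>x. Re (g x))"
    and intI: "set_integrable lborel {-real n..real n} (\<lambda>x. Im (g x))" for n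
    using integrable_Re[OF int[of n, unfolded set_integrable_def]] integrable_Im[OF int[of n, unfolded set_integrable_def]]
    by (simp_all add: set_integrable_def)
  have R: "AE x in lborel. \<forall>e>0. near_intervals x (\<lambda>u v. \<bar>(LINT y:{u..v}|lborel. Re (g y)) - Re (g x) * (v - u)\<bar> \<le> e * (v - u))"
    by (rule real_average_tendsto_AE) (use intR in auto)
  have I: "AE x in lborel. \<forall>e>0. near_intervals x (\<lambda>u v. \<bar>(LINT y:{u..v}|lborel. Im (g y)) - Im (g x) * (v - u)\<bar> \<le> e * (v - u))"
    by (rule real_average_tendsto_AE) (use intI in auto)
  show ?thesis using R I
  proof eventually_elim
    case (elim x)
    show ?case
    proof
      assume x: "0 < x"
      show "(F has_vector_derivative g x) (at x)"
        unfolding has_vector_derivative_def has_derivative_within_alt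
      proof (intro conjI allI impI)
        fix e :: real assume e: "0 < e"
        then have e2: "0 < e/2" by simp
        obtain d1 where d1: "d1 > 0" "\<And>u v. u \<le> x \<and> x \<le> v \<and> u < v \<and> v - u < d1 \<Longrightarrow>
           \<bar>(LINT y:{u..v}|lborel. Re (g y)) - Re (g x) * (v - u)\<bar> \<le> e/2 * (v - u)" using elim(1) e2 by blast
        obtain d2 where d2: "d2 > 0" "\<And>u v. u \<le> x \<and> x \<le> v \<and> u < v \<and> v - u < d2 \<Longrightarrow>
           \<bar>(LINT y:{u..v}|lborel. Im (g y)) - Im (g x) * (v - u)\<bar> \<le> e/2 * (v - u)" using elim(2) e2 by blast
        have key: "norm (F v - F u - (v - u) *\<^sub>R g x) \<le> e * (v - u)"
          if uv: "u \<le> x" "x \<le> v" "u < v" "v - u < min d1 d2" "0 \<le> u" for u v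
        proof -
          obtain n :: nat where n: "\<bar>u\<bar> + \<bar>v\<bar> < real n" using reals_Archimedean2 by blast
          have gi: "set_integrable lborel {u..v} g"
            by (rule set_integrable_subset[OF int[of n]]) (use n in auto)
          have "Re (F v - F u - (v - u) *\<^sub>R g x) = (LINT y:{u..v}|lborel. Re (g y)) - Re (g x) * (v - u)"
            using integral_Re[OF gi[unfolded set_integrable_def]] F[OF uv(5)] uv
            by (simp add: set_lebesgue_integral_def)
          moreover have "Im (F v - F u - (v - u) *\<^sub>R g x) = (LINT y:{u..v}|lborel. Im (g y)) - Im (g x) * (v - u)"
            using integral_Im[OF gi[unfolded set_integrable_def]] F[OF uv(5)] uv
            by (simp add: set_lebesgue_integral_def)
          ultimately have "norm (F v - F u - (v - u) *\<^sub>R g x) \<le> e/2 * (v - u) + e/2 * (v - u)"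
            using cmod_le[of "F v - F u - (v - u) *\<^sub>R g x"] d1(2)[of u v] d2(2)[of u v] uv by (simp add: mult.commute[of "v - u"])
          then show ?thesis by simp
        qed
        show "\<exists>d>0. \<forall>y\<in>UNIV. norm (y - x) < d \<longrightarrow> norm (F y - F x - (y - x) *\<^sub>R g x) \<le> e * norm (y - x)"
        proof (intro exI[of _ "min (min d1 d2) x"] conjI ballI impI)
          fix y assume y: "norm (y - x) < min (min d1 d2) x"
          consider "y = x" | "x < y" | "y < x" by linarith
          then show "norm (F y - F x - (y - x) *\<^sub>R g x) \<le> e * norm (y - x)"
          proof cases
            case 2 then show ?thesis using key[of x y] y x by auto
          next
            case 3
            have "norm (F y - F x - (y - x) *\<^sub>R g x) = norm (F x - F y - (x - y) *\<^sub>R g x)"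
              by (subst norm_minus_cancel[symmetric]) (simp add: algebra_simps)
            then show ?thesis using key[of y x] y x 3 by auto
          qed auto
        qed (use d1 d2 x in auto)
      qed (simp add: bounded_linear_scaleR_left)
    qed
  qed
qed

section \<open>Sums of exponentials and vanishing moments\<close>

text \<open>
  Convolution integrals need \<open>(t, \<tau>) \<mapsto> K (t - \<tau>)\<close> to be measurable on the product space, which can fail
  for a function that is Lebesgue but not Borel measurable.  Hence the passage to Borel versions.
\<close>

lemma lebesgue_complex_ex_borel:
  fixes f :: "real \<Rightarrow> complex"
  assumes "f \<in> borel_measurable lebesgue"
  obtains g where "g \<in> borel_measurable borel" "AE x in lborel. f x = g x"
proof -
  obtain p where p: "p \<in> borel_measurable lborel" "AE x in lborel. Re (f x) = p x"
    using completion_ex_borel_measurable_real[of "\<lambda>x. Re (f x)" lborel] assms by auto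
  obtain q where q: "q \<in> borel_measurable lborel" "AE x in lborel. Im (f x) = q x"
    using completion_ex_borel_measurable_real[of "\<lambda>x. Im (f x)" lborel] assms by auto
  show ?thesis
  proof
    show "(\<lambda>x. of_real (p x) + \<i> * of_real (q x)) \<in> borel_measurable borel" using p q by auto
    show "AE x in lborel. f x = of_real (p x) + \<i> * of_real (q x)"
      using p(2) q(2) by eventually_elim (auto simp: complex_eq_iff)
  qed
qed

text \<open>
  In the variable \<open>x = exp (- t)\<close> the function \<open>\<psi>\<close> lives on \<open>{0..1}\<close> and vanishes near \<open>0\<close>, so that
  it stays continuous after division by \<open>x ^ N\<close>.  Uniform polynomial approximation of the quotient
  turns into approximation with the weight \<open>exp (- N * t)\<close>.
\<close>

lemma exponential_sum_approximation:
  fixes \<psi> :: "real \<Rightarrow> complex" and N :: nat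
  assumes cont: "continuous_on UNIV \<psi>" and vanish: "\<And>t. r < t \<Longrightarrow> \<psi> t = 0" and e: "0 < e"
  shows "\<exists>(c :: nat \<Rightarrow> complex) m. \<forall>t\<ge>0.
    norm (\<psi> t - (\<Sum>i\<le>m. c i * exp (- (of_nat (N + i) * of_real t)))) \<le> e * exp (- real N * t)"
proof -
  \<comment> \<open>The function \<open>exp (N * t) * \<psi> t\<close> in the variable \<open>x = exp (- t)\<close>, extended by \<open>0\<close> to \<open>x = 0\<close>.\<close>
  define g :: "real \<Rightarrow> complex" where
    "g x = (if x \<le> 0 then 0 else of_real (inverse (x ^ N)) * \<psi> (- ln x))" for x
  have iso: "isCont \<psi> t" for t using cont by (simp add: continuous_on_eq_continuous_at)
  have "isCont g x" for x
  proof (cases "x < exp (- r)")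
    case True
    then have "\<forall>\<^sub>F y in nhds x. g y = 0"
    proof -
      have "\<forall>\<^sub>F y in nhds x. y < exp (- r)" using True eventually_nhds_in_open[of "{..<exp (- r)}" x] by simp
      then show ?thesis
      proof eventually_elim
        case (elim y)
        then have "0 < y \<Longrightarrow> ln y < - r" by (metis exp_less_cancel_iff exp_ln)
        then show ?case by (auto simp: g_def intro!: vanish)
      qed
    qed
    then show ?thesis by (subst isCont_cong[where g="\<lambda>_. 0"]) auto
  next
    case False
    then have x: "0 < x" using less_le_trans[OF exp_gt_zero] by (metis not_less)
    then have "\<forall>\<^sub>F y in nhds x. 0 < y" using eventually_nhds_in_open[of "{0<..}" x] by simp
    then have "\<forall>\<^sub>F y in nhds x. g y = of_real (inverse (y ^ N)) * \<psi> (- ln y)"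
      by eventually_elim (auto simp: g_def)
    moreover have "isCont (\<lambda>y. of_real (inverse (y ^ N)) * \<psi> (- ln y)) x"
      using x by (intro continuous_intros isCont_o2[OF _ iso]) auto
    ultimately show ?thesis by (subst isCont_cong)
  qed
  then have gc: "continuous_on {0..1} g" by (simp add: continuous_at_imp_continuous_on)
  have e2: "0 < e / 2" using e by simp
  have gR: "continuous_on {0..1} (\<lambda>x. Re (g x))" and gI: "continuous_on {0..1} (\<lambda>x. Im (g x))"
    using gc by (auto intro: continuous_intros)
  obtain p where p: "real_polynomial_function p" "\<And>x. x \<in> {0..1} \<Longrightarrow> \<bar>Re (g x) - p x\<bar> < e / 2"
    using Stone_Weierstrass_real_polynomial_function[OF compact_Icc gR e2] by blast
  obtain q where q: "real_polynomial_function q" "\<And>x. x \<in> {0..1} \<Longrightarrow> \<bar>Im (g x) - q x\<bar> < e / 2"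
    using Stone_Weierstrass_real_polynomial_function[OF compact_Icc gI e2] by blast
  obtain a n where a: "p = (\<lambda>x. \<Sum>i\<le>n. a i * x ^ i)" using p(1) real_polynomial_function_iff_sum by blast
  obtain b k where b: "q = (\<lambda>x. \<Sum>i\<le>k. b i * x ^ i)" using q(1) real_polynomial_function_iff_sum by blast
  define c where "c i = Complex (if i \<le> n then a i else 0) (if i \<le> k then b i else 0)" for i
  have cs: "(\<Sum>i\<le>n+k. c i * of_real (x ^ i)) = Complex (p x) (q x)" for x
  proof (rule complex_eqI)
    have "(\<Sum>i\<le>n+k. (if i \<le> n then a i else 0) * x ^ i) = (\<Sum>i\<le>n. a i * x ^ i)"
      by (rule sum.mono_neutral_cong_right) auto
    then show "Re (\<Sum>i\<le>n+k. c i * of_real (x ^ i)) = Re (Complex (p x) (q x))" by (simp add: c_def a)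
    have "(\<Sum>i\<le>n+k. (if i \<le> k then b i else 0) * x ^ i) = (\<Sum>i\<le>k. b i * x ^ i)"
      by (rule sum.mono_neutral_cong_right) auto
    then show "Im (\<Sum>i\<le>n+k. c i * of_real (x ^ i)) = Im (Complex (p x) (q x))" by (simp add: c_def b)
  qed
  show ?thesis
  proof (intro exI[of _ c] exI[of _ "n + k"] allI impI)
    fix t :: real assume t: "0 \<le> t"
    define x where "x = exp (- t)"
    have x: "0 < x" "x \<le> 1" using t by (auto simp: x_def)
    have "norm (g x - Complex (p x) (q x)) \<le> \<bar>Re (g x - Complex (p x) (q x))\<bar> + \<bar>Im (g x - Complex (p x) (q x))\<bar>"
      by (rule cmod_le)
    also have "\<dots> \<le> e / 2 + e / 2" using p(2)[of x] q(2)[of x] x by (intro add_mono) auto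
    finally have le: "norm (g x - Complex (p x) (q x)) \<le> e" by simp
    have gx: "g x = of_real (inverse (x ^ N)) * \<psi> t" using x by (simp add: g_def x_def)
    have xN: "x ^ N = exp (- real N * t)" by (simp add: x_def exp_of_nat_mult[symmetric])
    have ex: "exp (- (of_nat j * complex_of_real t)) = of_real (x ^ j)" for j
      by (simp add: x_def exp_of_nat_mult[symmetric] exp_of_real[symmetric])
    have "\<psi> t - (\<Sum>i\<le>n+k. c i * exp (- (of_nat (N + i) * of_real t))) =
        of_real (x ^ N) * (g x - Complex (p x) (q x))"
      unfolding ex cs[symmetric] gx using x(1)
      by (simp add: right_diff_distrib sum_distrib_left power_add mult_ac del: of_nat_add)
    then have "norm (\<psi> t - (\<Sum>i\<le>n+k. c i * exp (- (of_nat (N + i) * of_real t)))) =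
       x ^ N * norm (g x - Complex (p x) (q x))"
      using x by (simp add: norm_mult norm_power)
    also have "\<dots> \<le> x ^ N * e" using le x by (intro mult_left_mono) auto
    finally show "norm (\<psi> t - (\<Sum>i\<le>n+k. c i * exp (- (of_nat (N + i) * of_real t)))) \<le> e * exp (- real N * t)"
      by (simp add: xN mult.commute)
  qed
qed

text \<open>
  By approximation all integrals of \<open>k\<close> against continuous functions of bounded support vanish, in the
  limit also the integrals over \<open>{0..c}\<close>; differentiation with respect to \<open>c\<close> gives \<open>k\<close> back.
\<close>

lemma exponential_moments_zero_AE:
  fixes k :: "real \<Rightarrow> complex"
  assumes int: "integrable lebesgue k" and neg: "\<And>t. t < 0 \<Longrightarrow> k t = 0"
    and mom: "\<And>i. (LINT t|lebesgue. exp (- (of_nat i * of_real t)) * k t) = 0"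
  shows "AE t in lebesgue. 0 < t \<longrightarrow> k t = 0"
proof -
  have [measurable]: "k \<in> borel_measurable lebesgue" using int by auto
  have cts0: "(LINT t|lebesgue. \<psi> t * k t) = 0"
    if cont: "continuous_on UNIV \<psi>" and vanish: "\<And>t. r < t \<Longrightarrow> \<psi> t = 0" and bd: "\<And>t. norm (\<psi> t) \<le> 1"
    for \<psi> :: "real \<Rightarrow> complex" and r
  proof -
    have [measurable]: "\<psi> \<in> borel_measurable lebesgue"
      using borel_measurable_continuous_onI[OF cont] by (simp add: measurable_completion)
    have intp: "integrable lebesgue (\<lambda>t. \<psi> t * k t)"
      by (rule Bochner_Integration.integrable_bound[OF int])
         (auto simp: norm_mult intro!: mult_left_le_one_le bd)
    have exk: "integrable lebesgue (\<lambda>t. exp (- (of_nat i * of_real t)) * k t)" for i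
    proof (rule Bochner_Integration.integrable_bound[OF int])
      show "AE x in lebesgue. norm (exp (- (of_nat i * of_real x)) * k x) \<le> norm (k x)"
      proof (rule AE_I2)
        fix x show "norm (exp (- (of_nat i * of_real x)) * k x) \<le> norm (k x)"
          by (cases "x < 0") (auto simp: neg norm_mult intro!: mult_left_le_one_le)
      qed
      have "(\<lambda>t. exp (- (of_nat i * of_real t)) :: complex) \<in> borel_measurable borel"
        by (intro borel_measurable_continuous_onI continuous_intros)
      then have [measurable]: "(\<lambda>t. exp (- (of_nat i * of_real t)) :: complex) \<in> borel_measurable lebesgue"
        by (simp add: measurable_completion)
      show "(\<lambda>t. exp (- (of_nat i * of_real t)) * k t) \<in> borel_measurable lebesgue" by measurable
    qed
    have "norm (LINT t|lebesgue. \<psi> t * k t) \<le> e * (LINT t|lebesgue. norm (k t))" if e: "0 < e" for e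
    proof -
      obtain c m where c: "\<And>t. 0 \<le> t \<Longrightarrow> norm (\<psi> t - (\<Sum>i\<le>m. c i * exp (- (of_nat (0 + i) * of_real t)))) \<le> e * exp (- real 0 * t)"
        using exponential_sum_approximation[OF cont vanish e, of r 0] by blast
      let ?Q = "\<lambda>t. \<Sum>i\<le>m. c i * (exp (- (of_nat i * of_real t)) * k t)"
      have isum: "integrable lebesgue ?Q"
        by (intro Bochner_Integration.integrable_sum integrable_mult_right exk)
      have "(LINT t|lebesgue. \<psi> t * k t) =
          (LINT t|lebesgue. \<psi> t * k t) - (LINT t|lebesgue. ?Q t)"
        by (simp add: Bochner_Integration.integral_sum exk mom)
      also have "\<dots> = (LINT t|lebesgue. \<psi> t * k t - ?Q t)"
        by (rule Bochner_Integration.integral_diff[symmetric, OF intp isum])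
      finally have eq: "(LINT t|lebesgue. \<psi> t * k t) =
          (LINT t|lebesgue. \<psi> t * k t - ?Q t)" .
      have "norm (LINT t|lebesgue. \<psi> t * k t) \<le>
          (LINT t|lebesgue. norm (\<psi> t * k t - ?Q t))"
        by (subst eq) (rule integral_norm_bound)
      also have "\<dots> \<le> (LINT t|lebesgue. e * norm (k t))"
      proof (rule integral_mono)
        fix t :: real
        show "norm (\<psi> t * k t - ?Q t) \<le> e * norm (k t)"
        proof (cases "t < 0")
          case False
          have "\<psi> t * k t - ?Q t =
              (\<psi> t - (\<Sum>i\<le>m. c i * exp (- (of_nat (0 + i) * of_real t)))) * k t"
            by (simp add: left_diff_distrib sum_distrib_right mult.assoc)
          then show ?thesis using c[of t] False by (auto simp: norm_mult intro!: mult_right_mono)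
        qed (simp add: neg)
      qed (use int intp isum in auto)
      finally show ?thesis by simp
    qed
    note bound = this
    show ?thesis
    proof (rule ccontr)
      assume "(LINT t|lebesgue. \<psi> t * k t) \<noteq> 0"
      then have pos: "0 < norm (LINT t|lebesgue. \<psi> t * k t)" by simp
      define I where "I = (LINT t|lebesgue. norm (k t))"
      have I: "0 \<le> I" by (simp add: I_def)
      define e where "e = norm (LINT t|lebesgue. \<psi> t * k t) / (2 * (I + 1))"
      have "e > 0" using pos I by (simp add: e_def)
      from bound[OF this] have "norm (LINT t|lebesgue. \<psi> t * k t) \<le> e * I" by (simp add: I_def)
      also have "\<dots> \<le> e * (I + 1)" using \<open>e > 0\<close> by simp
      also have "\<dots> = norm (LINT t|lebesgue. \<psi> t * k t) / 2" using I by (simp add: e_def field_simps)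
      finally show False using pos by simp
    qed
  qed
  have ind: "(LINT t|lebesgue. indicator {..c} t *\<^sub>R k t) = 0" for c
  proof -
    define \<psi> :: "nat \<Rightarrow> real \<Rightarrow> complex" where
      "\<psi> j t = of_real (max 0 (min 1 (1 - real (Suc j) * (t - c))))" for j t
    \<comment> \<open>The cut-offs \<open>\<psi> j\<close> decrease to the indicator of \<open>{..c}\<close>.\<close>
    have z: "(LINT t|lebesgue. \<psi> j t * k t) = 0" for j
    proof (rule cts0)
      show "continuous_on UNIV (\<psi> j)" unfolding \<psi>_def by (intro continuous_intros)
      fix t assume t: "c + 1 < t"
      then have "1 \<le> real (Suc j) * (t - c)" by (intro mult_ge1_I) auto
      then show "\<psi> j t = 0" unfolding \<psi>_def by (auto simp: max_def)
    qed (auto simp: \<psi>_def)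
    have "(\<lambda>j. LINT t|lebesgue. \<psi> j t * k t) \<longlonglongrightarrow> (LINT t|lebesgue. indicator {..c} t *\<^sub>R k t)"
    proof (rule integral_dominated_convergence[where w="\<lambda>t. norm (k t)"])
      show "AE x in lebesgue. (\<lambda>i. \<psi> i x * k x) \<longlonglongrightarrow> indicator {..c} x *\<^sub>R k x"
      proof (rule AE_I2)
        fix x
        have "(\<lambda>i. \<psi> i x) \<longlonglongrightarrow> indicator {..c} x"
        proof (cases "x \<le> c")
          case True
          then have "\<psi> i x = 1" for i
            unfolding \<psi>_def by (auto simp: max_def min_def mult_nonneg_nonpos)
          then show ?thesis using True by simp
        next
          case False
          then obtain j0 :: nat where j0: "1 / (x - c) < real j0" using reals_Archimedean2 by blast
          have "\<psi> i x = 0" if "i \<ge> j0" for i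
          proof -
            have "1 < real j0 * (x - c)" using j0 False by (simp add: field_simps)
            also have "\<dots> \<le> real (Suc i) * (x - c)" using that False by (intro mult_right_mono) auto
            finally show ?thesis unfolding \<psi>_def by (auto simp: max_def)
          qed
          then have "\<forall>\<^sub>F i in sequentially. \<psi> i x = 0" by (auto simp: eventually_sequentially)
          then show ?thesis using False by (simp add: tendsto_eventually)
        qed
        then have "(\<lambda>i. \<psi> i x * k x) \<longlonglongrightarrow> indicator {..c} x * k x" by (rule tendsto_mult_right)
        then show "(\<lambda>i. \<psi> i x * k x) \<longlonglongrightarrow> indicator {..c} x *\<^sub>R k x" by (cases "x \<le> c") auto
      qed
      have "\<psi> i \<in> borel_measurable borel" for i
        unfolding \<psi>_def by (intro borel_measurable_continuous_onI continuous_intros)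
      then have [measurable]: "\<psi> i \<in> borel_measurable lebesgue" for i
        by (simp add: measurable_completion)
      show "(\<lambda>t. \<psi> i t * k t) \<in> borel_measurable lebesgue" for i by measurable
      show "AE x in lebesgue. norm (\<psi> i x * k x) \<le> norm (k x)" for i
        by (auto simp: \<psi>_def norm_mult intro!: mult_left_le_one_le)
      show "(\<lambda>t. indicator {..c} t *\<^sub>R k t) \<in> borel_measurable lebesgue"
        by (intro borel_measurable_scaleR borel_measurable_indicator) auto
      show "integrable lebesgue (\<lambda>t. norm (k t))" using int by auto
    qed
    then show ?thesis by (simp add: z LIMSEQ_const_iff)
  qed
  obtain g where [measurable]: "g \<in> borel_measurable borel" and g: "AE x in lborel. k x = g x"
    using lebesgue_complex_ex_borel[of k] by auto
  have geq: "AE x in lebesgue. k x = g x" using g by (simp add: AE_completion_iff)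
  have gm: "g \<in> borel_measurable lebesgue" by (simp add: measurable_completion)
  have gint: "integrable lborel g"
    using integrable_cong_AE[OF _ gm geq] int by (simp add: integrable_completion)
  have gi: "(LINT t|lborel. indicator {..c} t *\<^sub>R g t) = 0" for c
  proof -
    have "(LINT t|lborel. indicator {..c} t *\<^sub>R g t) = (LINT t|lebesgue. indicator {..c} t *\<^sub>R g t)"
      by (rule integral_completion[symmetric]) measurable
    also have "\<dots> = (LINT t|lebesgue. indicator {..c} t *\<^sub>R k t)"
      by (rule integral_cong_AE) (use geq in \<open>auto intro!: borel_measurable_scaleR borel_measurable_indicator gm\<close>)
    finally show ?thesis by (simp add: ind)
  qed
  have gii: "integrable lborel (\<lambda>t. indicator A t *\<^sub>R g t)" if "A \<in> sets borel" for A
    using that gint by (intro integrable_mult_indicator) auto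
  have "(LINT y:{u..v}|lborel. g y) = 0" if uv: "u \<le> v" for u v
  proof -
    have "(LINT y:{u..v}|lborel. g y) = (LINT y|lborel. indicator {..v} y *\<^sub>R g y - indicator {..u} y *\<^sub>R g y)"
      unfolding set_lebesgue_integral_def
    proof (rule integral_cong_AE)
      show "AE x in lborel. indicator {u..v} x *\<^sub>R g x = indicator {..v} x *\<^sub>R g x - indicator {..u} x *\<^sub>R g x"
        using AE_lborel_singleton[of u] by eventually_elim (use uv in \<open>auto simp: indicator_def\<close>)
    qed auto
    also have "\<dots> = 0" using gii by (subst Bochner_Integration.integral_diff) (auto simp: gi)
    finally show ?thesis .
  qed
  then have "AE x in lborel. 0 < x \<longrightarrow> ((\<lambda>_. 0) has_vector_derivative g x) (at x)"
    by (intro lebesgue_differentiation) (auto simp: set_integrable_def gii)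
  then have "AE x in lborel. 0 < x \<longrightarrow> k x = 0"
    using g by eventually_elim (use has_vector_derivative_const vector_derivative_unique_at in metis)
  then show ?thesis by (simp add: AE_completion_iff)
qed

section \<open>Laplace transforms of causal convolutions\<close>

lemma lebesgue_measurable_cong_AE:
  fixes f g :: "real \<Rightarrow> complex"
  assumes g: "g \<in> borel_measurable borel" and eq: "AE x in lborel. f x = g x"
  shows "f \<in> borel_measurable lebesgue"
proof (rule measurableI)
  fix A :: "complex set" assume A: "A \<in> sets borel"
  have gm: "g \<in> borel_measurable lebesgue" using g by (simp add: measurable_completion)
  have "g -` A \<inter> space lebesgue \<in> sets lebesgue" by (rule measurable_sets[OF gm A])
  moreover have "AE x in lebesgue. (x \<in> g -` A \<inter> space lebesgue) = (x \<in> f -` A \<inter> space lebesgue)"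
    using eq unfolding AE_completion_iff by eventually_elim auto
  ultimately show "f -` A \<inter> space lebesgue \<in> sets lebesgue"
    using completion.in_sets_AE[of "g -` A \<inter> space lebesgue" "f -` A \<inter> space lebesgue" lborel] by simp
qed auto

lemma lebesgue_transfer:
  fixes f g :: "real \<Rightarrow> complex"
  assumes g: "g \<in> borel_measurable borel" and eq: "AE x in lborel. f x = g x"
  shows lebesgue_integrable_transfer: "integrable lebesgue f \<longleftrightarrow> integrable lborel g"
    and lebesgue_integral_transfer: "integral\<^sup>L lebesgue f = integral\<^sup>L lborel g"
proof -
  have f: "f \<in> borel_measurable lebesgue" by (rule lebesgue_measurable_cong_AE[OF assms])
  have gm: "g \<in> borel_measurable lebesgue" using g by (simp add: measurable_completion)
  have eq': "AE x in lebesgue. f x = g x" using eq by (simp add: AE_completion_iff)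
  show "integrable lebesgue f \<longleftrightarrow> integrable lborel g"
    using integrable_cong_AE[OF f gm eq'] g by (simp add: integrable_completion)
  show "integral\<^sup>L lebesgue f = integral\<^sup>L lborel g"
    using integral_cong_AE[OF f gm eq'] g by (simp add: integral_completion)
qed

text \<open>
  Fubini for \<open>k (t - \<tau>) * v \<tau>\<close>, whose integral in \<open>t\<close> does not see the shift by \<open>\<tau>\<close>.
\<close>

lemma lborel_convolution:
  fixes k v :: "real \<Rightarrow> complex"
  assumes k: "integrable lborel k" and v: "integrable lborel v"
  shows "AE t in lborel. integrable lborel (\<lambda>\<tau>. k (t - \<tau>) * v \<tau>)"
    and "integrable lborel (\<lambda>t. LINT \<tau>|lborel. k (t - \<tau>) * v \<tau>)"
    and "(LINT t|lborel. (LINT \<tau>|lborel. k (t - \<tau>) * v \<tau>)) = integral\<^sup>L lborel k * integral\<^sup>L lborel v"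
proof -
  have [measurable]: "k \<in> borel_measurable borel" "v \<in> borel_measurable borel" using k v by auto
  have shift_int: "integrable lborel (\<lambda>t. k (t - \<tau>))" for \<tau>
    using lborel_integrable_real_affine[OF k, of 1 "- \<tau>"] by simp
  have shift: "(LINT t|lborel. k (t - \<tau>)) = integral\<^sup>L lborel k" for \<tau>
    using lborel_integral_real_affine[of 1 k "- \<tau>"] by simp
  have shiftn: "(LINT t|lborel. norm (k (t - \<tau>))) = (LINT t|lborel. norm (k t))" for \<tau>
    using lborel_integral_real_affine[of 1 "\<lambda>t. norm (k t)" "- \<tau>"] by simp
  have I: "integrable (lborel \<Otimes>\<^sub>M lborel) (\<lambda>(\<tau>, t). k (t - \<tau>) * v \<tau>)"
  proof (rule lborel_pair.Fubini_integrable)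
    show "integrable lborel (\<lambda>\<tau>. LINT t|lborel. norm (case (\<tau>, t) of (\<tau>, t) \<Rightarrow> k (t - \<tau>) * v \<tau>))"
      using v by (simp add: norm_mult shiftn)
    show "AE \<tau> in lborel. integrable lborel (\<lambda>t. case (\<tau>, t) of (\<tau>, t) \<Rightarrow> k (t - \<tau>) * v \<tau>)"
      using shift_int by auto
  qed measurable
  show "AE t in lborel. integrable lborel (\<lambda>\<tau>. k (t - \<tau>) * v \<tau>)"
    by (rule lborel_pair.AE_integrable_snd[OF I])
  show "integrable lborel (\<lambda>t. LINT \<tau>|lborel. k (t - \<tau>) * v \<tau>)"
    by (rule lborel_pair.integrable_snd[OF I])
  have "(LINT t|lborel. (LINT \<tau>|lborel. k (t - \<tau>) * v \<tau>)) = (LINT \<tau>|lborel. (LINT t|lborel. k (t - \<tau>) * v \<tau>))"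
    using lborel_pair.integral_snd[OF I] lborel_pair.integral_fst[OF I] by simp
  also have "\<dots> = integral\<^sup>L lborel k * integral\<^sup>L lborel v"
    using shift_int by (simp add: shift)
  finally show "(LINT t|lborel. (LINT \<tau>|lborel. k (t - \<tau>) * v \<tau>)) = integral\<^sup>L lborel k * integral\<^sup>L lborel v" .
qed

abbreviation laplace_integrable :: "(real \<Rightarrow> complex) \<Rightarrow> complex \<Rightarrow> bool" where
  "laplace_integrable V s \<equiv> set_integrable lebesgue {0..} (\<lambda>t. exp (- (s * of_real t)) * V t)"

lemma causal_borel_version:
  fixes V :: "real \<Rightarrow> complex" and s :: complex
  assumes "laplace_integrable V s"
  obtains W where "W \<in> borel_measurable borel" "\<And>t. t < 0 \<Longrightarrow> W t = 0"
    "AE t in lborel. 0 \<le> t \<longrightarrow> V t = W t"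
    "integrable lborel (\<lambda>t. exp (- (s * of_real t)) * W t)"
    "(LINT t|lborel. exp (- (s * of_real t)) * W t) = laplace V s"
proof -
  define k where "k t = indicator {0..} t *\<^sub>R (exp (- (s * of_real t)) * V t)" for t
  have k: "integrable lebesgue k" using assms by (simp add: set_integrable_def k_def[abs_def])
  then obtain g where [measurable]: "g \<in> borel_measurable borel" and g: "AE t in lborel. k t = g t"
    using lebesgue_complex_ex_borel[of k] by auto
  have [measurable]: "(\<lambda>t. exp (c * complex_of_real t)) \<in> borel_measurable borel" for c
    by (intro borel_measurable_continuous_onI continuous_intros)
  have [measurable]: "(\<lambda>t. exp (- (c * complex_of_real t))) \<in> borel_measurable borel" for c
    by (intro borel_measurable_continuous_onI continuous_intros)
  define W where "W t = (if t < 0 then 0 else exp (s * of_real t) * g t)" for t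
  have W[measurable]: "W \<in> borel_measurable borel" unfolding W_def by measurable
  have keq: "AE t in lborel. k t = exp (- (s * of_real t)) * W t"
    using g by eventually_elim (auto simp: k_def W_def indicator_def exp_minus field_simps)
  show ?thesis
  proof
    show "AE t in lborel. 0 \<le> t \<longrightarrow> V t = W t"
      using g by eventually_elim (auto simp: k_def W_def exp_minus field_simps)
    show "integrable lborel (\<lambda>t. exp (- (s * of_real t)) * W t)"
      using lebesgue_integrable_transfer[OF _ keq] k by simp
    show "(LINT t|lborel. exp (- (s * of_real t)) * W t) = laplace V s"
      using lebesgue_integral_transfer[OF _ keq] by (simp add: laplace_def k_def[abs_def] set_lebesgue_integral_def)
  qed (auto simp: W_def)
qed

definition causal_convolution :: "(real \<Rightarrow> complex) \<Rightarrow> (real \<Rightarrow> complex) \<Rightarrow> real \<Rightarrow> complex" where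
  "causal_convolution K V t = (LINT \<tau>:{0..t}|lebesgue. K (t - \<tau>) * V \<tau>)"

text \<open>
  The factor \<open>exp (- (s * t))\<close> splits as \<open>exp (- (s * (t - \<tau>))) * exp (- (s * \<tau>))\<close>, which reduces the
  claim to the unweighted convolution of two integrable functions.
\<close>

lemma laplace_causal_convolution:
  fixes K V :: "real \<Rightarrow> complex" and s :: complex
  assumes K: "laplace_integrable K s"
    and V: "laplace_integrable V s"
  shows "AE t in lebesgue. 0 < t \<longrightarrow> set_integrable lebesgue {0..t} (\<lambda>\<tau>. K (t - \<tau>) * V \<tau>)"
    and "laplace_integrable (causal_convolution K V) s"
    and "laplace (causal_convolution K V) s = laplace K s * laplace V s"
proof -
  obtain k where k: "k \<in> borel_measurable borel" "\<And>t. t < 0 \<Longrightarrow> k t = 0"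
    "AE t in lborel. 0 \<le> t \<longrightarrow> K t = k t"
    "integrable lborel (\<lambda>t. exp (- (s * of_real t)) * k t)"
    "(LINT t|lborel. exp (- (s * of_real t)) * k t) = laplace K s"
    using causal_borel_version[OF K] by blast
  obtain v where v: "v \<in> borel_measurable borel" "\<And>t. t < 0 \<Longrightarrow> v t = 0"
    "AE t in lborel. 0 \<le> t \<longrightarrow> V t = v t"
    "integrable lborel (\<lambda>t. exp (- (s * of_real t)) * v t)"
    "(LINT t|lborel. exp (- (s * of_real t)) * v t) = laplace V s"
    using causal_borel_version[OF V] by blast
  note [measurable] = k(1) v(1)
  have [measurable]: "(\<lambda>t. exp (- (c * complex_of_real t))) \<in> borel_measurable borel" for c
    by (intro borel_measurable_continuous_onI continuous_intros)
  obtain N where N: "N \<in> null_sets lborel" "{t \<in> space lborel. \<not> (0 \<le> t \<longrightarrow> K t = k t)} \<subseteq> N"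
    using k(3) unfolding eventually_ae_filter by blast
  have NK: "K x = k x" if "x \<notin> N" "0 \<le> x" for x using N(2) that by auto
  have Nr: "AE \<tau> in lborel. t - \<tau> \<notin> N" for t
  proof -
    have [measurable]: "N \<in> sets borel" using N by auto
    have "AE x in lborel. x \<notin> N" by (rule AE_not_in[OF N(1)])
    from AE_borel_affine[of "-1" "\<lambda>x. x \<notin> N" t, OF _ _ this] show ?thesis by simp
  qed
  have eq: "AE \<tau> in lborel. indicator {0..t} \<tau> *\<^sub>R (K (t - \<tau>) * V \<tau>) = k (t - \<tau>) * v \<tau>" for t
    using Nr[of t] v(3)
  proof eventually_elim
    case (elim \<tau>)
    show ?case
    proof (cases "0 \<le> \<tau> \<and> \<tau> \<le> t")
      case True
      then have "K (t - \<tau>) = k (t - \<tau>)" using elim(1) NK by simp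
      then show ?thesis using True elim(2) by simp
    next
      case False
      then have "k (t - \<tau>) = 0 \<or> v \<tau> = 0" using k(2)[of "t - \<tau>"] v(2)[of \<tau>] by auto
      then show ?thesis using False by auto
    qed
  qed
  have conv: "causal_convolution K V t = (LINT \<tau>|lborel. k (t - \<tau>) * v \<tau>)" for t
    unfolding causal_convolution_def set_lebesgue_integral_def
    by (rule lebesgue_integral_transfer[OF _ eq]) measurable
  have ee: "exp (- (s * of_real (t - \<tau>))) * k (t - \<tau>) * (exp (- (s * of_real \<tau>)) * v \<tau>) =
      exp (- (s * of_real t)) * (k (t - \<tau>) * v \<tau>)" for t \<tau>
    by (simp add: algebra_simps exp_diff exp_minus divide_inverse)
  note C = lborel_convolution[OF k(4) v(4), unfolded ee]
  have "AE t in lborel. integrable lborel (\<lambda>\<tau>. k (t - \<tau>) * v \<tau>)"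
    using C(1)
  proof eventually_elim
    case (elim t)
    from integrable_mult_right[OF this, of "exp (s * of_real t)"] show ?case
      by (simp add: mult.assoc[symmetric] exp_minus)
  qed
  then have "AE t in lborel. 0 < t \<longrightarrow> set_integrable lebesgue {0..t} (\<lambda>\<tau>. K (t - \<tau>) * V \<tau>)"
  proof eventually_elim
    case (elim t)
    then show ?case using lebesgue_integrable_transfer[OF _ eq[of t]] by (simp add: set_integrable_def)
  qed
  then show "AE t in lebesgue. 0 < t \<longrightarrow> set_integrable lebesgue {0..t} (\<lambda>\<tau>. K (t - \<tau>) * V \<tau>)"
    by (simp add: AE_completion_iff)
  have neg: "(LINT \<tau>|lborel. k (t - \<tau>) * v \<tau>) = 0" if "t < 0" for t
  proof -
    have "k (t - \<tau>) * v \<tau> = 0" for \<tau> using k(2)[of "t - \<tau>"] v(2)[of \<tau>] that by (cases "\<tau> < 0") auto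
    then have "(\<lambda>\<tau>. k (t - \<tau>) * v \<tau>) = (\<lambda>\<tau>. 0)" by (rule ext)
    then show ?thesis by simp
  qed
  have eq2: "AE t in lborel. indicator {0..} t *\<^sub>R (exp (- (s * of_real t)) * causal_convolution K V t) =
      exp (- (s * of_real t)) * (LINT \<tau>|lborel. k (t - \<tau>) * v \<tau>)"
    by (rule AE_I2) (auto simp: conv neg indicator_def)
  have m: "(\<lambda>t. exp (- (s * of_real t)) * (LINT \<tau>|lborel. k (t - \<tau>) * v \<tau>)) \<in> borel_measurable borel"
    by measurable
  show "laplace_integrable (causal_convolution K V) s"
    unfolding set_integrable_def lebesgue_integrable_transfer[OF m eq2] using C(2) by simp
  show "laplace (causal_convolution K V) s = laplace K s * laplace V s"
    unfolding laplace_def set_lebesgue_integral_def lebesgue_integral_transfer[OF m eq2]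
    using C(3) by (simp add: k(5) v(5) laplace_def set_lebesgue_integral_def)
qed

section \<open>Test functions of exponential decay\<close>

abbreviation laplace_kernel :: "complex \<Rightarrow> real \<Rightarrow> complex" where
  "laplace_kernel s \<equiv> \<lambda>t. exp (- (s * of_real t))"


lemma nth_deriv_0 [simp]: "nth_deriv 0 \<phi> = \<phi>" by (simp add: nth_deriv_def)

lemma nth_deriv_Suc: "nth_deriv (Suc k) \<phi> t = vector_derivative (nth_deriv k \<phi>) (at t)"
  by (simp add: nth_deriv_def)

lemma nth_deriv_nth_deriv: "nth_deriv j (nth_deriv k \<phi>) = nth_deriv (j + k) \<phi>"
  by (simp add: nth_deriv_def funpow_add)

lemma smooth_has_vector_derivative:
  "smooth \<phi> \<Longrightarrow> (nth_deriv k \<phi> has_vector_derivative nth_deriv (Suc k) \<phi> t) (at t)"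
  by (simp add: smooth_def nth_deriv_Suc vector_derivative_works[symmetric])

text \<open>
  Guessing the whole sequence of derivatives and checking one step is enough; this avoids any
  computation with iterated \<open>vector_derivative\<close> below.
\<close>

lemma derivative_chain_nth_deriv:
  assumes "\<And>k t. (\<Phi> k has_vector_derivative \<Phi> (Suc k) t) (at t)"
  shows "nth_deriv k (\<Phi> 0) = \<Phi> k"
proof (induction k)
  case (Suc k)
  show ?case
    by (rule ext) (simp add: nth_deriv_Suc Suc.IH vector_derivative_at[OF assms])
qed simp

lemma derivative_chain_smooth:
  assumes "\<And>k t. (\<Phi> k has_vector_derivative \<Phi> (Suc k) t) (at t)"
  shows "smooth (\<Phi> 0)"
  unfolding smooth_def derivative_chain_nth_deriv[of \<Phi>, OF assms]
  using assms by (meson differentiableI_vector)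

lemma smooth_nth_deriv: "smooth \<phi> \<Longrightarrow> smooth (nth_deriv k \<phi>)"
  by (simp add: smooth_def nth_deriv_nth_deriv)

lemma smooth_continuous: "smooth \<phi> \<Longrightarrow> continuous_on S (nth_deriv k \<phi>)"
  unfolding smooth_def
  by (meson continuous_at_imp_continuous_on differentiable_imp_continuous_within)

lemma exp_test_smooth: "\<phi> \<in> exp_test_functions a \<Longrightarrow> smooth \<phi>"
  by (simp add: exp_test_functions_def)

lemma derivative_chain_exp_test:
  assumes d: "\<And>k t. (\<Phi> k has_vector_derivative \<Phi> (Suc k) t) (at t)"
    and b: "\<And>k. \<exists>M. \<forall>t\<ge>0. exp (a * t) * norm (\<Phi> k t) \<le> M"
  shows "\<Phi> 0 \<in> exp_test_functions a"
  unfolding exp_test_functions_def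
proof (clarsimp, intro conjI allI)
  show "smooth (\<Phi> 0)" by (rule derivative_chain_smooth[of \<Phi>, OF d])
  fix k
  obtain M where "\<forall>t\<ge>0. exp (a * t) * norm (\<Phi> k t) \<le> M" using b by blast
  then show "bdd_above ((\<lambda>t. exp (a * t) * norm (nth_deriv k (\<Phi> 0) t)) ` {0..})"
    unfolding derivative_chain_nth_deriv[of \<Phi>, OF d] by (intro bdd_aboveI[of _ M]) auto
qed

lemma exp_test_bounded:
  assumes "\<phi> \<in> exp_test_functions a"
  shows "\<exists>M. \<forall>t\<ge>0. exp (a * t) * norm (nth_deriv k \<phi> t) \<le> M"
  using assms unfolding exp_test_functions_def bdd_above_def by fastforce

lemma exp_seminorm_upper:
  assumes \<phi>: "\<phi> \<in> exp_test_functions a" and t: "0 \<le> t" and k: "k \<le> n"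
  shows "exp (a * t) * norm (nth_deriv k \<phi> t) \<le> exp_seminorm a n \<phi>"
proof -
  have bdd: "bdd_above ((\<lambda>t. exp (a * t) * norm (nth_deriv j \<phi> t)) ` {0..})" for j
    using \<phi> by (simp add: exp_test_functions_def)
  have nn: "0 \<le> (SUP t\<in>{0..}. exp (a * t) * norm (nth_deriv j \<phi> t))" for j
    by (rule cSUP_upper2[OF bdd, of 0]) auto
  have "exp (a * t) * norm (nth_deriv k \<phi> t) \<le> (SUP t\<in>{0..}. exp (a * t) * norm (nth_deriv k \<phi> t))"
    by (rule cSUP_upper[OF _ bdd]) (use t in auto)
  also have "\<dots> \<le> exp_seminorm a n \<phi>"
    unfolding exp_seminorm_def by (rule member_le_sum) (use k nn in auto)
  finally show ?thesis .
qed

lemma exp_seminorm_least: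
  assumes "\<And>k t. k \<le> n \<Longrightarrow> 0 \<le> t \<Longrightarrow> exp (a * t) * norm (nth_deriv k \<phi> t) \<le> M"
  shows "exp_seminorm a n \<phi> \<le> real (Suc n) * M"
proof -
  have "exp_seminorm a n \<phi> \<le> of_nat (card {..n}) * M"
    unfolding exp_seminorm_def by (rule sum_bounded_above) (auto intro!: cSUP_least assms)
  then show ?thesis by simp
qed

lemma exp_seminorm_nonneg:
  assumes "\<phi> \<in> exp_test_functions a" shows "0 \<le> exp_seminorm a n \<phi>"
  using exp_seminorm_upper[OF assms, of 0 0 n] by (auto intro: order_trans[rotated])

lemma
  assumes \<phi>: "\<phi> \<in> exp_test_functions a" and \<theta>: "\<theta> \<in> exp_test_functions a"
  shows exp_test_add: "(\<lambda>t. \<phi> t + \<theta> t) \<in> exp_test_functions a"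
    and nth_deriv_add: "nth_deriv k (\<lambda>t. \<phi> t + \<theta> t) t = nth_deriv k \<phi> t + nth_deriv k \<theta> t"
proof -
  define \<Phi> where "\<Phi> k t = nth_deriv k \<phi> t + nth_deriv k \<theta> t" for k t
  have d: "(\<Phi> k has_vector_derivative \<Phi> (Suc k) t) (at t)" for k t
    unfolding \<Phi>_def using \<phi> \<theta>
    by (intro has_vector_derivative_add smooth_has_vector_derivative exp_test_smooth)
  have "\<exists>M. \<forall>t\<ge>0. exp (a * t) * norm (\<Phi> k t) \<le> M" for k
  proof -
    obtain M1 M2 where M: "\<forall>t\<ge>0. exp (a * t) * norm (nth_deriv k \<phi> t) \<le> M1"
       "\<forall>t\<ge>0. exp (a * t) * norm (nth_deriv k \<theta> t) \<le> M2"
      using exp_test_bounded \<phi> \<theta> by meson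
    have "exp (a * t) * norm (\<Phi> k t) \<le> M1 + M2" if "0 \<le> t" for t
    proof -
      have "exp (a * t) * norm (\<Phi> k t) \<le> exp (a * t) * (norm (nth_deriv k \<phi> t) + norm (nth_deriv k \<theta> t))"
        unfolding \<Phi>_def by (intro mult_left_mono norm_triangle_ineq) auto
      also have "\<dots> \<le> M1 + M2" using M that unfolding distrib_left by (intro add_mono) auto
      finally show ?thesis .
    qed
    then show ?thesis by blast
  qed
  then have "\<Phi> 0 \<in> exp_test_functions a" by (rule derivative_chain_exp_test[of \<Phi>, OF d])
  moreover have "\<Phi> 0 = (\<lambda>t. \<phi> t + \<theta> t)" by (auto simp: \<Phi>_def)
  ultimately show "(\<lambda>t. \<phi> t + \<theta> t) \<in> exp_test_functions a"
    "nth_deriv k (\<lambda>t. \<phi> t + \<theta> t) t = nth_deriv k \<phi> t + nth_deriv k \<theta> t"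
    using derivative_chain_nth_deriv[of \<Phi> k, OF d] by (auto simp: \<Phi>_def)
qed

lemma
  assumes \<phi>: "\<phi> \<in> exp_test_functions a"
  shows exp_test_scale: "(\<lambda>t. c * \<phi> t) \<in> exp_test_functions a"
    and nth_deriv_scale: "nth_deriv k (\<lambda>t. c * \<phi> t) t = c * nth_deriv k \<phi> t"
proof -
  define \<Phi> where "\<Phi> k t = c * nth_deriv k \<phi> t" for k t
  have d: "(\<Phi> k has_vector_derivative \<Phi> (Suc k) t) (at t)" for k t
    unfolding \<Phi>_def using \<phi>
    by (intro has_vector_derivative_mult_right smooth_has_vector_derivative exp_test_smooth)
  have "\<exists>M. \<forall>t\<ge>0. exp (a * t) * norm (\<Phi> k t) \<le> M" for k
  proof -
    obtain M where M: "\<forall>t\<ge>0. exp (a * t) * norm (nth_deriv k \<phi> t) \<le> M"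
      using exp_test_bounded \<phi> by meson
    have "exp (a * t) * norm (\<Phi> k t) \<le> norm c * M" if "0 \<le> t" for t
      using mult_left_mono[OF M[rule_format, OF that], of "norm c"]
      by (simp add: \<Phi>_def norm_mult mult_ac)
    then show ?thesis by blast
  qed
  then have "\<Phi> 0 \<in> exp_test_functions a" by (rule derivative_chain_exp_test[of \<Phi>, OF d])
  moreover have "\<Phi> 0 = (\<lambda>t. c * \<phi> t)" by (auto simp: \<Phi>_def)
  ultimately show "(\<lambda>t. c * \<phi> t) \<in> exp_test_functions a"
    "nth_deriv k (\<lambda>t. c * \<phi> t) t = c * nth_deriv k \<phi> t"
    using derivative_chain_nth_deriv[of \<Phi> k, OF d] by (auto simp: \<Phi>_def)
qed

lemma
  assumes s: "a \<le> Re s"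
  shows exp_test_exp: "(laplace_kernel s) \<in> exp_test_functions a"
    and nth_deriv_exp: "nth_deriv k (laplace_kernel s) t = (- s) ^ k * exp (- (s * of_real t))"
proof -
  define \<Phi> where "\<Phi> k t = (- s) ^ k * exp (- (s * complex_of_real t))" for k t
  have d: "(\<Phi> k has_vector_derivative \<Phi> (Suc k) t) (at t)" for k t
  proof -
    have "((\<lambda>t. exp (- (s * complex_of_real t))) has_vector_derivative - s * exp (- (s * complex_of_real t))) (at t)"
      by (rule has_vector_derivative_real_field) (auto intro!: derivative_eq_intros)
    from has_vector_derivative_mult_right[OF this, of "(- s) ^ k"]
    show ?thesis unfolding \<Phi>_def by (simp add: mult_ac)
  qed
  have "\<exists>M. \<forall>t\<ge>0. exp (a * t) * norm (\<Phi> k t) \<le> M" for k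
  proof -
    have "exp (a * t) * norm (\<Phi> k t) \<le> norm s ^ k" if "0 \<le> t" for t
    proof -
      have "exp (a * t) * norm (\<Phi> k t) = norm s ^ k * (exp (a * t) * exp (- (Re s * t)))"
        by (simp add: \<Phi>_def norm_mult norm_power mult_ac)
      also have "\<dots> \<le> norm s ^ k * 1"
        using s that by (intro mult_left_mono) (auto simp: exp_add[symmetric] mult_right_mono)
      finally show ?thesis by simp
    qed
    then show ?thesis by blast
  qed
  then have "\<Phi> 0 \<in> exp_test_functions a" by (rule derivative_chain_exp_test[of \<Phi>, OF d])
  moreover have "\<Phi> 0 = (laplace_kernel s)" by (auto simp: \<Phi>_def)
  ultimately show "(laplace_kernel s) \<in> exp_test_functions a"
    "nth_deriv k (laplace_kernel s) t = (- s) ^ k * exp (- (s * of_real t))"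
    using derivative_chain_nth_deriv[of \<Phi> k, OF d] by (auto simp: \<Phi>_def)
qed

text \<open>
  The definition bounds the derivatives on \<open>{0..}\<close> only.  A translate of a test
  function may move part of the negative axis there, where compactness provides the bound.
\<close>

lemma exp_test_halfline_bounded:
  assumes \<phi>: "\<phi> \<in> exp_test_functions a"
  shows "\<exists>M\<ge>0. \<forall>u\<ge>x. exp (a * u) * norm (nth_deriv k \<phi> u) \<le> M"
proof -
  obtain M1 where M1: "\<forall>t\<ge>0. exp (a * t) * norm (nth_deriv k \<phi> t) \<le> M1"
    using exp_test_bounded \<phi> by meson
  have "continuous_on {x..0} (\<lambda>u. exp (a * u) * norm (nth_deriv k \<phi> u))"
    by (intro continuous_intros smooth_continuous exp_test_smooth[OF \<phi>])
  then have "compact ((\<lambda>u. exp (a * u) * norm (nth_deriv k \<phi> u)) ` {x..0})"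
    by (rule compact_continuous_image) simp
  then have "bdd_above ((\<lambda>u. exp (a * u) * norm (nth_deriv k \<phi> u)) ` {x..0})"
    by (intro bounded_imp_bdd_above compact_imp_bounded)
  then obtain M2 where M2: "\<And>u. u \<in> {x..0} \<Longrightarrow> exp (a * u) * norm (nth_deriv k \<phi> u) \<le> M2"
    unfolding bdd_above_def by fastforce
  show ?thesis
  proof (intro exI[of _ "max 0 (max M1 M2)"] conjI allI impI)
    fix u assume "x \<le> u"
    then show "exp (a * u) * norm (nth_deriv k \<phi> u) \<le> max 0 (max M1 M2)"
      using M1[rule_format, of u] M2[of u] by (cases "0 \<le> u") (auto simp: le_max_iff_disj)
  qed auto
qed

lemma
  assumes \<phi>: "\<phi> \<in> exp_test_functions a"
  shows exp_test_translate: "(\<lambda>y. \<phi> (x + y)) \<in> exp_test_functions a"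
    and nth_deriv_translate: "nth_deriv k (\<lambda>y. \<phi> (x + y)) y = nth_deriv k \<phi> (x + y)"
proof -
  define \<Phi> where "\<Phi> k y = nth_deriv k \<phi> (x + y)" for k y
  have d: "(\<Phi> k has_vector_derivative \<Phi> (Suc k) t) (at t)" for k t
  proof -
    have "((nth_deriv k \<phi> \<circ> (\<lambda>y. x + y)) has_vector_derivative 1 *\<^sub>R nth_deriv (Suc k) \<phi> (x + t)) (at t)"
      by (rule vector_diff_chain_at[OF _ smooth_has_vector_derivative[OF exp_test_smooth[OF \<phi>]]])
         (auto intro!: derivative_eq_intros)
    then show ?thesis by (simp add: \<Phi>_def[abs_def] o_def)
  qed
  have "\<exists>M. \<forall>t\<ge>0. exp (a * t) * norm (\<Phi> k t) \<le> M" for k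
  proof -
    obtain M where M: "\<forall>u\<ge>x. exp (a * u) * norm (nth_deriv k \<phi> u) \<le> M"
      using exp_test_halfline_bounded[OF \<phi>] by blast
    have "exp (a * t) * norm (\<Phi> k t) \<le> exp (- (a * x)) * M" if "0 \<le> t" for t
    proof -
      have "exp (a * t) * norm (\<Phi> k t) = exp (- (a * x)) * (exp (a * (x + t)) * norm (nth_deriv k \<phi> (x + t)))"
        by (simp add: \<Phi>_def exp_add distrib_left exp_minus)
      also have "\<dots> \<le> exp (- (a * x)) * M" using M that by (intro mult_left_mono) auto
      finally show ?thesis .
    qed
    then show ?thesis by blast
  qed
  then have "\<Phi> 0 \<in> exp_test_functions a" by (rule derivative_chain_exp_test[of \<Phi>, OF d])
  moreover have "\<Phi> 0 = (\<lambda>y. \<phi> (x + y))" by (auto simp: \<Phi>_def)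
  ultimately show "(\<lambda>y. \<phi> (x + y)) \<in> exp_test_functions a"
    "nth_deriv k (\<lambda>y. \<phi> (x + y)) y = nth_deriv k \<phi> (x + y)"
    using derivative_chain_nth_deriv[of \<Phi> k, OF d] by (auto simp: \<Phi>_def)
qed

lemma exp_test_nth_deriv:
  assumes "\<phi> \<in> exp_test_functions a" shows "nth_deriv k \<phi> \<in> exp_test_functions a"
  using assms by (simp add: exp_test_functions_def smooth_nth_deriv nth_deriv_nth_deriv)

lemma test_function_deriv_vanishes:
  assumes \<phi>: "smooth \<phi>" and z: "\<And>t. r < t \<Longrightarrow> \<phi> t = 0"
  shows "r < t \<Longrightarrow> nth_deriv k \<phi> t = 0"
proof (induction k arbitrary: t)
  case (Suc k)
  have "((\<lambda>_. 0) has_vector_derivative nth_deriv (Suc k) \<phi> t) (at t)"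
    by (rule has_vector_derivative_transform_within_open[OF smooth_has_vector_derivative[OF \<phi>], of "{r<..}"])
       (use Suc in auto)
  then show ?case using has_vector_derivative_const vector_derivative_unique_at by metis
qed (simp add: z)

lemma test_function_exp_test:
  assumes "\<phi> \<in> test_functions" shows "\<phi> \<in> exp_test_functions a"
proof -
  obtain r where r: "\<And>t. r < \<bar>t\<bar> \<Longrightarrow> \<phi> t = 0" and sm: "smooth \<phi>"
    using assms by (auto simp: test_functions_def)
  have "\<exists>M. \<forall>t\<ge>0. exp (a * t) * norm (nth_deriv k \<phi> t) \<le> M" for k
  proof -
    have "continuous_on {0..r} (\<lambda>u. exp (a * u) * norm (nth_deriv k \<phi> u))"
      by (intro continuous_intros smooth_continuous sm)
    then have "compact ((\<lambda>u. exp (a * u) * norm (nth_deriv k \<phi> u)) ` {0..r})"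
      by (rule compact_continuous_image) simp
    then have "bdd_above ((\<lambda>u. exp (a * u) * norm (nth_deriv k \<phi> u)) ` {0..r})"
      by (intro bounded_imp_bdd_above compact_imp_bounded)
    then obtain M where M: "\<And>u. u \<in> {0..r} \<Longrightarrow> exp (a * u) * norm (nth_deriv k \<phi> u) \<le> M"
      unfolding bdd_above_def by fastforce
    have "exp (a * t) * norm (nth_deriv k \<phi> t) \<le> max 0 M" if "0 \<le> t" for t
    proof (cases "t \<le> r")
      case False
      then have "nth_deriv k \<phi> t = 0"
        by (intro test_function_deriv_vanishes[OF sm, of r]) (auto intro: r)
      then show ?thesis by simp
    qed (use M[of t] that in \<open>auto simp: le_max_iff_disj\<close>)
    then show ?thesis by blast
  qed
  then show ?thesis using derivative_chain_exp_test[of "\<lambda>k. nth_deriv k \<phi>" a] smooth_has_vector_derivative[OF sm]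
    by simp
qed

section \<open>Causal distributions and their convolution\<close>

text \<open>
  Continuity at a single exponential rate \<open>a\<close>.  A causal distribution has it for every rate beyond
  its abscissa, and one sufficiently large rate carries the whole argument.
\<close>

definition exp_continuous :: "real \<Rightarrow> ((real \<Rightarrow> complex) \<Rightarrow> complex) \<Rightarrow> bool" where
  "exp_continuous a U \<longleftrightarrow>
     (\<forall>\<phi>\<in>exp_test_functions a. \<forall>\<theta>\<in>exp_test_functions a. U (\<lambda>t. \<phi> t + \<theta> t) = U \<phi> + U \<theta>) \<and>
     (\<forall>\<phi>\<in>exp_test_functions a. \<forall>c. U (\<lambda>t. c * \<phi> t) = c * U \<phi>) \<and>
     (\<exists>C n. \<forall>\<phi>\<in>exp_test_functions a. norm (U \<phi>) \<le> C * exp_seminorm a n \<phi>)"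

lemma causal_distribution_exp_continuous:
  "causal_distribution \<sigma> U \<Longrightarrow> \<sigma> < a \<Longrightarrow> exp_continuous a U"
  unfolding causal_distribution_def exp_continuous_def by blast

lemma exp_continuous_add:
  "exp_continuous a U \<Longrightarrow> \<phi> \<in> exp_test_functions a \<Longrightarrow> \<theta> \<in> exp_test_functions a \<Longrightarrow>
    U (\<lambda>t. \<phi> t + \<theta> t) = U \<phi> + U \<theta>"
  by (simp add: exp_continuous_def)

lemma exp_continuous_scale:
  "exp_continuous a U \<Longrightarrow> \<phi> \<in> exp_test_functions a \<Longrightarrow> U (\<lambda>t. c * \<phi> t) = c * U \<phi>"
  by (simp add: exp_continuous_def)

lemma exp_continuous_bound:
  assumes "exp_continuous a U"
  obtains C n where "0 < C" "\<And>\<phi>. \<phi> \<in> exp_test_functions a \<Longrightarrow> norm (U \<phi>) \<le> C * exp_seminorm a n \<phi>"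
proof -
  obtain C n where C: "\<And>\<phi>. \<phi> \<in> exp_test_functions a \<Longrightarrow> norm (U \<phi>) \<le> C * exp_seminorm a n \<phi>"
    using assms unfolding exp_continuous_def by blast
  show ?thesis
  proof (rule that[of "\<bar>C\<bar> + 1" n])
    fix \<phi> assume \<phi>: "\<phi> \<in> exp_test_functions a"
    show "norm (U \<phi>) \<le> (\<bar>C\<bar> + 1) * exp_seminorm a n \<phi>"
      by (rule order_trans[OF C[OF \<phi>]]) (intro mult_right_mono exp_seminorm_nonneg \<phi>, simp)
  qed simp
qed

text \<open>
  The first-order Taylor bound, by the mean value inequality applied to the derivative and then to the
  function.
\<close>

lemma second_order_increment_bound:
  fixes f :: "real \<Rightarrow> complex"
  assumes f: "\<And>u. (f has_vector_derivative f' u) (at u)" and f': "\<And>u. (f' has_vector_derivative f'' u) (at u)"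
    and B: "\<And>u. u \<in> closed_segment x y \<Longrightarrow> norm (f'' u) \<le> B"
  shows "norm (f y - f x - (y - x) *\<^sub>R f' x) \<le> \<bar>y - x\<bar> * (B * \<bar>y - x\<bar>)"
proof -
  have B0: "0 \<le> B" using B[of x] by (auto intro: order_trans[rotated])
  have d1: "norm (f' u - f' x) \<le> B * \<bar>y - x\<bar>" if u: "u \<in> closed_segment x y" for u
  proof -
    have "norm (f' u - f' x) \<le> B * norm (u - x)"
    proof (rule differentiable_bound[where S = "closed_segment x y" and f' = "\<lambda>u h. h *\<^sub>R f'' u"])
      show "(f' has_derivative (\<lambda>h. h *\<^sub>R f'' z)) (at z within closed_segment x y)" for z
        using f'[of z] by (simp add: has_vector_derivative_def has_derivative_at_withinI)
      show "onorm (\<lambda>h. h *\<^sub>R f'' z) \<le> B" if "z \<in> closed_segment x y" for z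
        using B[OF that] by (intro onorm_bound B0) (simp add: mult.commute[of B] mult_left_mono)
    qed (use u in auto)
    also have "\<dots> \<le> B * \<bar>y - x\<bar>"
      using segment_bound(1)[OF u] B0 by (intro mult_left_mono) auto
    finally show ?thesis .
  qed
  show ?thesis
    using vector_differentiable_bound_linearization[where S = "closed_segment x y" and f = f and f' = f'
        and a = x and b = y and ?x0.0 = x and B = "B * \<bar>y - x\<bar>"] d1
      has_vector_derivative_at_within[OF f] by auto
qed

text \<open>
  The difference quotients of \<open>\<phi>\<close> converge to the derivative with an error that is linear in the
  increment, uniformly with the exponential weight and for all derivatives up to order \<open>n\<close>.  So they
  converge in the seminorm that controls \<open>V\<close>, and differentiation can be carried out inside \<open>V\<close>.
\<close>

lemma translate_has_vector_derivative:
  assumes V: "exp_continuous a V" and \<phi>: "\<phi> \<in> exp_test_functions a"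
  shows "((\<lambda>x. V (\<lambda>y. \<phi> (x + y))) has_vector_derivative V (\<lambda>y. nth_deriv 1 \<phi> (x + y))) (at x)"
proof -
  let ?W = "\<lambda>x. V (\<lambda>y. \<phi> (x + y))" and ?V' = "V (\<lambda>y. nth_deriv 1 \<phi> (x + y))"
  obtain C n where C: "0 < C" "\<And>\<phi>. \<phi> \<in> exp_test_functions a \<Longrightarrow> norm (V \<phi>) \<le> C * exp_seminorm a n \<phi>"
    using exp_continuous_bound[OF V] by blast
  have "\<forall>k. \<exists>M\<ge>0. \<forall>u\<ge>x - 1. exp (a * u) * norm (nth_deriv k \<phi> u) \<le> M"
    using exp_test_halfline_bounded[OF \<phi>] by blast
  then obtain M where M: "\<And>k. 0 \<le> M k"
    "\<And>k u. x - 1 \<le> u \<Longrightarrow> exp (a * u) * norm (nth_deriv k \<phi> u) \<le> M k" by metis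
  define E where "E = exp (\<bar>a\<bar> * (\<bar>x\<bar> + 1))"
  \<comment> \<open>\<open>E\<close> bounds the ratio of the exponential weights at \<open>y\<close> and at points within distance \<open>1\<close> of \<open>x + y\<close>.\<close>
  define B where "B = E * (\<Sum>k\<le>n. M (Suc (Suc k)))"
  have B: "E * M (Suc (Suc k)) \<le> B" if "k \<le> n" for k
    unfolding B_def E_def by (intro mult_left_mono member_le_sum) (use that M in auto)
  have B0: "0 \<le> B" unfolding B_def E_def using M by (intro mult_nonneg_nonneg sum_nonneg) auto
  have key: "norm (?W z - ?W x - (z - x) *\<^sub>R ?V')
      \<le> C * (real (Suc n) * (\<bar>z - x\<bar> * \<bar>z - x\<bar> * B))" if z: "\<bar>z - x\<bar> \<le> 1" for z
  proof -
    define h where "h = complex_of_real (z - x)"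
    define \<rho>1 where "\<rho>1 y = - h * nth_deriv 1 \<phi> (x + y)" for y
    define \<rho>2 where "\<rho>2 y = - 1 * \<phi> (x + y)" for y
    define \<rho>3 where "\<rho>3 y = \<rho>2 y + \<rho>1 y" for y
    define \<rho> where "\<rho> y = \<phi> (z + y) + \<rho>3 y" for y
    have t1: "(\<lambda>y. nth_deriv 1 \<phi> (x + y)) \<in> exp_test_functions a"
      by (rule exp_test_translate[OF exp_test_nth_deriv[OF \<phi>]])
    have m1: "\<rho>1 \<in> exp_test_functions a"
      unfolding \<rho>1_def by (rule exp_test_scale[OF t1])
    have m2: "\<rho>2 \<in> exp_test_functions a"
      unfolding \<rho>2_def by (rule exp_test_scale[OF exp_test_translate[OF \<phi>]])
    have m3: "\<rho>3 \<in> exp_test_functions a"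
      unfolding \<rho>3_def by (rule exp_test_add[OF m2 m1])
    have m: "\<rho> \<in> exp_test_functions a"
      unfolding \<rho>_def by (rule exp_test_add[OF exp_test_translate[OF \<phi>] m3])
    have "V \<rho> = ?W z + (- 1 * ?W x + - h * ?V')"
    proof -
      have "V \<rho> = ?W z + V \<rho>3"
        unfolding \<rho>_def by (rule exp_continuous_add[OF V exp_test_translate[OF \<phi>] m3])
      moreover have "V \<rho>3 = V \<rho>2 + V \<rho>1" unfolding \<rho>3_def by (rule exp_continuous_add[OF V m2 m1])
      moreover have "V \<rho>2 = - 1 * ?W x"
        unfolding \<rho>2_def by (rule exp_continuous_scale[OF V exp_test_translate[OF \<phi>]])
      moreover have "V \<rho>1 = - h * ?V'"
        unfolding \<rho>1_def by (rule exp_continuous_scale[OF V t1])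
      ultimately show ?thesis by simp
    qed
    then have Veq: "?W z - ?W x - (z - x) *\<^sub>R ?V' = V \<rho>"
      by (simp add: h_def scaleR_conv_of_real algebra_simps)
    have d: "nth_deriv k \<rho> y = nth_deriv k \<phi> (z + y) - nth_deriv k \<phi> (x + y) - (z - x) *\<^sub>R nth_deriv (Suc k) \<phi> (x + y)"
      for k y
    proof -
      have "nth_deriv k \<rho> y = nth_deriv k \<phi> (z + y) + nth_deriv k \<rho>3 y"
        unfolding \<rho>_def nth_deriv_add[OF exp_test_translate[OF \<phi>] m3] nth_deriv_translate[OF \<phi>] ..
      also have "nth_deriv k \<rho>3 y = nth_deriv k \<rho>2 y + nth_deriv k \<rho>1 y"
        unfolding \<rho>3_def nth_deriv_add[OF m2 m1] ..
      also have "nth_deriv k \<rho>2 y = - 1 * nth_deriv k \<phi> (x + y)"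
        unfolding \<rho>2_def nth_deriv_scale[OF exp_test_translate[OF \<phi>]] nth_deriv_translate[OF \<phi>] ..
      also have "nth_deriv k \<rho>1 y = - h * nth_deriv (Suc k) \<phi> (x + y)"
        unfolding \<rho>1_def nth_deriv_scale[OF t1] nth_deriv_translate[OF exp_test_nth_deriv[OF \<phi>]] nth_deriv_nth_deriv
        by simp
      finally show ?thesis by (simp add: h_def scaleR_conv_of_real algebra_simps)
    qed
    have bd: "exp (a * y) * norm (nth_deriv k \<rho> y) \<le> \<bar>z - x\<bar> * \<bar>z - x\<bar> * B" if k: "k \<le> n" and y: "0 \<le> y" for k y
    proof -
      define D where "D = exp (- (a * y)) * (E * M (Suc (Suc k)))"
      have "norm (nth_deriv (Suc (Suc k)) \<phi> u) \<le> D" if u: "u \<in> closed_segment (x + y) (z + y)" for u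
      proof -
        have u1: "\<bar>u - (x + y)\<bar> \<le> 1" using segment_bound(1)[OF u] z by simp
        then have "x - 1 \<le> u" using y by linarith
        then have "exp (a * u) * norm (nth_deriv (Suc (Suc k)) \<phi> u) \<le> M (Suc (Suc k))" by (rule M(2))
        then have "exp (- (a * u)) * (exp (a * u) * norm (nth_deriv (Suc (Suc k)) \<phi> u)) \<le> exp (- (a * u)) * M (Suc (Suc k))"
          by (intro mult_left_mono) auto
        then have "norm (nth_deriv (Suc (Suc k)) \<phi> u) \<le> exp (- (a * u)) * M (Suc (Suc k))"
          by (simp add: mult.assoc[symmetric] exp_add[symmetric])
        also have "exp (- (a * u)) \<le> exp (- (a * y)) * E"
        proof -
          have "\<bar>a * (y - u)\<bar> \<le> \<bar>a\<bar> * (\<bar>x\<bar> + 1)"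
            unfolding abs_mult using u1 by (intro mult_left_mono) auto
          then have "- (a * u) \<le> - (a * y) + \<bar>a\<bar> * (\<bar>x\<bar> + 1)" by (simp add: right_diff_distrib)
          then show ?thesis by (simp add: E_def exp_add[symmetric])
        qed
        finally show ?thesis using M(1) by (simp add: D_def mult_right_mono mult.assoc)
      qed
      then have "norm (nth_deriv k \<phi> (z + y) - nth_deriv k \<phi> (x + y) - ((z + y) - (x + y)) *\<^sub>R nth_deriv (Suc k) \<phi> (x + y))
          \<le> \<bar>(z + y) - (x + y)\<bar> * (D * \<bar>(z + y) - (x + y)\<bar>)"
        by (intro second_order_increment_bound[where f'' = "nth_deriv (Suc (Suc k)) \<phi>"]
              smooth_has_vector_derivative exp_test_smooth[OF \<phi>])
      then have "norm (nth_deriv k \<rho> y) \<le> \<bar>z - x\<bar> * (D * \<bar>z - x\<bar>)" by (simp add: d)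
      then have "exp (a * y) * norm (nth_deriv k \<rho> y) \<le> exp (a * y) * (\<bar>z - x\<bar> * (D * \<bar>z - x\<bar>))"
        by (intro mult_left_mono) auto
      also have "\<dots> = \<bar>z - x\<bar> * \<bar>z - x\<bar> * (exp (a * y) * D)"
        by (simp only: mult_ac)
      also have "\<dots> = \<bar>z - x\<bar> * \<bar>z - x\<bar> * (E * M (Suc (Suc k)))" by (simp add: D_def exp_minus)
      also have "\<dots> \<le> \<bar>z - x\<bar> * \<bar>z - x\<bar> * B"
        using B[OF k] by (intro mult_left_mono) auto
      finally show ?thesis .
    qed
    have "norm (V \<rho>) \<le> C * exp_seminorm a n \<rho>" by (rule C(2)[OF m])
    also have "\<dots> \<le> C * (real (Suc n) * (\<bar>z - x\<bar> * \<bar>z - x\<bar> * B))"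
      using C(1) by (intro mult_left_mono exp_seminorm_least bd) auto
    finally show ?thesis unfolding Veq .
  qed
  show ?thesis
    unfolding has_vector_derivative_def has_derivative_within_alt
  proof (intro conjI allI impI)
    fix e :: real assume e: "0 < e"
    define A where "A = C * (real (Suc n) * B)"
    have A: "0 \<le> A" using C(1) B0 by (simp add: A_def)
    show "\<exists>d>0. \<forall>y\<in>UNIV. norm (y - x) < d \<longrightarrow>
        norm (?W y - ?W x - (y - x) *\<^sub>R ?V') \<le> e * norm (y - x)"
    proof (intro exI[of _ "min 1 (e / (A + 1))"] conjI ballI impI)
      show "0 < min 1 (e / (A + 1))" using e A by simp
      fix z assume z: "norm (z - x) < min 1 (e / (A + 1))"
      have "norm (?W z - ?W x - (z - x) *\<^sub>R ?V')
        \<le> C * (real (Suc n) * (\<bar>z - x\<bar> * \<bar>z - x\<bar> * B))" using z by (intro key) auto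
      also have "\<dots> = (A * \<bar>z - x\<bar>) * \<bar>z - x\<bar>" by (simp add: A_def)
      also have "\<dots> \<le> e * \<bar>z - x\<bar>"
      proof (rule mult_right_mono)
        have "A * \<bar>z - x\<bar> \<le> (A + 1) * \<bar>z - x\<bar>" by (intro mult_right_mono) auto
        also have "\<dots> \<le> (A + 1) * (e / (A + 1))" using z A by (intro mult_left_mono) auto
        also have "\<dots> = e" using A by simp
        finally show "A * \<bar>z - x\<bar> \<le> e" .
      qed simp
      finally show "norm (?W z - ?W x - (z - x) *\<^sub>R ?V') \<le> e * norm (z - x)"
        by simp
    qed
  qed (simp add: bounded_linear_scaleR_left)
qed

text \<open>
  This is what gives a meaning to the convolution of distributions: \<open>U\<close> is applied to
  \<open>\<lambda>x. V (\<lambda>y. \<phi> (x + y))\<close>.  The weight reappears because \<open>exp (a * y) = exp (- a * x) * exp (a * (x + y))\<close>.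
\<close>

lemma translate_exp_test:
  assumes V: "exp_continuous a V"
  obtains C n where "0 \<le> C"
    "\<And>\<phi>. \<phi> \<in> exp_test_functions a \<Longrightarrow> (\<lambda>x. V (\<lambda>y. \<phi> (x + y))) \<in> exp_test_functions a"
    "\<And>\<phi> m. \<phi> \<in> exp_test_functions a \<Longrightarrow>
       exp_seminorm a m (\<lambda>x. V (\<lambda>y. \<phi> (x + y))) \<le> real (Suc m) * (C * exp_seminorm a (n + m) \<phi>)"
proof -
  obtain C n where C: "0 < C" "\<And>\<phi>. \<phi> \<in> exp_test_functions a \<Longrightarrow> norm (V \<phi>) \<le> C * exp_seminorm a n \<phi>"
    using exp_continuous_bound[OF V] by blast
  define \<Phi> where "\<Phi> \<phi> k x = V (\<lambda>y. nth_deriv k \<phi> (x + y))" for \<phi> k x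
  have d: "(\<Phi> \<phi> k has_vector_derivative \<Phi> \<phi> (Suc k) x) (at x)" if \<phi>: "\<phi> \<in> exp_test_functions a" for \<phi> k x
    using translate_has_vector_derivative[OF V exp_test_nth_deriv[OF \<phi>], of k x]
    by (simp add: \<Phi>_def[abs_def] nth_deriv_nth_deriv)
  have bd: "exp (a * x) * norm (\<Phi> \<phi> k x) \<le> C * real (Suc n) * exp_seminorm a (n + m) \<phi>"
    if \<phi>: "\<phi> \<in> exp_test_functions a" and x: "0 \<le> x" and k: "k \<le> m" for \<phi> k m x
  proof -
    have "norm (\<Phi> \<phi> k x) \<le> C * exp_seminorm a n (\<lambda>y. nth_deriv k \<phi> (x + y))"
      unfolding \<Phi>_def by (intro C(2) exp_test_translate exp_test_nth_deriv \<phi>)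
    also have "\<dots> \<le> C * (real (Suc n) * (exp (- (a * x)) * exp_seminorm a (n + m) \<phi>))"
    proof (intro mult_left_mono exp_seminorm_least)
      fix j y assume j: "j \<le> n" and y: "(0::real) \<le> y"
      have "exp (a * y) * norm (nth_deriv j (\<lambda>y. nth_deriv k \<phi> (x + y)) y) =
          exp (- (a * x)) * (exp (a * (x + y)) * norm (nth_deriv (j + k) \<phi> (x + y)))"
        by (simp add: nth_deriv_translate[OF exp_test_nth_deriv[OF \<phi>]] nth_deriv_nth_deriv
              mult.assoc[symmetric] exp_add[symmetric] distrib_left)
      also have "\<dots> \<le> exp (- (a * x)) * exp_seminorm a (n + m) \<phi>"
        using x y j k by (intro mult_left_mono exp_seminorm_upper[OF \<phi>]) auto
      finally show "exp (a * y) * norm (nth_deriv j (\<lambda>y. nth_deriv k \<phi> (x + y)) y) \<le>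
          exp (- (a * x)) * exp_seminorm a (n + m) \<phi>" .
    qed (use C in auto)
    finally have "exp (a * x) * norm (\<Phi> \<phi> k x) \<le>
        exp (a * x) * (C * (real (Suc n) * (exp (- (a * x)) * exp_seminorm a (n + m) \<phi>)))"
      by (intro mult_left_mono) auto
    also have "\<dots> = C * real (Suc n) * exp_seminorm a (n + m) \<phi>" by (simp add: exp_minus)
    finally show ?thesis .
  qed
  have \<Phi>0: "\<Phi> \<phi> 0 = (\<lambda>x. V (\<lambda>y. \<phi> (x + y)))" for \<phi> by (simp add: \<Phi>_def[abs_def])
  show ?thesis
  proof (rule that[of "C * real (Suc n)" n])
    show "0 \<le> C * real (Suc n)" using C by simp
    fix \<phi> assume \<phi>: "\<phi> \<in> exp_test_functions a"
    show "(\<lambda>x. V (\<lambda>y. \<phi> (x + y))) \<in> exp_test_functions a"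
      unfolding \<Phi>0[symmetric] using bd[OF \<phi>] by (intro derivative_chain_exp_test d[OF \<phi>]) blast
    show "exp_seminorm a m (\<lambda>x. V (\<lambda>y. \<phi> (x + y))) \<le> real (Suc m) * (C * real (Suc n) * exp_seminorm a (n + m) \<phi>)" for m
    proof (rule exp_seminorm_least)
      fix k x assume "k \<le> m" "(0::real) \<le> x"
      then show "exp (a * x) * norm (nth_deriv k (\<lambda>x. V (\<lambda>y. \<phi> (x + y))) x) \<le> C * real (Suc n) * exp_seminorm a (n + m) \<phi>"
        unfolding \<Phi>0[symmetric] derivative_chain_nth_deriv[of "\<Phi> \<phi>", OF d[OF \<phi>]] by (intro bd \<phi>)
    qed
  qed
qed

lemma distr_conv_exp_continuous:
  assumes U: "exp_continuous a U" and V: "exp_continuous a V"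
  shows "exp_continuous a (distr_conv U V)"
proof -
  obtain C n where C: "0 < C" "\<And>\<phi>. \<phi> \<in> exp_test_functions a \<Longrightarrow> norm (U \<phi>) \<le> C * exp_seminorm a n \<phi>"
    using exp_continuous_bound[OF U] by blast
  obtain D m where D: "0 \<le> D"
    "\<And>\<phi>. \<phi> \<in> exp_test_functions a \<Longrightarrow> (\<lambda>x. V (\<lambda>y. \<phi> (x + y))) \<in> exp_test_functions a"
    "\<And>\<phi> k. \<phi> \<in> exp_test_functions a \<Longrightarrow>
       exp_seminorm a k (\<lambda>x. V (\<lambda>y. \<phi> (x + y))) \<le> real (Suc k) * (D * exp_seminorm a (m + k) \<phi>)"
    using translate_exp_test[OF V] by metis
  show ?thesis
    unfolding exp_continuous_def distr_conv_def
  proof (intro conjI ballI allI exI)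
    fix \<phi> \<theta> assume \<phi>: "\<phi> \<in> exp_test_functions a" and \<theta>: "\<theta> \<in> exp_test_functions a"
    show "U (\<lambda>x. V (\<lambda>y. \<phi> (x + y) + \<theta> (x + y))) = U (\<lambda>x. V (\<lambda>y. \<phi> (x + y))) + U (\<lambda>x. V (\<lambda>y. \<theta> (x + y)))"
      by (simp add: exp_continuous_add[OF V] exp_continuous_add[OF U] exp_test_translate \<phi> \<theta> D(2))
  next
    fix \<phi> c assume \<phi>: "\<phi> \<in> exp_test_functions a"
    show "U (\<lambda>x. V (\<lambda>y. c * \<phi> (x + y))) = c * U (\<lambda>x. V (\<lambda>y. \<phi> (x + y)))"
      by (simp add: exp_continuous_scale[OF V] exp_continuous_scale[OF U] exp_test_translate \<phi> D(2))
  next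
    fix \<phi> assume \<phi>: "\<phi> \<in> exp_test_functions a"
    have "norm (U (\<lambda>x. V (\<lambda>y. \<phi> (x + y)))) \<le> C * exp_seminorm a n (\<lambda>x. V (\<lambda>y. \<phi> (x + y)))"
      by (intro C D \<phi>)
    also have "\<dots> \<le> C * (real (Suc n) * (D * exp_seminorm a (m + n) \<phi>))"
      using C(1) by (intro mult_left_mono D \<phi>) auto
    finally show "norm (U (\<lambda>x. V (\<lambda>y. \<phi> (x + y)))) \<le> (C * real (Suc n) * D) * exp_seminorm a (m + n) \<phi>"
      by (simp add: mult.assoc)
  qed
qed

lemma distr_conv_exp:
  assumes U: "exp_continuous a U" and V: "exp_continuous a V" and s: "a \<le> Re s"
  shows "distr_conv U V (laplace_kernel s) = U (laplace_kernel s) * V (laplace_kernel s)"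
proof -
  have "V (\<lambda>y. exp (- (s * of_real (x + y)))) = V (laplace_kernel s) * exp (- (s * of_real x))" for x
    using exp_continuous_scale[OF V exp_test_exp[OF s], of "exp (- (s * of_real x))"]
    by (simp add: distrib_left exp_add[symmetric] add.commute mult.commute[of "V _"])
  then have eq: "(\<lambda>x. V (\<lambda>y. exp (- (s * of_real (x + y))))) = (\<lambda>x. V (laplace_kernel s) * exp (- (s * of_real x)))"
    by (rule ext)
  show ?thesis
    unfolding distr_conv_def eq exp_continuous_scale[OF U exp_test_exp[OF s]] by (rule mult.commute)
qed

lemma exp_continuous_combination:
  assumes U: "exp_continuous a U" and V: "exp_continuous a V"
  shows "exp_continuous a (\<lambda>\<phi>. U \<phi> + c * V \<phi>)"
proof -
  obtain C n where C: "0 < C" "\<And>\<phi>. \<phi> \<in> exp_test_functions a \<Longrightarrow> norm (U \<phi>) \<le> C * exp_seminorm a n \<phi>"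
    using exp_continuous_bound[OF U] by blast
  obtain D m where D: "0 < D" "\<And>\<phi>. \<phi> \<in> exp_test_functions a \<Longrightarrow> norm (V \<phi>) \<le> D * exp_seminorm a m \<phi>"
    using exp_continuous_bound[OF V] by blast
  have mono: "exp_seminorm a k \<phi> \<le> real (Suc k) * exp_seminorm a (n + m) \<phi>"
    if "\<phi> \<in> exp_test_functions a" "k \<le> n + m" for k \<phi>
    using that by (intro exp_seminorm_least exp_seminorm_upper) auto
  show ?thesis
    unfolding exp_continuous_def
  proof (intro conjI ballI allI exI)
    fix \<phi> assume \<phi>: "\<phi> \<in> exp_test_functions a"
    have "norm (U \<phi> + c * V \<phi>) \<le> norm (U \<phi>) + norm c * norm (V \<phi>)"
      by (metis norm_mult norm_triangle_ineq)
    also have "\<dots> \<le> C * (real (Suc n) * exp_seminorm a (n + m) \<phi>) + norm c * (D * (real (Suc m) * exp_seminorm a (n + m) \<phi>))"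
      using C D mono[OF \<phi>, of n] mono[OF \<phi>, of m]
      by (intro add_mono mult_left_mono order_trans[OF C(2)[OF \<phi>]] order_trans[OF D(2)[OF \<phi>]]) auto
    finally show "norm (U \<phi> + c * V \<phi>) \<le> (C * real (Suc n) + norm c * D * real (Suc m)) * exp_seminorm a (n + m) \<phi>"
      by (simp add: algebra_simps)
  qed (simp_all add: exp_continuous_add[OF U] exp_continuous_add[OF V] exp_continuous_scale[OF U] exp_continuous_scale[OF V] algebra_simps)
qed

lemma exp_continuous_sum:
  assumes U: "exp_continuous a U" and s: "\<And>i. a \<le> Re (s i)"
  shows "(\<lambda>t. \<Sum>i\<le>(m::nat). c i * exp (- (s i * of_real t))) \<in> exp_test_functions a"
    and "nth_deriv k (\<lambda>t. \<Sum>i\<le>m. c i * exp (- (s i * of_real t))) t =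
      (\<Sum>i\<le>m. c i * ((- s i) ^ k * exp (- (s i * of_real t))))"
    and "U (\<lambda>t. \<Sum>i\<le>m. c i * exp (- (s i * of_real t))) = (\<Sum>i\<le>m. c i * U (laplace_kernel (s i)))"
proof (induction m)
  case 0
  { case 1 show ?case using exp_test_scale[OF exp_test_exp[OF s]] by simp
  next case 2 show ?case by (simp add: nth_deriv_scale[OF exp_test_exp[OF s]] nth_deriv_exp[OF s])
  next case 3 show ?case by (simp add: exp_continuous_scale[OF U exp_test_exp[OF s]]) }
next
  case (Suc m)
  note sc = exp_test_scale[OF exp_test_exp[OF s]]
  { case 1 show ?case using exp_test_add[OF Suc.IH(1) sc] by simp
  next case 2 show ?case
      by (simp add: nth_deriv_add[OF Suc.IH(1) sc] Suc.IH(2) nth_deriv_scale[OF exp_test_exp[OF s]] nth_deriv_exp[OF s])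
  next case 3 show ?case
      by (simp add: exp_continuous_add[OF U Suc.IH(1) sc] Suc.IH(3) exp_continuous_scale[OF U exp_test_exp[OF s]]) }
qed

text \<open>
  A function that tends to \<open>0\<close> is recovered from its derivative by integration from infinity, and
  \<open>exp (- N * t)\<close> reproduces itself up to the factor \<open>1 / N \<le> 1\<close>.
\<close>

lemma exp_decay_antiderivative:
  fixes D D' :: "real \<Rightarrow> complex"
  assumes d: "\<And>t. (D has_vector_derivative D' t) (at t)"
    and b: "\<And>t. 0 \<le> t \<Longrightarrow> norm (D' t) \<le> e * exp (- N * t)"
    and lim: "(D \<longlongrightarrow> 0) at_top" and N: "1 \<le> N" and e: "0 \<le> e" and t: "0 \<le> t"
  shows "norm (D t) \<le> e * exp (- N * t)"
proof -
  have fin: "norm (D T - D t) \<le> e * exp (- N * t)" if T: "t < T" for T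
  proof -
    have "norm (D T - D t) \<le> (- (e / N) * exp (- N * T)) - (- (e / N) * exp (- N * t))"
    proof (rule differentiable_bound_general[OF T, where f' = D' and \<phi>' = "\<lambda>x. e * exp (- N * x)"])
      show "continuous_on {t..T} D"
        using d by (meson continuous_at_imp_continuous_on differentiableI_vector differentiable_imp_continuous_within)
      show "continuous_on {t..T} (\<lambda>x. - (e / N) * exp (- N * x))" by (intro continuous_intros)
      show "((\<lambda>x. - (e / N) * exp (- N * x)) has_vector_derivative e * exp (- N * x)) (at x)" for x
        unfolding has_real_derivative_iff_has_vector_derivative[symmetric]
        using N by (auto intro!: derivative_eq_intros)
    qed (use d b t in auto)
    also have "\<dots> \<le> e / N * exp (- N * t)" using e N by simp
    also have "\<dots> \<le> e * exp (- N * t)"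
      using mult_left_mono[OF N e] N by (intro mult_right_mono) (auto simp: divide_le_eq)
    finally show ?thesis .
  qed
  have "((\<lambda>T. norm (D T - D t)) \<longlongrightarrow> norm (0 - D t)) at_top"
    by (intro tendsto_intros lim)
  then have "norm (0 - D t) \<le> e * exp (- N * t)"
  proof (rule tendsto_upperbound)
    show "\<forall>\<^sub>F T in at_top. norm (D T - D t) \<le> e * exp (- N * t)"
      using eventually_gt_at_top[of t] by eventually_elim (rule fin)
  qed simp
  then show ?thesis by simp
qed

text \<open>
  If the sum of exponentials \<open>Q\<close> approximates the \<open>n\<close>-th derivative of \<open>\<phi>\<close> with the error
  \<open>e * exp (- N * t)\<close>, the \<open>n\<close>-fold integral of \<open>Q\<close> from infinity is again a sum of exponentials, it is
  annihilated by \<open>U\<close>, and it approximates all lower derivatives of \<open>\<phi>\<close> with the same error.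
\<close>

theorem exp_continuous_unique:
  assumes U: "exp_continuous (real N) U" and N: "1 \<le> N"
    and z: "\<And>n. N \<le> n \<Longrightarrow> U (laplace_kernel (of_nat n)) = 0"
    and \<phi>: "\<phi> \<in> test_functions"
  shows "U \<phi> = 0"
proof -
  obtain r where r: "\<And>t. r < \<bar>t\<bar> \<Longrightarrow> \<phi> t = 0" and sm: "smooth \<phi>"
    using \<phi> by (auto simp: test_functions_def)
  have van: "nth_deriv k \<phi> t = 0" if "\<bar>r\<bar> < t" for k t
    using that by (intro test_function_deriv_vanishes[OF sm, of "\<bar>r\<bar>"]) (auto intro: r)
  have \<phi>E: "\<phi> \<in> exp_test_functions (real N)" by (rule test_function_exp_test[OF \<phi>])
  obtain C n where C: "0 < C" "\<And>\<phi>. \<phi> \<in> exp_test_functions (real N) \<Longrightarrow> norm (U \<phi>) \<le> C * exp_seminorm (real N) n \<phi>"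
    using exp_continuous_bound[OF U] by blast
  have main: "norm (U \<phi>) \<le> C * (real (Suc n) * e)" if e: "0 < e" for e
  proof -
    obtain c m where c: "\<forall>t\<ge>0.
        norm (nth_deriv n \<phi> t - (\<Sum>i\<le>m. c i * exp (- (of_nat (N + i) * of_real t)))) \<le> e * exp (- real N * t)"
      using exponential_sum_approximation[where \<psi> = "nth_deriv n \<phi>" and r = "\<bar>r\<bar>" and N = N,
          OF smooth_continuous[OF sm] van e] by blast
    define s where "s i = complex_of_nat (N + i)" for i
    have s0: "s i \<noteq> 0" for i using N by (simp add: s_def del: of_nat_add)
    have sR: "real N \<le> Re (s i)" for i by (simp add: s_def)
    \<comment> \<open>Division by \<open>(- s i) ^ n\<close> integrates \<open>n\<close> times; the sign makes \<open>\<phi> + P\<close> the approximation error.\<close>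
    define P where "P t = (\<Sum>i\<le>m. - (c i / (- s i) ^ n) * exp (- (s i * of_real t)))" for t
    have PE: "P \<in> exp_test_functions (real N)" unfolding P_def[abs_def] by (rule exp_continuous_sum(1)[OF U sR])
    have UP: "U P = 0"
    proof -
      have "U P = (\<Sum>i\<le>m. - (c i / (- s i) ^ n) * U (laplace_kernel (s i)))"
        unfolding P_def[abs_def] by (rule exp_continuous_sum(3)[OF U sR])
      also have "\<dots> = 0" by (intro sum.neutral) (auto simp: s_def z simp del: of_nat_add)
      finally show ?thesis .
    qed
    have Pd: "nth_deriv k P t = (\<Sum>i\<le>m. - (c i / (- s i) ^ n) * ((- s i) ^ k * exp (- (s i * of_real t))))" for k t
      unfolding P_def[abs_def] by (rule exp_continuous_sum(2)[OF U sR])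
    define D where "D t = \<phi> t + P t" for t
    have DE: "D \<in> exp_test_functions (real N)" unfolding D_def by (rule exp_test_add[OF \<phi>E PE])
    have UD: "U D = U \<phi>" unfolding D_def using exp_continuous_add[OF U \<phi>E PE] UP by simp
    have Dd: "nth_deriv k D t = nth_deriv k \<phi> t + nth_deriv k P t" for k t
      unfolding D_def by (rule nth_deriv_add[OF \<phi>E PE])
    have lim: "(nth_deriv k D \<longlongrightarrow> 0) at_top" for k
    proof -
      have ex: "((\<lambda>t. exp (- (s i * complex_of_real t))) \<longlongrightarrow> 0) at_top" for i
      proof (rule tendsto_norm_zero_cancel)
        have "filterlim (\<lambda>t. - (real (N + i) * t)) at_bot at_top"
          using N by (intro filterlim_uminus_at_bot_at_top[THEN filterlim_compose] filterlim_tendsto_pos_mult_at_top[OF tendsto_const]) (auto intro: filterlim_ident)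
        then have "((\<lambda>t. exp (- (real (N + i) * t))) \<longlongrightarrow> 0) at_top"
          by (rule filterlim_compose[OF exp_at_bot])
        then show "((\<lambda>t. norm (exp (- (s i * complex_of_real t)))) \<longlongrightarrow> 0) at_top"
          by (simp add: s_def)
      qed
      have "((\<lambda>t. nth_deriv k P t) \<longlongrightarrow> (\<Sum>i\<le>m. - (c i / (- s i) ^ n) * ((- s i) ^ k * 0))) at_top"
        unfolding Pd by (intro tendsto_intros ex)
      moreover have "((\<lambda>t. nth_deriv k \<phi> t) \<longlongrightarrow> 0) at_top"
        by (rule tendsto_eventually) (auto intro: eventually_mono[OF eventually_gt_at_top[of "\<bar>r\<bar>"]] van)
      ultimately have "((\<lambda>t. nth_deriv k \<phi> t + nth_deriv k P t) \<longlongrightarrow> 0 + 0) at_top"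
        by (intro tendsto_add) auto
      then show ?thesis by (simp add: Dd[abs_def])
    qed
    have bd: "\<forall>t\<ge>0. norm (nth_deriv k D t) \<le> e * exp (- real N * t)" if "k \<le> n" for k
      using that
    proof (induction rule: inc_induct)
      case base
      have "nth_deriv n P t = - (\<Sum>i\<le>m. c i * exp (- (of_nat (N + i) * of_real t)))" for t
      proof -
        have "- (c i / (- s i) ^ n) * ((- s i) ^ n * E) = - (c i * E)" for i E using s0[of i] by simp
        then show ?thesis unfolding Pd sum_negf[symmetric] s_def[symmetric] by (intro sum.cong refl) blast
      qed
      then show ?case using c by (simp add: Dd)
    next
      case (step k)
      show ?case
      proof (intro allI impI)
        fix t :: real assume t: "0 \<le> t"
        show "norm (nth_deriv k D t) \<le> e * exp (- real N * t)"
          by (rule exp_decay_antiderivative[where D = "nth_deriv k D" and D' = "nth_deriv (Suc k) D",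
                OF smooth_has_vector_derivative[OF exp_test_smooth[OF DE]] _ lim])
             (use step.IH N e t in auto)
      qed
    qed
    have "norm (U \<phi>) \<le> C * exp_seminorm (real N) n D" using C(2)[OF DE] by (simp add: UD)
    also have "\<dots> \<le> C * (real (Suc n) * e)"
    proof (intro mult_left_mono exp_seminorm_least)
      fix k t assume "k \<le> n" "(0::real) \<le> t"
      then have "exp (real N * t) * norm (nth_deriv k D t) \<le> exp (real N * t) * (e * exp (- real N * t))"
        using bd by (intro mult_left_mono) auto
      also have "\<dots> = e" by (simp add: exp_minus)
      finally show "exp (real N * t) * norm (nth_deriv k D t) \<le> e" .
    qed (use C in auto)
    finally show ?thesis .
  qed
  show ?thesis
  proof (rule ccontr)
    assume "U \<phi> \<noteq> 0"
    then have p: "0 < norm (U \<phi>)" by simp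
    define A where "A = C * real (Suc n)"
    have A: "0 < A" using C by (simp add: A_def)
    define x where "x = norm (U \<phi>) / (2 * A)"
    have "0 < x" using p A by (simp add: x_def)
    then have "norm (U \<phi>) \<le> A * x" unfolding A_def mult.assoc by (rule main)
    also have "\<dots> = norm (U \<phi>) / 2" using A by (simp add: x_def)
    finally show False using p by simp
  qed
qed

lemma fun_distr_exp_continuous:
  assumes V: "laplace_integrable V (of_real a)"
  shows "exp_continuous a (fun_distr V)"
proof -
  have m: "\<phi> \<in> borel_measurable borel" if "\<phi> \<in> exp_test_functions a" for \<phi>
    using smooth_continuous[OF exp_test_smooth[OF that], of UNIV 0] by (simp add: borel_measurable_continuous_onI)
  have em: "(\<lambda>t. exp (complex_of_real a * complex_of_real t)) \<in> borel_measurable borel"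
    by (intro borel_measurable_continuous_onI continuous_intros)
  define k where "k t = indicator {0..} t *\<^sub>R (exp (- (of_real a * of_real t)) * V t)" for t
  have kint: "integrable lebesgue k" using V by (simp add: set_integrable_def k_def[abs_def])
  have eq: "indicator {0..} t *\<^sub>R (V t * \<phi> t) = k t * (exp (of_real a * of_real t) * \<phi> t)" for t and \<phi> :: "real \<Rightarrow> complex"
    by (simp add: k_def exp_minus indicator_def)
  have bd: "norm (k t * (exp (of_real a * of_real t) * \<phi> t)) \<le> norm (exp_seminorm a 0 \<phi> * norm (k t))"
    if \<phi>: "\<phi> \<in> exp_test_functions a" for t \<phi>
  proof (cases "0 \<le> t")
    case True
    have "norm (k t * (exp (of_real a * of_real t) * \<phi> t)) = norm (k t) * (exp (a * t) * norm (\<phi> t))"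
      by (simp add: norm_mult)
    also have "\<dots> \<le> norm (k t) * exp_seminorm a 0 \<phi>"
      using exp_seminorm_upper[OF \<phi> True, of 0 0] by (intro mult_left_mono) auto
    finally show ?thesis using exp_seminorm_nonneg[OF \<phi>] by (simp add: mult.commute)
  qed (simp add: k_def)
  have int: "integrable lebesgue (\<lambda>t. indicator {0..} t *\<^sub>R (V t * \<phi> t))" if \<phi>: "\<phi> \<in> exp_test_functions a" for \<phi>
    unfolding eq
  proof (rule Bochner_Integration.integrable_bound)
    show "integrable lebesgue (\<lambda>t. exp_seminorm a 0 \<phi> * norm (k t))" using kint by auto
    show "(\<lambda>t. k t * (exp (of_real a * of_real t) * \<phi> t)) \<in> borel_measurable lebesgue"
      using kint m[OF \<phi>] em by (intro borel_measurable_times) (auto simp: measurable_completion)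
  qed (use bd[OF \<phi>] in auto)
  let ?I = "\<lambda>\<phi>. LINT t|lebesgue. indicat_real {0..} t *\<^sub>R (V t * \<phi> t)"
  show ?thesis
    unfolding exp_continuous_def fun_distr_def set_lebesgue_integral_def
  proof (intro conjI ballI allI exI)
    fix \<phi> \<theta> assume \<phi>: "\<phi> \<in> exp_test_functions a" and \<theta>: "\<theta> \<in> exp_test_functions a"
    show "?I (\<lambda>t. \<phi> t + \<theta> t) =
      ?I \<phi> + ?I \<theta>"
      by (subst Bochner_Integration.integral_add[OF int[OF \<phi>] int[OF \<theta>], symmetric])
         (simp add: distrib_left scaleR_add_right)
  next
    fix \<phi> and c :: complex assume \<phi>: "\<phi> \<in> exp_test_functions a"
    have "?I (\<lambda>t. c * \<phi> t) =
      (LINT t|lebesgue. c * (indicat_real {0..} t *\<^sub>R (V t * \<phi> t)))"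
      by (simp add: mult_ac)
    also have "\<dots> = c * ?I \<phi>"
      by (rule Bochner_Integration.integral_mult_right) (rule int[OF \<phi>])
    finally show "?I (\<lambda>t. c * \<phi> t) =
      c * ?I \<phi>" .
  next
    fix \<phi> assume \<phi>: "\<phi> \<in> exp_test_functions a"
    have "norm (?I \<phi>) \<le> (LINT t|lebesgue. norm (indicat_real {0..} t *\<^sub>R (V t * \<phi> t)))"
      by (rule integral_norm_bound)
    also have "\<dots> \<le> (LINT t|lebesgue. exp_seminorm a 0 \<phi> * norm (k t))"
    proof (rule integral_mono)
      show "norm (indicat_real {0..} t *\<^sub>R (V t * \<phi> t)) \<le> exp_seminorm a 0 \<phi> * norm (k t)" for t
        unfolding eq using bd[OF \<phi>, of t] exp_seminorm_nonneg[OF \<phi>] by simp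
      show "integrable lebesgue (\<lambda>t. norm (indicat_real {0..} t *\<^sub>R (V t * \<phi> t)))"
        by (rule integrable_norm[OF int[OF \<phi>]])
    qed (use kint in auto)
    also have "\<dots> = (LINT t|lebesgue. norm (k t)) * exp_seminorm a 0 \<phi>" using kint by simp
    finally show "norm (?I \<phi>) \<le> (LINT t|lebesgue. norm (k t)) * exp_seminorm a 0 \<phi>" .
  qed
qed

lemma fun_distr_exp: "fun_distr V (laplace_kernel s) = laplace V s"
  by (simp add: fun_distr_def laplace_def mult.commute)

section \<open>Generating functions of the discrete renewal process\<close>

lemma waiting_time_density_nonneg: "waiting_time_density \<psi> \<Longrightarrow> 0 \<le> \<psi> (Suc t)"
  by (simp add: waiting_time_density_def)

lemma waiting_time_density_sums: "waiting_time_density \<psi> \<Longrightarrow> (\<lambda>t. \<psi> (Suc t)) sums 1"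
  by (simp add: waiting_time_density_def)

lemma gen_fun_term_bound:
  fixes u :: complex
  assumes "waiting_time_density \<psi>" "norm u \<le> 1"
  shows "norm (of_real (\<psi> (Suc t)) * u ^ Suc t) \<le> norm u * \<psi> (Suc t)"
proof -
  have "norm u ^ t \<le> 1" using assms by (simp add: power_le_one)
  then have "\<psi> (Suc t) * (norm u * norm u ^ t) \<le> \<psi> (Suc t) * (norm u * 1)"
    using waiting_time_density_nonneg[OF assms(1)] by (intro mult_left_mono) auto
  then show ?thesis
    using waiting_time_density_nonneg[OF assms(1)] by (simp add: norm_mult norm_power mult_ac)
qed

lemma gen_fun_summable_norm:
  fixes u :: complex
  assumes "waiting_time_density \<psi>" "norm u \<le> 1"
  shows "summable (\<lambda>t. norm (of_real (\<psi> (Suc t)) * u ^ Suc t))"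
proof (rule summable_comparison_test')
  show "summable (\<lambda>t. norm u * \<psi> (Suc t))"
    using waiting_time_density_sums[OF assms(1)] by (intro summable_mult) (simp add: sums_iff)
qed (use gen_fun_term_bound[OF assms] in auto)

lemma norm_gen_fun_le:
  assumes "waiting_time_density \<psi>" "norm u \<le> 1"
  shows "norm (gen_fun \<psi> u) \<le> norm u"
proof -
  have s: "(\<lambda>t. norm u * \<psi> (Suc t)) sums (norm u * 1)"
    by (intro sums_mult waiting_time_density_sums assms)
  have "norm (gen_fun \<psi> u) \<le> (\<Sum>t. norm u * \<psi> (Suc t))"
    unfolding gen_fun_def
    by (rule norm_suminf_le) (use gen_fun_term_bound[OF assms] s in \<open>auto simp: sums_iff\<close>)
  then show ?thesis using s by (simp add: sums_iff)
qed

text \<open>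
  If \<open>k + 1\<close> is the least time of positive weight, the sum of all later terms is at most
  \<open>norm u ^ (k + 2)\<close>, which the term of order \<open>k + 1\<close> exceeds once \<open>norm u < \<psi> (k + 1)\<close>.
\<close>

lemma gen_fun_nonzero_near_0:
  assumes \<psi>: "waiting_time_density \<psi>"
  obtains \<delta> where "0 < \<delta>" "\<delta> \<le> 1" "\<And>u. 0 < norm u \<Longrightarrow> norm u < \<delta> \<Longrightarrow> gen_fun \<psi> u \<noteq> 0"
proof -
  have nn: "\<And>t. 0 \<le> \<psi> (Suc t)" by (rule waiting_time_density_nonneg[OF \<psi>])
  have sums: "(\<lambda>t. \<psi> (Suc t)) sums 1" by (rule waiting_time_density_sums[OF \<psi>])
  have "\<exists>k. \<psi> (Suc k) \<noteq> 0"
  proof (rule ccontr)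
    assume "\<nexists>k. \<psi> (Suc k) \<noteq> 0"
    then have "(\<lambda>t. \<psi> (Suc t)) = (\<lambda>_. 0)" by auto
    with sums show False using sums_unique2[OF _ sums_zero] by fastforce
  qed
  define k where "k = (LEAST k. \<psi> (Suc k) \<noteq> 0)"
  have k: "\<psi> (Suc k) \<noteq> 0" unfolding k_def using \<open>\<exists>k. \<psi> (Suc k) \<noteq> 0\<close> by (rule LeastI_ex)
  have k0: "\<psi> (Suc j) = 0" if "j < k" for j using not_less_Least[of j] that unfolding k_def by blast
  show ?thesis
  proof (rule that[of "min 1 (\<psi> (Suc k))"])
    show "0 < min 1 (\<psi> (Suc k))" using k nn[of k] by simp
    fix u :: complex assume u0: "0 < norm u" and u: "norm u < min 1 (\<psi> (Suc k))"
    let ?f = "\<lambda>t. of_real (\<psi> (Suc t)) * u ^ Suc t"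
    have sm: "summable ?f" using gen_fun_summable_norm[OF \<psi>, of u] u by (auto intro: summable_norm_cancel)
    have "gen_fun \<psi> u = (\<Sum>t. ?f (t + Suc k)) + (\<Sum>t<Suc k. ?f t)"
      unfolding gen_fun_def by (rule suminf_split_initial_segment[OF sm])
    also have "(\<Sum>t<Suc k. ?f t) = of_real (\<psi> (Suc k)) * u ^ Suc k" by (simp add: k0)
    finally have eq: "gen_fun \<psi> u = (\<Sum>t. ?f (t + Suc k)) + of_real (\<psi> (Suc k)) * u ^ Suc k" .
    have tail_s: "summable (\<lambda>t. \<psi> (Suc (t + Suc k)))"
      using sums summable_ignore_initial_segment[of "\<lambda>t. \<psi> (Suc t)" "Suc k"] by (simp add: sums_iff)
    have "norm (\<Sum>t. ?f (t + Suc k)) \<le> (\<Sum>t. norm u ^ Suc (Suc k) * \<psi> (Suc (t + Suc k)))"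
    proof (rule norm_suminf_le)
      fix t
      have "norm u ^ t \<le> 1" using u by (intro power_le_one) auto
      have "norm (?f (t + Suc k)) = \<psi> (Suc (t + Suc k)) * norm u ^ Suc (Suc k) * norm u ^ t"
        using nn[of "t + Suc k"] by (simp add: norm_mult norm_power power_add mult_ac)
      also have "\<dots> \<le> \<psi> (Suc (t + Suc k)) * norm u ^ Suc (Suc k) * 1"
        using \<open>norm u ^ t \<le> 1\<close> nn[of "t + Suc k"] by (intro mult_left_mono) auto
      finally show "norm (?f (t + Suc k)) \<le> norm u ^ Suc (Suc k) * \<psi> (Suc (t + Suc k))"
        by (simp add: mult_ac)
    qed (intro summable_mult tail_s)
    also have "\<dots> = norm u ^ Suc (Suc k) * (\<Sum>t. \<psi> (Suc (t + Suc k)))"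
      by (rule suminf_mult[OF tail_s])
    also have "\<dots> \<le> norm u ^ Suc (Suc k) * 1"
    proof (rule mult_left_mono)
      have "(\<Sum>t. \<psi> (Suc t)) = (\<Sum>t. \<psi> (Suc (t + Suc k))) + (\<Sum>t<Suc k. \<psi> (Suc t))"
        using suminf_split_initial_segment[of "\<lambda>t. \<psi> (Suc t)" "Suc k"] sums by (simp add: sums_iff)
      moreover have "0 \<le> (\<Sum>t<Suc k. \<psi> (Suc t))" by (intro sum_nonneg nn)
      ultimately show "(\<Sum>t. \<psi> (Suc (t + Suc k))) \<le> 1" using sums by (simp add: sums_iff)
    qed auto
    also have "\<dots> < \<psi> (Suc k) * norm u ^ Suc k"
      using u u0 by simp
    also have "\<dots> = norm (of_real (\<psi> (Suc k)) * u ^ Suc k)" using nn[of k] by (simp add: norm_mult norm_power)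
    finally have less: "norm (\<Sum>t. ?f (t + Suc k)) < norm (of_real (\<psi> (Suc k)) * u ^ Suc k)" .
    have "X + Y \<noteq> 0" if "norm X < norm Y" for X Y :: complex
      using that by (auto simp: add_eq_0_iff)
    from this[OF less] show "gen_fun \<psi> u \<noteq> 0" unfolding eq .
  qed auto
qed

text \<open>
  Here \<open>p n m\<close> stands for the probability of \<open>n\<close> arrivals up to time \<open>m\<close>.  The
  recursion comes from splitting off one waiting time.
\<close>

locale discrete_renewal =
  fixes \<psi> :: "nat \<Rightarrow> real" and p :: "nat \<Rightarrow> nat \<Rightarrow> real"
  assumes \<psi>: "waiting_time_density \<psi>"
    and p_0: "p 0 m = 1 - (\<Sum>k<m. \<psi> (Suc k))"
    and p_Suc: "p (Suc n) m = (\<Sum>k<m. \<psi> (Suc k) * p n (m - Suc k))"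
begin

lemma p_nonneg: "0 \<le> p n m"
proof (induction n arbitrary: m)
  case 0
  have "(\<Sum>k<m. \<psi> (Suc k)) \<le> (\<Sum>k. \<psi> (Suc k))"
    using waiting_time_density_sums[OF \<psi>] waiting_time_density_nonneg[OF \<psi>]
    by (intro sum_le_suminf) (auto simp: sums_iff)
  then show ?case using waiting_time_density_sums[OF \<psi>] by (simp add: p_0 sums_iff)
next
  case (Suc n) then show ?case
    unfolding p_Suc by (intro sum_nonneg mult_nonneg_nonneg waiting_time_density_nonneg[OF \<psi>])
qed

lemma p_eq_0: "m < n \<Longrightarrow> p n m = 0"
proof (induction n arbitrary: m)
  case (Suc n) then show ?case unfolding p_Suc by (intro sum.neutral) auto
qed simp

lemma p_total: "(\<Sum>n\<le>m. p n m) = 1"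
proof (induction m rule: less_induct)
  case (less m)
  have "(\<Sum>n\<le>m. p n m) = p 0 m + (\<Sum>n<m. p (Suc n) m)" by (simp add: sum.atMost_shift)
  also have "(\<Sum>n<m. p (Suc n) m) = (\<Sum>k<m. \<Sum>n<m. \<psi> (Suc k) * p n (m - Suc k))"
    unfolding p_Suc by (rule sum.swap)
  also have "\<dots> = (\<Sum>k<m. \<psi> (Suc k))"
  proof (rule sum.cong)
    fix k assume k: "k \<in> {..<m}"
    have "(\<Sum>n<m. p n (m - Suc k)) = (\<Sum>n\<le>m - Suc k. p n (m - Suc k))"
      using k by (intro sum.mono_neutral_right) (auto simp: p_eq_0)
    also have "\<dots> = 1" using k by (intro less.IH) auto
    finally show "(\<Sum>n<m. \<psi> (Suc k) * p n (m - Suc k)) = \<psi> (Suc k)"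
      by (simp add: sum_distrib_left[symmetric])
  qed simp
  finally show ?case by (simp add: p_0)
qed

text \<open>
  The expectation of \<open>a ^ N(m) * b ^ (m - N(m))\<close>.
\<close>

definition jump_average :: "complex \<Rightarrow> complex \<Rightarrow> nat \<Rightarrow> complex" where
  "jump_average a b m = (\<Sum>n\<le>m. of_real (p n m) * a ^ n * b ^ (m - n))"

lemma norm_jump_average_le:
  assumes "norm a \<le> 1" "norm b \<le> 1" shows "norm (jump_average a b m) \<le> 1"
proof -
  have "norm (jump_average a b m) \<le> (\<Sum>n\<le>m. p n m)"
    unfolding jump_average_def
  proof (rule sum_norm_le)
    fix n
    have "norm a ^ n * norm b ^ (m - n) \<le> 1 * 1"
      using assms by (intro mult_mono power_le_one) auto
    then have "p n m * (norm a ^ n * norm b ^ (m - n)) \<le> p n m * 1"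
      by (intro mult_left_mono p_nonneg) auto
    then show "norm (of_real (p n m) * a ^ n * b ^ (m - n)) \<le> p n m"
      using p_nonneg[of n m] by (simp add: norm_mult norm_power mult.assoc)
  qed
  then show ?thesis by (simp add: p_total)
qed

lemma jump_average_0: "jump_average a b 0 = 1" by (simp add: jump_average_def p_0)

text \<open>
  A first arrival at time \<open>k + 1\<close> contributes \<open>k\<close> factors \<open>b\<close>, one factor \<open>a\<close>, and then an independent
  copy of the process that starts with \<open>m - k - 1\<close> remaining steps.
\<close>

lemma jump_average_recursion:
  "jump_average a b m = of_real (p 0 m) * b ^ m + (\<Sum>k<m. of_real (\<psi> (Suc k)) * a * b ^ k * jump_average a b (m - Suc k))"
proof -
  let ?t = "\<lambda>k n. complex_of_real (\<psi> (Suc k)) * of_real (p n (m - Suc k)) * a ^ Suc n * b ^ (m - Suc n)"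
  have "jump_average a b m = of_real (p 0 m) * b ^ m + (\<Sum>n<m. of_real (p (Suc n) m) * a ^ Suc n * b ^ (m - Suc n))"
    unfolding jump_average_def by (simp add: sum.atMost_shift)
  also have "(\<Sum>n<m. of_real (p (Suc n) m) * a ^ Suc n * b ^ (m - Suc n)) =
      (\<Sum>n<m. \<Sum>k<m. ?t k n)"
    by (simp add: p_Suc sum_distrib_right)
  also have "\<dots> = (\<Sum>k<m. \<Sum>n<m. ?t k n)"
    by (rule sum.swap)
  also have "\<dots> = (\<Sum>k<m. of_real (\<psi> (Suc k)) * a * b ^ k * jump_average a b (m - Suc k))"
  proof (rule sum.cong)
    fix k assume k: "k \<in> {..<m}"
    have "(\<Sum>n<m. ?t k n) =
       (\<Sum>n\<le>m - Suc k. ?t k n)"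
      using k by (intro sum.mono_neutral_right) (auto simp: p_eq_0)
    also have "\<dots> = (\<Sum>n\<le>m - Suc k. of_real (\<psi> (Suc k)) * a * b ^ k * (of_real (p n (m - Suc k)) * a ^ n * b ^ (m - Suc k - n)))"
    proof (rule sum.cong)
      fix n assume n: "n \<in> {..m - Suc k}"
      then have "m - Suc n = k + (m - Suc k - n)" using k by auto
      then show "?t k n =
        of_real (\<psi> (Suc k)) * a * b ^ k * (of_real (p n (m - Suc k)) * a ^ n * b ^ (m - Suc k - n))"
        by (simp add: power_add mult_ac)
    qed simp
    finally show "(\<Sum>n<m. ?t k n) =
      of_real (\<psi> (Suc k)) * a * b ^ k * jump_average a b (m - Suc k)"
      by (simp add: jump_average_def sum_distrib_left)
  qed simp
  finally show ?thesis .
qed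

lemma summable_jump_average:
  assumes "norm a \<le> 1" "norm b \<le> 1" "norm z < 1"
  shows "summable (\<lambda>m. norm (jump_average a b m * z ^ m))"
proof (rule summable_comparison_test')
  show "summable (\<lambda>m. norm z ^ m)" using assms by (intro summable_geometric) auto
  show "norm (norm (jump_average a b m * z ^ m)) \<le> norm z ^ m" for m
    using mult_right_mono[OF norm_jump_average_le[OF assms(1,2), of m], of "norm z ^ m"] by (simp add: norm_mult norm_power)
qed

text \<open>
  Multiplication by \<open>1 - u\<close> telescopes, because consecutive survival probabilities differ by \<open>\<psi>\<close>.
\<close>

lemma survival_generating_function:
  assumes u: "norm u < 1"
  shows "summable (\<lambda>m. norm (of_real (p 0 m) * u ^ m))"
    and "(1 - u) * (\<Sum>m. of_real (p 0 m) * u ^ m) = 1 - gen_fun \<psi> u"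
proof -
  have p01: "p 0 m \<le> 1" for m
    unfolding p_0 using waiting_time_density_nonneg[OF \<psi>] by (simp add: sum_nonneg)
  show sn: "summable (\<lambda>m. norm (of_real (p 0 m) * u ^ m))"
  proof (rule summable_comparison_test')
    show "summable (\<lambda>m. norm u ^ m)" using assms by (intro summable_geometric) auto
    show "norm (norm (of_real (p 0 m) * u ^ m)) \<le> norm u ^ m" for m
      using mult_right_mono[OF p01[of m], of "norm u ^ m"] p_nonneg[of 0 m] by (simp add: norm_mult norm_power)
  qed
  then have s: "summable (\<lambda>m. of_real (p 0 m) * u ^ m)" by (rule summable_norm_cancel)
  have g: "summable (\<lambda>t. of_real (\<psi> (Suc t)) * u ^ Suc t)"
    using gen_fun_summable_norm[OF \<psi>, of u] u by (auto intro: summable_norm_cancel)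
  let ?G = "\<Sum>m. of_real (p 0 m) * u ^ m"
  have "?G = 1 + (\<Sum>m. of_real (p 0 (Suc m)) * u ^ Suc m)"
    using suminf_split_head[OF s] by (simp add: p_0)
  also have "(\<Sum>m. of_real (p 0 (Suc m)) * u ^ Suc m) =
      (\<Sum>m. u * (of_real (p 0 m) * u ^ m) - of_real (\<psi> (Suc m)) * u ^ Suc m)"
    by (simp add: p_0 algebra_simps)
  also have "\<dots> = (\<Sum>m. u * (of_real (p 0 m) * u ^ m)) - (\<Sum>m. of_real (\<psi> (Suc m)) * u ^ Suc m)"
    by (rule suminf_diff[symmetric, OF summable_mult[OF s] g])
  also have "(\<Sum>m. u * (of_real (p 0 m) * u ^ m)) = u * ?G"
    by (rule suminf_mult[OF s])
  finally show "(1 - u) * ?G = 1 - gen_fun \<psi> u"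
    by (simp add: gen_fun_def algebra_simps)
qed

text \<open>
  The recursion is a Cauchy product, so that the generating function \<open>C\<close> satisfies \<open>C = G + Q * C\<close> with
  \<open>b * Q = a * gen_fun \<psi> (b * z)\<close> and the survival series \<open>G\<close>.  The factor \<open>b\<close> avoids a division.
\<close>

theorem jump_average_generating_function:
  assumes a: "norm a \<le> 1" and b: "norm b \<le> 1" and z: "norm z < 1"
  shows "(1 - b * z) * (b - a * gen_fun \<psi> (b * z)) * (\<Sum>m. jump_average a b m * z ^ m) = b * (1 - gen_fun \<psi> (b * z))"
proof -
  let ?u = "b * z"
  have u: "norm ?u < 1" using b z mult_mono[of "norm b" 1 "norm z" "norm z"] by (simp add: norm_mult)
  define q where "q i = (if i = 0 then 0 else of_real (\<psi> i) * a * b ^ (i - 1) * z ^ i)" for i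
  have qS: "q (Suc t) = of_real (\<psi> (Suc t)) * a * b ^ t * z ^ Suc t" for t by (simp add: q_def)
  have qsn: "summable (\<lambda>i. norm (q i))"
  proof (subst summable_Suc_iff[symmetric], rule summable_comparison_test')
    show "summable (\<lambda>t. \<psi> (Suc t))" using waiting_time_density_sums[OF \<psi>] by (simp add: sums_iff)
    fix t
    have "norm a * (norm b ^ t * norm z ^ Suc t) \<le> 1 * (1 * 1)"
      using a b z by (intro mult_mono power_le_one mult_nonneg_nonneg zero_le_power) auto
    from mult_left_mono[OF this waiting_time_density_nonneg[OF \<psi>, of t]]
    show "norm (norm (q (Suc t))) \<le> \<psi> (Suc t)"
      using waiting_time_density_nonneg[OF \<psi>, of t] by (simp add: qS norm_mult norm_power mult_ac)
  qed
  have csn: "summable (\<lambda>m. norm (jump_average a b m * z ^ m))" by (rule summable_jump_average[OF a b z])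
  let ?C = "\<Sum>m. jump_average a b m * z ^ m" and ?Q = "\<Sum>i. q i" and ?G = "\<Sum>m. of_real (p 0 m) * ?u ^ m"
  let ?qc = "\<lambda>m. \<Sum>i\<le>m. q i * (jump_average a b (m - i) * z ^ (m - i))"
  have conv: "?qc m =
      (\<Sum>k<m. of_real (\<psi> (Suc k)) * a * b ^ k * jump_average a b (m - Suc k)) * z ^ m" for m
  proof -
    have "?qc m = (\<Sum>k<m. q (Suc k) * (jump_average a b (m - Suc k) * z ^ (m - Suc k)))"
      by (simp add: sum.atMost_shift q_def)
    also have "\<dots> = (\<Sum>k<m. of_real (\<psi> (Suc k)) * a * b ^ k * jump_average a b (m - Suc k) * z ^ m)"
    proof (rule sum.cong)
      fix k assume "k \<in> {..<m}"
      then have "m = Suc k + (m - Suc k)" by auto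
      then have "z ^ m = z ^ Suc k * z ^ (m - Suc k)" by (metis power_add)
      then show "q (Suc k) * (jump_average a b (m - Suc k) * z ^ (m - Suc k)) =
        of_real (\<psi> (Suc k)) * a * b ^ k * jump_average a b (m - Suc k) * z ^ m"
        by (simp add: qS mult_ac)
    qed simp
    finally show ?thesis by (simp add: sum_distrib_right)
  qed
  have split: "jump_average a b m * z ^ m = of_real (p 0 m) * ?u ^ m + ?qc m" for m
    unfolding conv by (subst jump_average_recursion) (simp add: distrib_right power_mult_distrib mult.assoc)
  have "?C = (\<Sum>m. of_real (p 0 m) * ?u ^ m + ?qc m)"
    by (subst split) (rule refl)
  also have "\<dots> = ?G + (\<Sum>m. ?qc m)"
    by (rule suminf_add[symmetric, OF summable_norm_cancel[OF survival_generating_function(1)[OF u]]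
          summable_Cauchy_product[OF qsn csn]])
  also have "(\<Sum>m. ?qc m) = ?Q * ?C"
    by (rule Cauchy_product[OF qsn csn, symmetric])
  finally have C: "?C = ?G + ?Q * ?C" .
  have "b * ?Q = b * (\<Sum>t. q (Suc t))"
    using suminf_split_head[OF summable_norm_cancel[OF qsn]] by (simp add: q_def)
  also have "\<dots> = (\<Sum>t. b * q (Suc t))"
    using summable_norm_cancel[OF qsn] by (intro suminf_mult[symmetric]) (simp add: summable_Suc_iff)
  also have "\<dots> = (\<Sum>t. a * (of_real (\<psi> (Suc t)) * ?u ^ Suc t))"
    by (simp add: qS power_mult_distrib mult_ac)
  also have "\<dots> = a * gen_fun \<psi> ?u"
    unfolding gen_fun_def using gen_fun_summable_norm[OF \<psi>, of ?u] u
    by (intro suminf_mult) (auto intro: summable_norm_cancel)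
  finally have Q: "b * ?Q = a * gen_fun \<psi> ?u" .
  have "(1 - b * z) * (b - a * gen_fun \<psi> ?u) * ?C = (1 - ?u) * b * (?C - ?Q * ?C)"
    by (simp add: Q[symmetric] algebra_simps)
  also have "?C - ?Q * ?C = ?G" using C by (metis add_diff_cancel_right')
  also have "(1 - ?u) * b * ?G = b * ((1 - ?u) * ?G)" by (simp only: mult_ac)
  also have "\<dots> = b * (1 - gen_fun \<psi> ?u)" by (simp only: survival_generating_function(2)[OF u])
  finally show ?thesis .
qed

end

section \<open>Laws of renewal counts\<close>

text \<open>
  When the arrival times increase beyond \<open>t\<close>, the set whose maximum defines the count is an initial
  segment.
\<close>

lemma renewal_count_eq_iff:
  fixes X :: "nat \<Rightarrow> 'w \<Rightarrow> 't::{comm_monoid_add, linorder}"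
  assumes mono: "\<And>n. (\<Sum>j<n. X j \<omega>) \<le> (\<Sum>j<Suc n. X j \<omega>)"
    and esc: "\<exists>n. \<not> (\<Sum>j<n. X j \<omega>) \<le> t" and t: "0 \<le> t"
  shows "renewal_count X t \<omega> = m \<longleftrightarrow> (\<Sum>j<m. X j \<omega>) \<le> t \<and> \<not> (\<Sum>j<Suc m. X j \<omega>) \<le> t"
proof -
  define S where "S n = (\<Sum>j<n. X j \<omega>)" for n
  have S0: "S 0 \<le> t" using t by (simp add: S_def)
  have "S n \<le> S (Suc n)" for n using mono by (simp only: S_def)
  then have mS: "S i \<le> S j" if "i \<le> j" for i j using that by (rule lift_Suc_mono_le)
  obtain n where n: "\<not> S n \<le> t" using esc by (auto simp: S_def)
  have bd: "i < n" if "S i \<le> t" for i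
  proof (rule ccontr)
    assume "\<not> i < n"
    then have "S n \<le> S i" by (intro mS) simp
    with that n show False by (meson order_trans)
  qed
  have fin: "finite {i. S i \<le> t}" by (rule finite_subset[of _ "{..<n}"]) (auto intro: bd)
  have ne: "{i. S i \<le> t} \<noteq> {}" using S0 by auto
  have "renewal_count X t \<omega> = m \<longleftrightarrow> Max {i. S i \<le> t} = m" by (simp add: renewal_count_def S_def)
  also have "\<dots> \<longleftrightarrow> S m \<le> t \<and> (\<forall>i. S i \<le> t \<longrightarrow> i \<le> m)"
    using Max_eq_iff[OF fin ne, of m] by auto
  also have "\<dots> \<longleftrightarrow> S m \<le> t \<and> \<not> S (Suc m) \<le> t"
  proof (intro conj_cong refl iffI allI impI)
    assume "\<forall>i. S i \<le> t \<longrightarrow> i \<le> m" then show "\<not> S (Suc m) \<le> t" by (metis Suc_n_not_le_n)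
  next
    fix i assume "\<not> S (Suc m) \<le> t" "S i \<le> t"
    then show "i \<le> m" using mS[of "Suc m" i] by (meson not_less_eq_eq order_trans)
  qed
  finally show ?thesis by (simp add: S_def)
qed

text \<open>
  The event is measurable for arbitrary outcomes, also on the null event where the maximum is taken
  over an infinite set; otherwise its \<open>measure\<close> would be \<open>0\<close> by convention.
\<close>

lemma (in prob_space) prob_renewal_count:
  fixes X :: "nat \<Rightarrow> 'a \<Rightarrow> 't::{comm_monoid_add, linorder}"
  assumes meas [measurable]: "\<And>n. Measurable.pred M (\<lambda>\<omega>. (\<Sum>j<n. X j \<omega>) \<le> t)"
    and mono: "AE \<omega> in M. \<forall>n. (\<Sum>j<n. X j \<omega>) \<le> (\<Sum>j<Suc n. X j \<omega>)"
    and esc: "AE \<omega> in M. \<exists>n. \<not> (\<Sum>j<n. X j \<omega>) \<le> t" and t: "0 \<le> t"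
  shows "prob {\<omega>\<in>space M. renewal_count X t \<omega> = m} =
     prob {\<omega>\<in>space M. (\<Sum>j<m. X j \<omega>) \<le> t} - prob {\<omega>\<in>space M. (\<Sum>j<Suc m. X j \<omega>) \<le> t}"
proof -
  let ?A = "\<lambda>n. {\<omega>\<in>space M. (\<Sum>j<n. X j \<omega>) \<le> t}"
  have rc [measurable]: "(\<lambda>\<omega>. renewal_count X t \<omega>) \<in> measurable M (count_space UNIV)"
    unfolding renewal_count_def by (rule measurable_Max_nat) (rule meas)
  have sA: "?A n \<in> events" for n using meas[of n] by (simp add: pred_def)
  have rcs: "{\<omega>\<in>space M. renewal_count X t \<omega> = m} \<in> events" by measurable
  have "prob {\<omega>\<in>space M. renewal_count X t \<omega> = m} = prob (?A m - ?A (Suc m))"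
  proof (rule finite_measure_eq_AE)
    show "AE \<omega> in M. (\<omega> \<in> {\<omega>\<in>space M. renewal_count X t \<omega> = m}) = (\<omega> \<in> ?A m - ?A (Suc m))"
      using mono esc
    proof eventually_elim
      case (elim \<omega>)
      then show ?case using renewal_count_eq_iff[of X \<omega> t m] t by auto
    qed
  qed (intro rcs sets.Diff sA)+
  also have "\<dots> = prob (?A m) - prob (?A m \<inter> ?A (Suc m))"
    by (intro finite_measure_Diff' sA)
  also have "prob (?A m \<inter> ?A (Suc m)) = prob (?A (Suc m))"
  proof (rule finite_measure_eq_AE)
    show "AE \<omega> in M. (\<omega> \<in> ?A m \<inter> ?A (Suc m)) = (\<omega> \<in> ?A (Suc m))"
      using mono
    proof eventually_elim
      case (elim \<omega>)
      then have "(\<Sum>j<m. X j \<omega>) \<le> (\<Sum>j<Suc m. X j \<omega>)" by blast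
      then show ?case by (auto simp del: sum.lessThan_Suc intro: order_trans)
    qed
  qed (intro sets.Int sA)+
  finally show ?thesis .
qed

text \<open>
  The event of at most \<open>m\<close> units of time for \<open>n + 1\<close> waiting times is split according to the value of
  the last one, which is independent of the others.
\<close>

lemma (in prob_space) discrete_renewal_counts:
  fixes \<Delta> :: "nat \<Rightarrow> 'a \<Rightarrow> nat"
  assumes \<psi>: "waiting_time_density \<psi>"
    and indep: "indep_vars (\<lambda>_. count_space UNIV) \<Delta> UNIV"
    and law: "\<And>j k. k \<ge> 1 \<Longrightarrow> prob {\<omega> \<in> space M. \<Delta> j \<omega> = k} = \<psi> k"
  shows "discrete_renewal \<psi> (\<lambda>n m. prob {\<omega>\<in>space M. renewal_count \<Delta> m \<omega> = n})"
proof -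
  have D [measurable]: "\<Delta> j \<in> measurable M (count_space UNIV)" for j
    using indep by (auto simp: indep_vars_def)
  have ev: "{\<omega>\<in>space M. \<Delta> j \<omega> = k} \<in> events" for j k by measurable
  have pos: "AE \<omega> in M. 1 \<le> \<Delta> j \<omega>" for j
  proof -
    have dis: "disjoint_family (\<lambda>k. {\<omega>\<in>space M. \<Delta> j \<omega> = Suc k})" by (auto simp: disjoint_family_on_def)
    have "(\<lambda>k. prob {\<omega>\<in>space M. \<Delta> j \<omega> = Suc k}) sums prob (\<Union>k. {\<omega>\<in>space M. \<Delta> j \<omega> = Suc k})"
      by (rule finite_measure_UNION[OF _ dis]) (use ev in auto)
    moreover have "(\<lambda>k. prob {\<omega>\<in>space M. \<Delta> j \<omega> = Suc k}) = (\<lambda>k. \<psi> (Suc k))" by (auto simp: law)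
    ultimately have "prob (\<Union>k. {\<omega>\<in>space M. \<Delta> j \<omega> = Suc k}) = 1"
      using sums_unique2[OF _ waiting_time_density_sums[OF \<psi>]] by simp
    moreover have "(\<Union>k. {\<omega>\<in>space M. \<Delta> j \<omega> = Suc k}) \<in> events" using ev by auto
    ultimately have "AE \<omega> in M. \<omega> \<in> (\<Union>k. {\<omega>\<in>space M. \<Delta> j \<omega> = Suc k})" by (simp add: prob_eq_1)
    then show ?thesis by eventually_elim auto
  qed
  then have pos: "AE \<omega> in M. \<forall>j. 1 \<le> \<Delta> j \<omega>" by (simp add: AE_all_countable)
  define q where "q n m = prob {\<omega>\<in>space M. (\<Sum>j<n. \<Delta> j \<omega>) \<le> m}" for n m
  have rc: "prob {\<omega>\<in>space M. renewal_count \<Delta> m \<omega> = n} = q n m - q (Suc n) m" for n m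
    unfolding q_def
  proof (rule prob_renewal_count)
    show "AE \<omega> in M. \<exists>n. \<not> (\<Sum>j<n. \<Delta> j \<omega>) \<le> m"
      using pos
    proof eventually_elim
      case (elim \<omega>)
      have "(\<Sum>j<Suc m. 1) \<le> (\<Sum>j<Suc m. \<Delta> j \<omega>)" by (rule sum_mono) (use elim in auto)
      then have "\<not> (\<Sum>j<Suc m. \<Delta> j \<omega>) \<le> m" by simp
      then show ?case by blast
    qed
  qed auto
  have q0: "q 0 m = 1" for m by (simp add: q_def prob_space)
  have qS: "q (Suc n) m = (\<Sum>k<m. \<psi> (Suc k) * q n (m - Suc k))" for n m
  proof -
    let ?E = "\<lambda>k. {\<omega>\<in>space M. \<Delta> n \<omega> = Suc k \<and> (\<Sum>j<n. \<Delta> j \<omega>) \<le> m - Suc k}"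
    have Ee: "?E k \<in> events" for k by measurable
    have "q (Suc n) m = prob (\<Union>k\<in>{..<m}. ?E k)"
      unfolding q_def
    proof (rule finite_measure_eq_AE)
      show "AE \<omega> in M. (\<omega> \<in> {\<omega>\<in>space M. (\<Sum>j<Suc n. \<Delta> j \<omega>) \<le> m}) = (\<omega> \<in> (\<Union>k\<in>{..<m}. ?E k))"
        using pos
      proof eventually_elim
        case (elim \<omega>)
        obtain k where k: "\<Delta> n \<omega> = Suc k" using elim by (metis One_nat_def Suc_le_D)
        show ?case
        proof
          assume "\<omega> \<in> {\<omega>\<in>space M. (\<Sum>j<Suc n. \<Delta> j \<omega>) \<le> m}"
          then have "\<omega> \<in> ?E k" "k < m" using k by auto
          then show "\<omega> \<in> (\<Union>k\<in>{..<m}. ?E k)" by blast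
        qed auto
      qed
      show "{\<omega>\<in>space M. (\<Sum>j<Suc n. \<Delta> j \<omega>) \<le> m} \<in> events" by measurable
    qed (use Ee in auto)
    also have "\<dots> = (\<Sum>k<m. prob (?E k))"
      by (rule finite_measure_finite_Union) (use Ee in \<open>auto simp: disjoint_family_on_def\<close>)
    also have "\<dots> = (\<Sum>k<m. \<psi> (Suc k) * q n (m - Suc k))"
    proof (rule sum.cong)
      fix k
      have "indep_vars (\<lambda>_. borel) (\<lambda>j \<omega>. real (\<Delta> j \<omega>)) UNIV"
        by (rule indep_vars_compose2[OF indep]) auto
      then have "indep_vars (\<lambda>_. borel) (\<lambda>j \<omega>. real (\<Delta> j \<omega>)) (insert n {..<n})"
        by (rule indep_vars_subset) auto
      then have iv: "indep_var borel (\<lambda>\<omega>. real (\<Delta> n \<omega>)) borel (\<lambda>\<omega>. \<Sum>i<n. real (\<Delta> i \<omega>))"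
        by (intro indep_vars_sum) auto
      have "prob ((\<lambda>\<omega>. (real (\<Delta> n \<omega>), \<Sum>i<n. real (\<Delta> i \<omega>))) -` ({real (Suc k)} \<times> {..real (m - Suc k)}) \<inter> space M) =
        prob ((\<lambda>\<omega>. real (\<Delta> n \<omega>)) -` {real (Suc k)} \<inter> space M) *
        prob ((\<lambda>\<omega>. \<Sum>i<n. real (\<Delta> i \<omega>)) -` {..real (m - Suc k)} \<inter> space M)"
        by (rule indep_varD[OF iv]) auto
      also have "(\<lambda>\<omega>. (real (\<Delta> n \<omega>), \<Sum>i<n. real (\<Delta> i \<omega>))) -` ({real (Suc k)} \<times> {..real (m - Suc k)}) \<inter> space M = ?E k"
        by (auto simp del: of_nat_sum of_nat_diff of_nat_Suc simp: of_nat_sum[symmetric])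
      also have "(\<lambda>\<omega>. real (\<Delta> n \<omega>)) -` {real (Suc k)} \<inter> space M = {\<omega>\<in>space M. \<Delta> n \<omega> = Suc k}"
        by (auto simp del: of_nat_Suc)
      also have "(\<lambda>\<omega>. \<Sum>i<n. real (\<Delta> i \<omega>)) -` {..real (m - Suc k)} \<inter> space M = {\<omega>\<in>space M. (\<Sum>j<n. \<Delta> j \<omega>) \<le> m - Suc k}"
        by (auto simp del: of_nat_sum of_nat_diff of_nat_Suc simp: of_nat_sum[symmetric])
      finally show "prob (?E k) = \<psi> (Suc k) * q n (m - Suc k)" by (simp add: q_def law)
    qed simp
    finally show ?thesis .
  qed
  show ?thesis
  proof
    show "waiting_time_density \<psi>" by (rule \<psi>)
    show "prob {\<omega>\<in>space M. renewal_count \<Delta> m \<omega> = 0} = 1 - (\<Sum>k<m. \<psi> (Suc k))" for m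
      unfolding rc by (simp add: q0 qS)
    show "prob {\<omega>\<in>space M. renewal_count \<Delta> m \<omega> = Suc n} =
      (\<Sum>k<m. \<psi> (Suc k) * prob {\<omega>\<in>space M. renewal_count \<Delta> (m - Suc k) \<omega> = n})" for n m
      unfolding rc qS[of "Suc n"] by (subst qS) (simp add: right_diff_distrib sum_subtractf)
  qed
qed

section \<open>The continuous renewal process\<close>

locale continuous_renewal = prob_space M for M :: "'a measure" +
  fixes T :: "nat \<Rightarrow> 'a \<Rightarrow> real" and \<eta> :: "real \<Rightarrow> real"
  assumes eta_nonneg: "\<And>t. 0 \<le> \<eta> t" and eta_neg: "\<And>t. t < 0 \<Longrightarrow> \<eta> t = 0"
    and indep: "indep_vars (\<lambda>_. borel) T UNIV"
    and dist: "\<And>j. distributed M lborel (T j) (\<lambda>t. ennreal (\<eta> t))"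
begin

definition eta_transform :: "real \<Rightarrow> real" where "eta_transform s = (LINT t|lborel. \<eta> t * exp (- s * t))"

definition arrival_time :: "nat \<Rightarrow> 'a \<Rightarrow> real" where "arrival_time n \<omega> = (\<Sum>j<n. T j \<omega>)"

definition arrival_cdf :: "nat \<Rightarrow> real \<Rightarrow> real" where "arrival_cdf n t = prob {\<omega>\<in>space M. arrival_time n \<omega> \<le> t}"

lemma T_measurable [measurable]: "T j \<in> borel_measurable M"
  using distributed_measurable[OF dist[of j]] by simp

lemma arrival_time_measurable [measurable]: "arrival_time n \<in> borel_measurable M"
  unfolding arrival_time_def by measurable

lemma eta_measurable [measurable]: "\<eta> \<in> borel_measurable borel"
  using distributed_real_measurable[OF _ dist[of 0]] eta_nonneg by simp

lemma T_pos: "AE \<omega> in M. \<forall>j. 0 < T j \<omega>"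
proof -
  have "AE \<omega> in M. 0 < T j \<omega>" for j
  proof (subst distributed_AE2[OF dist[of j], of "\<lambda>x. 0 < x"])
    show "AE x in lborel. 0 < ennreal (\<eta> x) \<longrightarrow> 0 < x"
      using AE_lborel_singleton[of 0]
    proof eventually_elim
      case (elim x) then show ?case by (cases "x < 0") (auto simp: eta_neg)
    qed
  qed measurable
  then show ?thesis by (simp add: AE_all_countable)
qed

lemma T_nonneg: "AE \<omega> in M. \<forall>j. 0 \<le> T j \<omega>"
  using T_pos by eventually_elim (simp add: less_imp_le)

lemma arrival_time_mono: "AE \<omega> in M. \<forall>n. arrival_time n \<omega> \<le> arrival_time (Suc n) \<omega>"
  using T_nonneg by eventually_elim (auto simp: arrival_time_def)

lemma arrival_time_nonneg: "AE \<omega> in M. \<forall>n. 0 \<le> arrival_time n \<omega>"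
  using T_nonneg by eventually_elim (auto simp: arrival_time_def intro!: sum_nonneg)

lemma expectation_exp_T: "expectation (\<lambda>\<omega>. exp (- s * T j \<omega>)) = eta_transform s"
  unfolding eta_transform_def by (rule distributed_integral[OF dist[of j], symmetric]) (auto simp: eta_nonneg)

lemma integrable_exp_T: "0 \<le> s \<Longrightarrow> integrable M (\<lambda>\<omega>. exp (- s * T j \<omega>))"
  by (rule integrable_const_bound[where B = 1])
     (use T_nonneg in \<open>auto elim!: eventually_mono intro!: mult_nonneg_nonneg\<close>)

lemma integrable_exp_arrival_time: "0 \<le> s \<Longrightarrow> integrable M (\<lambda>\<omega>. exp (- s * arrival_time n \<omega>))"
  by (rule integrable_const_bound[where B = 1])
     (use arrival_time_nonneg in \<open>auto elim!: eventually_mono intro!: mult_nonneg_nonneg\<close>)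

lemma eta_transform_pos: "0 \<le> s \<Longrightarrow> 0 < eta_transform s"
  unfolding expectation_exp_T[of s 0, symmetric]
  by (rule expectation_greater, rule integrable_exp_T) auto

lemma eta_transform_less_1: "0 < s \<Longrightarrow> eta_transform s < 1"
  unfolding expectation_exp_T[of s 0, symmetric]
  by (rule expectation_less, rule integrable_exp_T) (use T_pos in \<open>auto elim!: eventually_mono\<close>)

text \<open>
  Dominated convergence, since interarrival times are positive almost surely.  This brings the
  argument of the generating function close to \<open>0\<close>, where \<open>0\<close> is its only zero.
\<close>

lemma eta_transform_tendsto_0: "(\<lambda>n. eta_transform (real n)) \<longlonglongrightarrow> 0"
proof -
  have "(\<lambda>n. expectation (\<lambda>\<omega>. exp (- real n * T 0 \<omega>))) \<longlonglongrightarrow> expectation (\<lambda>\<omega>. 0)"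
  proof (rule integral_dominated_convergence[where w = "\<lambda>_. 1"])
    show "AE \<omega> in M. (\<lambda>n. exp (- real n * T 0 \<omega>)) \<longlonglongrightarrow> 0"
      using T_pos
    proof eventually_elim
      case (elim \<omega>)
      have eq: "(\<lambda>n. exp (- real n * T 0 \<omega>)) = (\<lambda>n. exp (- T 0 \<omega>) ^ n)"
        by (simp add: exp_of_nat_mult[symmetric])
      show ?case unfolding eq by (rule LIMSEQ_power_zero) (use elim in simp)
    qed
    show "AE \<omega> in M. norm (exp (- real n * T 0 \<omega>)) \<le> 1" for n
      using T_nonneg by eventually_elim (auto intro!: mult_nonneg_nonneg)
  qed auto
  then show ?thesis by (simp only: expectation_exp_T) simp
qed

lemma expectation_exp_arrival_time: "0 \<le> s \<Longrightarrow> expectation (\<lambda>\<omega>. exp (- s * arrival_time n \<omega>)) = eta_transform s ^ n"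
proof -
  assume s: "0 \<le> s"
  have "indep_vars (\<lambda>_. borel) (\<lambda>j \<omega>. exp (- s * T j \<omega>)) UNIV"
    by (rule indep_vars_compose2[OF indep]) auto
  then have iv: "indep_vars (\<lambda>_. borel) (\<lambda>j \<omega>. exp (- s * T j \<omega>)) {..<n}"
    by (rule indep_vars_subset) auto
  have "expectation (\<lambda>\<omega>. exp (- s * arrival_time n \<omega>)) = expectation (\<lambda>\<omega>. \<Prod>j<n. exp (- s * T j \<omega>))"
    by (simp add: arrival_time_def exp_sum[symmetric] sum_distrib_left sum_negf)
  also have "\<dots> = (\<Prod>j<n. expectation (\<lambda>\<omega>. exp (- s * T j \<omega>)))"
    by (rule indep_vars_lebesgue_integral[OF _ iv integrable_exp_T[OF s]]) simp
  finally show ?thesis by (simp only: expectation_exp_T) simp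
qed

text \<open>
  The exponential Markov inequality.  It makes the renewal series converge and rules out infinitely
  many arrivals in finite time.
\<close>

lemma arrival_cdf_bound: "arrival_cdf n t \<le> exp t * eta_transform 1 ^ n"
proof -
  have "arrival_cdf n t = expectation (indicator {\<omega>\<in>space M. arrival_time n \<omega> \<le> t})"
    by (simp add: arrival_cdf_def)
  also have "\<dots> \<le> expectation (\<lambda>\<omega>. exp t * exp (- 1 * arrival_time n \<omega>))"
  proof (rule integral_mono)
    show "integrable M (\<lambda>\<omega>. exp t * exp (- 1 * arrival_time n \<omega>))" by (intro integrable_mult_right integrable_exp_arrival_time) simp
    show "indicator {\<omega>\<in>space M. arrival_time n \<omega> \<le> t} \<omega> \<le> exp t * exp (- 1 * arrival_time n \<omega>)" for \<omega>
      by (auto simp: indicator_def exp_add[symmetric])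
  qed (auto simp: emeasure_eq_measure)
  also have "\<dots> = exp t * eta_transform 1 ^ n" using expectation_exp_arrival_time[of 1 n] by simp
  finally show ?thesis .
qed

lemma arrival_cdf_nonneg: "0 \<le> arrival_cdf n t" by (simp add: arrival_cdf_def)

lemma summable_arrival_cdf: "summable (\<lambda>n. arrival_cdf n t)"
proof (rule summable_comparison_test')
  show "summable (\<lambda>n. exp t * eta_transform 1 ^ n)"
    using eta_transform_pos[of 1] eta_transform_less_1[of 1] by (intro summable_mult summable_geometric) auto
  show "norm (arrival_cdf n t) \<le> exp t * eta_transform 1 ^ n" for n using arrival_cdf_bound arrival_cdf_nonneg by simp
qed

lemma arrival_cdf_0: "0 \<le> t \<Longrightarrow> arrival_cdf 0 t = 1" by (simp add: arrival_cdf_def arrival_time_def prob_space)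

text \<open>
  The bound above tends to \<open>0\<close> with the number of arrivals.
\<close>

lemma arrival_time_escapes: "AE \<omega> in M. \<exists>n. \<not> arrival_time n \<omega> \<le> t"
proof -
  have ev: "{\<omega>\<in>space M. \<forall>n. arrival_time n \<omega> \<le> t} \<in> events" by measurable
  have "prob {\<omega>\<in>space M. \<forall>n. arrival_time n \<omega> \<le> t} \<le> arrival_cdf n t" for n
    unfolding arrival_cdf_def by (rule finite_measure_mono) auto
  moreover have "(\<lambda>n. arrival_cdf n t) \<longlonglongrightarrow> 0" by (rule summable_LIMSEQ_zero[OF summable_arrival_cdf])
  ultimately have "prob {\<omega>\<in>space M. \<forall>n. arrival_time n \<omega> \<le> t} \<le> 0"
    by (intro LIMSEQ_le_const) auto
  then have "prob {\<omega>\<in>space M. \<forall>n. arrival_time n \<omega> \<le> t} = 0" by (simp add: measure_le_0_iff)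
  then have "AE \<omega> in M. \<omega> \<notin> {\<omega>\<in>space M. \<forall>n. arrival_time n \<omega> \<le> t}" using prob_eq_0[OF ev] by simp
  with AE_space show ?thesis by eventually_elim auto
qed

lemma prob_renewal_count_T:
  assumes "0 \<le> t"
  shows "prob {\<omega>\<in>space M. renewal_count T t \<omega> = m} = arrival_cdf m t - arrival_cdf (Suc m) t"
  unfolding arrival_cdf_def arrival_time_def
  by (rule prob_renewal_count) (use arrival_time_mono arrival_time_escapes[of t] assms in \<open>auto simp: arrival_time_def\<close>)

text \<open>
  Convolution produces a density with values in the extended reals; it is finite almost everywhere,
  being of total mass \<open>1\<close>, and can be replaced by a real one.
\<close>

lemma ex_arrival_pdf:
  "\<exists>g. (\<forall>t. 0 \<le> g t) \<and> (\<forall>t<0. g t = 0) \<and> distributed M lborel (arrival_time (Suc n)) (\<lambda>t. ennreal (g t))"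
proof (induction n)
  case 0
  have "arrival_time (Suc 0) = T 0" by (auto simp: arrival_time_def)
  then show ?case using dist[of 0] eta_nonneg eta_neg by auto
next
  case (Suc n)
  then obtain g where g: "\<And>t. 0 \<le> g t" "\<And>t. t < 0 \<Longrightarrow> g t = 0"
    and gd: "distributed M lborel (arrival_time (Suc n)) (\<lambda>t. ennreal (g t))" by blast
  have [measurable]: "g \<in> borel_measurable borel" using distributed_real_measurable[OF _ gd] g by simp
  have "indep_vars (\<lambda>_. borel) T (insert (Suc n) {..<Suc n})"
    by (rule indep_vars_subset[OF indep]) auto
  then have iv: "indep_var borel (T (Suc n)) borel (arrival_time (Suc n))"
    unfolding arrival_time_def[abs_def] by (intro indep_vars_sum) auto
  define d where "d x = (\<integral>\<^sup>+y. ennreal (\<eta> (x - y)) * ennreal (g y) \<partial>lborel)" for x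
  have [measurable]: "d \<in> borel_measurable borel" unfolding d_def[abs_def] by measurable
  have "(\<lambda>\<omega>. T (Suc n) \<omega> + arrival_time (Suc n) \<omega>) = arrival_time (Suc (Suc n))" by (auto simp: arrival_time_def)
  then have dd: "distributed M lborel (arrival_time (Suc (Suc n))) d"
    using distributed_convolution[OF iv dist gd] by (simp add: d_def[abs_def])
  have "(\<integral>\<^sup>+x. d x \<partial>lborel) = emeasure M (arrival_time (Suc (Suc n)) -` UNIV \<inter> space M)"
    by (subst distributed_emeasure[OF dd]) auto
  then have "(\<integral>\<^sup>+x. d x \<partial>lborel) \<noteq> \<infinity>" by (simp add: emeasure_space_1)
  then have fin: "AE x in lborel. d x \<noteq> \<infinity>" by (intro nn_integral_PInf_AE) auto
  have dneg: "d x = 0" if "x < 0" for x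
  proof -
    have "ennreal (\<eta> (x - y)) * ennreal (g y) = 0" for y
      using that g(2)[of y] eta_neg[of "x - y"] by (cases "y < 0") auto
    then show ?thesis by (simp only: d_def nn_integral_const) simp
  qed
  define h where "h x = enn2real (d x)" for x
  have hd: "AE x in lborel. d x = ennreal (h x)"
    using fin by eventually_elim (simp add: h_def less_top)
  have "distributed M lborel (arrival_time (Suc (Suc n))) (\<lambda>x. ennreal (h x))"
    using dd by (subst distributed_cong_density[OF hd, symmetric]) (simp_all add: h_def[abs_def])
  then show ?case by (intro exI[of _ h]) (auto simp: h_def dneg)
qed

definition arrival_pdf :: "nat \<Rightarrow> real \<Rightarrow> real" where
  "arrival_pdf n = (SOME g. (\<forall>t. 0 \<le> g t) \<and> (\<forall>t<0. g t = 0) \<and>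
     distributed M lborel (arrival_time (Suc n)) (\<lambda>t. ennreal (g t)))"

lemma arrival_pdf_nonneg: "0 \<le> arrival_pdf n t" and arrival_pdf_neg: "t < 0 \<Longrightarrow> arrival_pdf n t = 0"
  and arrival_pdf_distributed: "distributed M lborel (arrival_time (Suc n)) (\<lambda>t. ennreal (arrival_pdf n t))"
  using someI_ex[OF ex_arrival_pdf[of n], folded arrival_pdf_def] by auto

lemma arrival_pdf_measurable [measurable]: "arrival_pdf n \<in> borel_measurable borel"
  using distributed_real_measurable[OF _ arrival_pdf_distributed] arrival_pdf_nonneg by simp

lemma
  assumes "0 \<le> s"
  shows integrable_arrival_pdf_exp: "integrable lborel (\<lambda>t. arrival_pdf n t * exp (- s * t))"
    and integral_arrival_pdf_exp: "(LINT t|lborel. arrival_pdf n t * exp (- s * t)) = eta_transform s ^ Suc n"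
proof -
  show "integrable lborel (\<lambda>t. arrival_pdf n t * exp (- s * t))"
    using distributed_integrable[OF arrival_pdf_distributed[of n], of "\<lambda>t. exp (- s * t)"] integrable_exp_arrival_time[OF assms, of "Suc n"]
    by (simp add: arrival_pdf_nonneg)
  show "(LINT t|lborel. arrival_pdf n t * exp (- s * t)) = eta_transform s ^ Suc n"
    using distributed_integral[OF arrival_pdf_distributed[of n], of "\<lambda>t. exp (- s * t)"] expectation_exp_arrival_time[OF assms, of "Suc n"]
    by (simp add: arrival_pdf_nonneg)
qed

lemma
  shows integrable_arrival_pdf_Icc: "integrable lborel (\<lambda>x. indicator {0..t} x * arrival_pdf n x)"
    and integral_arrival_pdf_Icc: "(LINT x|lborel. indicator {0..t} x * arrival_pdf n x) = arrival_cdf (Suc n) t"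
proof -
  have int: "integrable M (\<lambda>\<omega>. indicator {0..t} (arrival_time (Suc n) \<omega>) :: real)"
    by (rule integrable_const_bound[where B = 1]) (auto simp: indicator_def)
  show "integrable lborel (\<lambda>x. indicator {0..t} x * arrival_pdf n x)"
    using distributed_integrable[OF arrival_pdf_distributed[of n], of "indicator {0..t}"] int
    by (simp add: arrival_pdf_nonneg mult.commute)
  have "(LINT x|lborel. indicator {0..t} x * arrival_pdf n x) = expectation (\<lambda>\<omega>. indicator {0..t} (arrival_time (Suc n) \<omega>))"
    using distributed_integral[OF arrival_pdf_distributed[of n], of "indicator {0..t}"]
    by (simp add: arrival_pdf_nonneg mult.commute)
  also have "\<dots> = expectation (indicator {\<omega>\<in>space M. arrival_time (Suc n) \<omega> \<le> t})"
  proof (rule integral_cong_AE)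
    show "AE \<omega> in M. indicator {0..t} (arrival_time (Suc n) \<omega>) = (indicator {\<omega>\<in>space M. arrival_time (Suc n) \<omega> \<le> t} \<omega> :: real)"
      using arrival_time_nonneg AE_space by eventually_elim (auto simp: indicator_def)
  qed auto
  finally show "(LINT x|lborel. indicator {0..t} x * arrival_pdf n x) = arrival_cdf (Suc n) t" by (simp add: arrival_cdf_def)
qed

text \<open>
  With the weight \<open>exp (- t)\<close> the integrals of the densities form a convergent geometric series.
\<close>

lemma AE_summable_arrival_pdf: "AE t in lborel. summable (\<lambda>n. arrival_pdf n t)"
proof -
  have "(\<integral>\<^sup>+t. (\<Sum>n. ennreal (arrival_pdf n t * exp (- 1 * t))) \<partial>lborel) = (\<Sum>n. \<integral>\<^sup>+t. ennreal (arrival_pdf n t * exp (- 1 * t)) \<partial>lborel)"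
    by (rule nn_integral_suminf) measurable
  also have "\<dots> = (\<Sum>n. ennreal (eta_transform 1 ^ Suc n))"
  proof (rule suminf_cong)
    fix n
    show "(\<integral>\<^sup>+t. ennreal (arrival_pdf n t * exp (- 1 * t)) \<partial>lborel) = ennreal (eta_transform 1 ^ Suc n)"
      by (subst nn_integral_eq_integral[OF integrable_arrival_pdf_exp]) (simp_all only: integral_arrival_pdf_exp zero_le_one, simp add: arrival_pdf_nonneg)
  qed
  also have "\<dots> = ennreal (\<Sum>n. eta_transform 1 ^ Suc n)"
    using eta_transform_pos[of 1] eta_transform_less_1[of 1]
    by (intro suminf_ennreal2) (auto simp: summable_Suc_iff intro: summable_geometric)
  finally have fin: "(\<integral>\<^sup>+t. (\<Sum>n. ennreal (arrival_pdf n t * exp (- 1 * t))) \<partial>lborel) \<noteq> \<infinity>" by simp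
  have "AE t in lborel. (\<Sum>n. ennreal (arrival_pdf n t * exp (- 1 * t))) \<noteq> \<infinity>"
    by (rule nn_integral_PInf_AE[OF _ fin]) measurable
  then show ?thesis
  proof eventually_elim
    case (elim t)
    have "summable (\<lambda>n. arrival_pdf n t * exp (- 1 * t))"
      by (rule summable_suminf_not_top) (use elim arrival_pdf_nonneg in auto)
    from summable_mult2[OF this, of "exp t"] show ?case
      by (simp add: mult.assoc exp_minus)
  qed
qed

text \<open>
  The derivative almost everywhere of \<open>\<lambda>t. \<Sum>m. P(M(t) = m) * c m\<close>: the probability of \<open>m\<close> arrivals is a difference of two
  consecutive distribution functions, and Abel summation moves the difference to \<open>c\<close>.
\<close>

definition renewal_series :: "(nat \<Rightarrow> complex) \<Rightarrow> real \<Rightarrow> complex" where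
  "renewal_series c t = (\<Sum>n. (c (Suc n) - c n) * of_real (arrival_pdf n t))"

lemma renewal_series_measurable [measurable]: "renewal_series c \<in> borel_measurable borel"
  unfolding renewal_series_def[abs_def] by measurable

lemma renewal_series_neg: "t < 0 \<Longrightarrow> renewal_series c t = 0"
  by (simp add: renewal_series_def arrival_pdf_neg)

context
  fixes c :: "nat \<Rightarrow> complex"
  assumes c: "\<And>n. norm (c n) \<le> 1"
begin

lemma norm_c_diff: "norm (c (Suc n) - c n) \<le> 2"
  using norm_triangle_ineq4[of "c (Suc n)" "c n"] c[of n] c[of "Suc n"] by linarith

text \<open>
  Exchange of sum and integral for a general weight.  The exponential weight gives the Laplace
  transform, the indicator of \<open>{0..t}\<close> the integral over an interval.
\<close>

lemma renewal_series_weighted: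
  fixes w :: "real \<Rightarrow> real"
  assumes [measurable]: "w \<in> borel_measurable borel" and w: "\<And>t. 0 \<le> w t"
    and int: "\<And>n. integrable lborel (\<lambda>t. w t * arrival_pdf n t)"
    and sm: "summable (\<lambda>n. LINT t|lborel. w t * arrival_pdf n t)"
  shows "integrable lborel (\<lambda>t. of_real (w t) * renewal_series c t)"
    and "(LINT t|lborel. of_real (w t) * renewal_series c t) =
           (\<Sum>n. (c (Suc n) - c n) * of_real (LINT t|lborel. w t * arrival_pdf n t))"
proof -
  let ?f = "\<lambda>n t. (c (Suc n) - c n) * of_real (w t * arrival_pdf n t)"
  have f_int: "integrable lborel (?f n)" for n
    by (intro integrable_mult_right integrable_of_real int)
  have n_eq: "norm (?f n t) = norm (c (Suc n) - c n) * (w t * arrival_pdf n t)" for n t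
    using w[of t] arrival_pdf_nonneg[of n t] by (simp add: norm_mult)
  have f_ae: "AE t in lborel. summable (\<lambda>n. norm (?f n t))"
    using AE_summable_arrival_pdf
  proof eventually_elim
    case (elim t)
    show ?case
    proof (rule summable_comparison_test')
      show "summable (\<lambda>n. 2 * (w t * arrival_pdf n t))" by (intro summable_mult elim)
      show "norm (norm (?f n t)) \<le> 2 * (w t * arrival_pdf n t)" for n
        unfolding n_eq real_norm_def using norm_c_diff[of n] w[of t] arrival_pdf_nonneg[of n t]
        by (subst abs_of_nonneg) (auto intro!: mult_right_mono)
    qed
  qed
  have f_sum: "summable (\<lambda>n. LINT t|lborel. norm (?f n t))"
  proof (rule summable_comparison_test')
    show "summable (\<lambda>n. 2 * (LINT t|lborel. w t * arrival_pdf n t))" by (intro summable_mult sm)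
    fix n
    have nn: "0 \<le> (LINT t|lborel. w t * arrival_pdf n t)"
      by (rule Bochner_Integration.integral_nonneg) (use w arrival_pdf_nonneg in auto)
    then show "norm (LINT t|lborel. norm (?f n t)) \<le> 2 * (LINT t|lborel. w t * arrival_pdf n t)"
      unfolding n_eq using norm_c_diff[of n] int
      by (simp add: abs_mult mult_right_mono)
  qed
  have eq: "AE t in lborel. (\<Sum>n. ?f n t) = of_real (w t) * renewal_series c t"
    using AE_summable_arrival_pdf
  proof eventually_elim
    case (elim t)
    have "summable (\<lambda>n. norm ((c (Suc n) - c n) * of_real (arrival_pdf n t)))"
    proof (rule summable_comparison_test')
      show "summable (\<lambda>n. 2 * arrival_pdf n t)" by (intro summable_mult elim)
      show "norm (norm ((c (Suc n) - c n) * of_real (arrival_pdf n t))) \<le> 2 * arrival_pdf n t" for n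
        using norm_c_diff[of n] arrival_pdf_nonneg[of n t] by (auto simp: norm_mult intro!: mult_right_mono)
    qed
    from suminf_mult[OF summable_norm_cancel[OF this], of "of_real (w t)"] show ?case
      by (simp add: renewal_series_def mult_ac)
  qed
  have i1: "integrable lborel (\<lambda>t. \<Sum>n. ?f n t)" by (rule integrable_suminf[OF f_int f_ae f_sum])
  show "integrable lborel (\<lambda>t. of_real (w t) * renewal_series c t)"
    by (rule integrable_cong_AE_imp[OF i1]) (use eq in \<open>auto elim: eventually_mono\<close>)
  have "(LINT t|lborel. of_real (w t) * renewal_series c t) = (LINT t|lborel. (\<Sum>n. ?f n t))"
    by (rule integral_cong_AE) (use eq i1 in \<open>auto elim: eventually_mono\<close>)
  also have "\<dots> = (\<Sum>n. LINT t|lborel. ?f n t)" by (rule integral_suminf[OF f_int f_ae f_sum])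
  also have "\<dots> = (\<Sum>n. (c (Suc n) - c n) * of_real (LINT t|lborel. w t * arrival_pdf n t))"
  proof (rule suminf_cong)
    fix n
    have "(LINT t|lborel. ?f n t) = (c (Suc n) - c n) * (LINT t|lborel. complex_of_real (w t * arrival_pdf n t))"
      by (rule Bochner_Integration.integral_mult_right) (intro integrable_of_real int)
    also have "(LINT t|lborel. complex_of_real (w t * arrival_pdf n t)) = of_real (LINT t|lborel. w t * arrival_pdf n t)"
      by (rule integral_complex_of_real)
    finally show "(LINT t|lborel. ?f n t) = (c (Suc n) - c n) * of_real (LINT t|lborel. w t * arrival_pdf n t)" .
  qed
  finally show "(LINT t|lborel. of_real (w t) * renewal_series c t) =
           (\<Sum>n. (c (Suc n) - c n) * of_real (LINT t|lborel. w t * arrival_pdf n t))" .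
qed

lemma
  assumes s: "0 < s"
  shows integrable_renewal_series_exp: "integrable lborel (\<lambda>t. of_real (exp (- s * t)) * renewal_series c t)"
    and integral_renewal_series_exp: "(LINT t|lborel. of_real (exp (- s * t)) * renewal_series c t) =
      (1 - of_real (eta_transform s)) * (\<Sum>n. c n * of_real (eta_transform s) ^ n) - c 0"
proof -
  have Ls: "0 < eta_transform s" "eta_transform s < 1" using eta_transform_pos eta_transform_less_1 s by auto
  have int: "integrable lborel (\<lambda>t. exp (- s * t) * arrival_pdf n t)" for n
    using integrable_arrival_pdf_exp[of s n] s by (simp add: mult.commute)
  have val: "(LINT t|lborel. exp (- s * t) * arrival_pdf n t) = eta_transform s ^ Suc n" for n
    using integral_arrival_pdf_exp[of s n] s by (simp add: mult.commute)
  have sm: "summable (\<lambda>n. LINT t|lborel. exp (- s * t) * arrival_pdf n t)"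
    unfolding val using Ls by (auto simp: summable_Suc_iff intro: summable_geometric)
  note W = renewal_series_weighted[of "\<lambda>t. exp (- s * t)", OF _ _ int sm]
  show "integrable lborel (\<lambda>t. of_real (exp (- s * t)) * renewal_series c t)" by (rule W(1)) auto
  let ?z = "complex_of_real (eta_transform s)"
  have cs: "summable (\<lambda>n. c n * ?z ^ n)"
  proof (rule summable_norm_cancel, rule summable_comparison_test')
    show "summable (\<lambda>n. eta_transform s ^ n)" using Ls by (intro summable_geometric) auto
    show "norm (norm (c n * ?z ^ n)) \<le> eta_transform s ^ n" for n
      using mult_right_mono[OF c[of n], of "eta_transform s ^ n"] Ls by (simp add: norm_mult norm_power)
  qed
  have cs': "summable (\<lambda>n. c (Suc n) * ?z ^ Suc n)" using cs by (subst summable_Suc_iff)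
  have "(LINT t|lborel. of_real (exp (- s * t)) * renewal_series c t) = (\<Sum>n. (c (Suc n) - c n) * of_real (eta_transform s ^ Suc n))"
    unfolding val[symmetric] by (rule W(2)) auto
  also have "\<dots> = (\<Sum>n. c (Suc n) * ?z ^ Suc n - ?z * (c n * ?z ^ n))"
    by (simp add: algebra_simps)
  also have "\<dots> = (\<Sum>n. c (Suc n) * ?z ^ Suc n) - (\<Sum>n. ?z * (c n * ?z ^ n))"
    by (rule suminf_diff[symmetric, OF cs' summable_mult[OF cs]])
  also have "(\<Sum>n. ?z * (c n * ?z ^ n)) = ?z * (\<Sum>n. c n * ?z ^ n)" by (rule suminf_mult[OF cs])
  also have "(\<Sum>n. c (Suc n) * ?z ^ Suc n) = (\<Sum>n. c n * ?z ^ n) - c 0"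
    using suminf_split_head[OF cs] by simp
  finally show "(LINT t|lborel. of_real (exp (- s * t)) * renewal_series c t) =
      (1 - ?z) * (\<Sum>n. c n * ?z ^ n) - c 0"
    by (simp add: algebra_simps)
qed

lemma
  shows integrable_renewal_series_Icc: "integrable lborel (\<lambda>x. of_real (indicator {0..t} x) * renewal_series c x)"
    and renewal_mixture_eq: "0 \<le> t \<Longrightarrow> (\<Sum>m. of_real (arrival_cdf m t - arrival_cdf (Suc m) t) * c m) =
      c 0 + (LINT x|lborel. of_real (indicator {0..t} x) * renewal_series c x)"
proof -
  have Fs: "summable (\<lambda>n. arrival_cdf (Suc n) t)" using summable_arrival_cdf[of t] by (subst summable_Suc_iff)
  note W = renewal_series_weighted[of "indicator {0..t}", OF _ _ integrable_arrival_pdf_Icc, unfolded integral_arrival_pdf_Icc, OF _ _ Fs]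
  show "integrable lborel (\<lambda>x. of_real (indicator {0..t} x) * renewal_series c x)" by (rule W(1)) auto
  assume t: "0 \<le> t"
  have cs: "summable (\<lambda>n. of_real (arrival_cdf n t) * c n)"
  proof (rule summable_norm_cancel, rule summable_comparison_test')
    show "summable (\<lambda>n. arrival_cdf n t)" by (rule summable_arrival_cdf)
    show "norm (norm (of_real (arrival_cdf n t) * c n)) \<le> arrival_cdf n t" for n
      using mult_left_mono[OF c[of n] arrival_cdf_nonneg[of n t]] arrival_cdf_nonneg[of n t] by (simp add: norm_mult)
  qed
  have cs': "summable (\<lambda>n. of_real (arrival_cdf (Suc n) t) * c (Suc n))" using cs by (subst summable_Suc_iff)
  have cs'': "summable (\<lambda>n. of_real (arrival_cdf (Suc n) t) * c n)"
  proof (rule summable_norm_cancel, rule summable_comparison_test')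
    show "norm (norm (of_real (arrival_cdf (Suc n) t) * c n)) \<le> arrival_cdf (Suc n) t" for n
      using mult_left_mono[OF c[of n] arrival_cdf_nonneg[of "Suc n" t]] arrival_cdf_nonneg[of "Suc n" t] by (simp add: norm_mult)
  qed (rule Fs)
  have "(\<Sum>m. of_real (arrival_cdf m t - arrival_cdf (Suc m) t) * c m) = (\<Sum>m. of_real (arrival_cdf m t) * c m - of_real (arrival_cdf (Suc m) t) * c m)"
    by (simp add: left_diff_distrib)
  also have "\<dots> = (\<Sum>m. of_real (arrival_cdf m t) * c m) - (\<Sum>m. of_real (arrival_cdf (Suc m) t) * c m)"
    by (rule suminf_diff[symmetric, OF cs cs''])
  also have "(\<Sum>m. of_real (arrival_cdf m t) * c m) = c 0 + (\<Sum>m. of_real (arrival_cdf (Suc m) t) * c (Suc m))"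
    using suminf_split_head[OF cs] t by (simp add: arrival_cdf_0)
  also have "c 0 + (\<Sum>m. of_real (arrival_cdf (Suc m) t) * c (Suc m)) - (\<Sum>m. of_real (arrival_cdf (Suc m) t) * c m) =
      c 0 + (\<Sum>m. of_real (arrival_cdf (Suc m) t) * c (Suc m) - of_real (arrival_cdf (Suc m) t) * c m)"
    by (simp add: suminf_diff[OF cs' cs''])
  also have "(\<Sum>m. of_real (arrival_cdf (Suc m) t) * c (Suc m) - of_real (arrival_cdf (Suc m) t) * c m) =
      (LINT x|lborel. of_real (indicator {0..t} x) * renewal_series c x)"
    by (subst W(2)) (auto simp: algebra_simps)
  finally show "(\<Sum>m. of_real (arrival_cdf m t - arrival_cdf (Suc m) t) * c m) =
      c 0 + (LINT x|lborel. of_real (indicator {0..t} x) * renewal_series c x)" .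
qed

end
end

section \<open>The evolution equation from its Laplace transform\<close>

lemma exp_of_real_product: "exp (- (complex_of_real r * complex_of_real t)) = of_real (exp (- r * t))"
  by (simp add: exp_of_real[symmetric])

lemma
  assumes r: "0 < r"
  shows laplace_one_integrable: "laplace_integrable (\<lambda>_. 1) (of_real r)"
    and laplace_one: "laplace (\<lambda>_. 1) (of_real r) = 1 / of_real r"
proof -
  have hi: "((\<lambda>t. exp (- r * t)) has_integral 1 / r) {0..}"
    using has_integral_exp_minus_to_infinity[OF r, of 0] by simp
  then have ai: "(\<lambda>t. exp (- r * t)) absolutely_integrable_on {0..}"
    by (intro nonnegative_absolutely_integrable_1) (auto simp: integrable_on_def)
  have eq: "indicator {0..} t *\<^sub>R (exp (- (of_real r * of_real t)) * (1::complex)) =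
      of_real (indicator {0..} t *\<^sub>R exp (- r * t))" for t
    by (simp add: exp_of_real_product scaleR_conv_of_real)
  show "laplace_integrable (\<lambda>_. 1) (of_real r)"
    unfolding set_integrable_def eq using ai by (intro integrable_of_real) (simp add: set_integrable_def)
  have "(LINT t:{0..}|lebesgue. exp (- r * t)) = 1 / r"
    using set_lebesgue_integral_eq_integral(2)[OF ai] hi by (simp add: integral_unique)
  then show "laplace (\<lambda>_. 1) (of_real r) = 1 / of_real r"
    unfolding laplace_def set_lebesgue_integral_def eq integral_complex_of_real by simp
qed

text \<open>
  What the transition function of the random walk contributes to the evolution equation: it is
  \<open>1\<close> plus the integral of a density \<open>D\<close> with Laplace transform on the whole half-line of positive
  parameters.
\<close>

locale integrated_density =
  fixes f D :: "real \<Rightarrow> complex"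
  assumes D_measurable [measurable]: "D \<in> borel_measurable borel"
    and D_neg: "\<And>t. t < 0 \<Longrightarrow> D t = 0"
    and D_exp: "\<And>r. 0 < r \<Longrightarrow> integrable lborel (\<lambda>t. of_real (exp (- r * t)) * D t)"
    and D_Icc: "\<And>t. integrable lborel (\<lambda>x. of_real (indicator {0..t} x) * D x)"
    and f_eq: "\<And>t. 0 \<le> t \<Longrightarrow> f t = 1 + (LINT x|lborel. of_real (indicator {0..t} x) * D x)"
begin

lemma f_0: "f 0 = 1"
proof -
  have "(LINT x|lborel. of_real (indicator {0..0} x) * D x) = (LINT x::real|lborel. (0::complex))"
  proof (rule integral_cong_AE)
    show "AE x in lborel. of_real (indicator {0..0} x) * D x = 0"
      using AE_lborel_singleton[of 0] by eventually_elim auto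
  qed auto
  then show ?thesis using f_eq[of 0] by simp
qed

lemma derivative_AE: "AE t in lebesgue. 0 < t \<longrightarrow> (f has_vector_derivative D t) (at t)"
proof -
  have "AE t in lborel. 0 < t \<longrightarrow> (f has_vector_derivative D t) (at t)"
  proof (rule lebesgue_differentiation[OF D_measurable])
    fix n :: nat
    have "indicat_real {- real n..real n} x *\<^sub>R D x = of_real (indicator {0..real n} x) * D x" for x
      by (cases "x < 0") (auto simp: D_neg indicator_def)
    then show "set_integrable lborel {- real n..real n} D"
      using D_Icc[of "real n"] by (simp add: set_integrable_def)
  next
    fix u v :: real assume uv: "0 \<le> u" "u \<le> v"
    have "f v - f u = (LINT x|lborel. of_real (indicator {0..v} x) * D x) - (LINT x|lborel. of_real (indicator {0..u} x) * D x)"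
      using uv by (simp add: f_eq)
    also have "\<dots> = (LINT x|lborel. of_real (indicator {0..v} x) * D x - of_real (indicator {0..u} x) * D x)"
      by (rule Bochner_Integration.integral_diff[symmetric, OF D_Icc D_Icc])
    also have "\<dots> = (LINT x:{u..v}|lborel. D x)"
      unfolding set_lebesgue_integral_def
      by (rule integral_cong_AE)
         (use AE_lborel_singleton[of u] uv in \<open>auto elim!: eventually_mono simp: indicator_def\<close>)
    finally show "f v - f u = (LINT y:{u..v}|lborel. D y)" .
  qed
  then show ?thesis by (simp add: AE_completion_iff)
qed

abbreviation f' :: "real \<Rightarrow> complex" where "f' \<equiv> \<lambda>\<tau>. vector_derivative f (at \<tau>)"

lemma f'_eq_AE: "AE t in lborel. 0 \<le> t \<longrightarrow> f' t = D t"
proof -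
  have "AE t in lborel. 0 < t \<longrightarrow> (f has_vector_derivative D t) (at t)"
    using derivative_AE by (simp add: AE_completion_iff)
  with AE_lborel_singleton[of 0] show ?thesis
    by eventually_elim (auto intro: vector_derivative_at)
qed

lemma f'_eq_AE_Icc: "AE x in lborel. indicator {0..t} x *\<^sub>R f' x = of_real (indicator {0..t} x) * D x"
  using f'_eq_AE by eventually_elim (auto simp: indicator_def)

lemma f'_eq_AE_exp:
  "AE x in lborel. indicator {0..} x *\<^sub>R (exp (- (of_real r * of_real x)) * f' x) = of_real (exp (- r * x)) * D x"
  using f'_eq_AE
proof eventually_elim
  case (elim x)
  then show ?case by (cases "x < 0") (auto simp: indicator_def D_neg exp_of_real_product)
qed

theorem locally_abs_continuous_f: "locally_abs_continuous f"
  unfolding locally_abs_continuous_def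
proof (intro conjI allI impI)
  show "AE t in lebesgue. 0 < t \<longrightarrow> f differentiable (at t)"
    using derivative_AE by eventually_elim (auto intro: differentiableI_vector)
  fix t :: real assume t: "0 \<le> t"
  have m: "(\<lambda>x. of_real (indicator {0..t} x) * D x) \<in> borel_measurable borel" by measurable
  show "set_integrable lebesgue {0..t} f'"
    unfolding set_integrable_def lebesgue_integrable_transfer[OF m f'_eq_AE_Icc] by (rule D_Icc)
  show "f t = f 0 + (LINT \<tau>:{0..t}|lebesgue. f' \<tau>)"
    unfolding set_lebesgue_integral_def lebesgue_integral_transfer[OF m f'_eq_AE_Icc]
    using t by (simp add: f_eq f_0)
qed

lemma
  assumes r: "0 < r"
  shows f'_laplace_integrable: "laplace_integrable f' (of_real r)"
    and laplace_f': "laplace f' (of_real r) = (LINT t|lborel. of_real (exp (- r * t)) * D t)"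
proof -
  have m: "(\<lambda>t. of_real (exp (- r * t)) * D t) \<in> borel_measurable borel" by measurable
  show "laplace_integrable f' (of_real r)"
    unfolding set_integrable_def lebesgue_integrable_transfer[OF m f'_eq_AE_exp] by (rule D_exp[OF r])
  show "laplace f' (of_real r) = (LINT t|lborel. of_real (exp (- r * t)) * D t)"
    unfolding laplace_def set_lebesgue_integral_def by (rule lebesgue_integral_transfer[OF m f'_eq_AE_exp])
qed

text \<open>
  The function is \<open>1\<close> plus the causal convolution of its derivative with the constant \<open>1\<close>, whose
  transform at \<open>r\<close> is \<open>1 / r\<close>.
\<close>

lemma
  assumes r: "0 < r"
  shows f_laplace_integrable: "laplace_integrable f (of_real r)"
    and laplace_f: "of_real r * laplace f (of_real r) = 1 + laplace f' (of_real r)"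
proof -
  note i1 = laplace_one_integrable[OF r]
  note C = laplace_causal_convolution[OF i1 f'_laplace_integrable[OF r]]
  have feq: "f t = 1 + causal_convolution (\<lambda>_. 1) f' t" if "0 \<le> t" for t
    using locally_abs_continuous_f that f_0
    by (simp add: locally_abs_continuous_def causal_convolution_def)
  have split: "indicator {0..} t *\<^sub>R (exp (- (of_real r * of_real t)) * f t) =
      indicator {0..} t *\<^sub>R (exp (- (of_real r * of_real t)) * 1) +
      indicator {0..} t *\<^sub>R (exp (- (of_real r * of_real t)) * causal_convolution (\<lambda>_. 1) f' t)" for t
    by (cases "0 \<le> t") (auto simp: feq distrib_left)
  show "laplace_integrable f (of_real r)"
    unfolding set_integrable_def split
    by (intro Bochner_Integration.integrable_add i1[unfolded set_integrable_def] C(2)[unfolded set_integrable_def])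
  have "laplace f (of_real r) = laplace (\<lambda>_. 1) (of_real r) + laplace (causal_convolution (\<lambda>_. 1) f') (of_real r)"
    unfolding laplace_def set_lebesgue_integral_def split
    by (rule Bochner_Integration.integral_add[OF i1[unfolded set_integrable_def] C(2)[unfolded set_integrable_def]])
  also have "\<dots> = 1 / of_real r + 1 / of_real r * laplace f' (of_real r)"
    by (simp add: C(3) laplace_one[OF r])
  finally show "of_real r * laplace f (of_real r) = 1 + laplace f' (of_real r)"
    using r by (simp add: field_simps)
qed

text \<open>
  Both sides of the equation are Laplace transformable and their transforms agree at all large
  integers.  Uniqueness is applied to the difference of the two sides: as a functional on test
  functions in the first case, as a function in the second.
\<close>

theorem evolution_eq_of_laplace:
  fixes a b :: complex and N :: nat and FK FR :: "complex \<Rightarrow> complex"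
  assumes N: "1 \<le> N"
    and eq: "\<And>n. N \<le> n \<Longrightarrow> FK (of_nat n) * laplace f' (of_nat n) =
        (b - 1) * (FK (of_nat n) * FR (of_nat n)) + (a / b - 1) * laplace f (of_nat n)"
  shows "inverse_laplace_distr K FK \<Longrightarrow> inverse_laplace_distr R FR \<Longrightarrow> evolution_eq_distr K R a b f"
    and "inverse_laplace_fun k FK \<Longrightarrow> inverse_laplace_fun q FR \<Longrightarrow> evolution_eq_fun k q a b f"
proof -
  have f'i: "laplace_integrable f' (of_nat n)"
    and fi: "laplace_integrable f (of_nat n)" if "1 \<le> n" for n
    using f'_laplace_integrable[of "real n"] f_laplace_integrable[of "real n"] that by simp_all
  show "evolution_eq_distr K R a b f"
    if K: "inverse_laplace_distr K FK" and R: "inverse_laplace_distr R FR"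
  proof -
    obtain \<sigma>1 where s1: "causal_distribution \<sigma>1 K" "\<And>s. \<sigma>1 < Re s \<Longrightarrow> K (laplace_kernel s) = FK s"
      using K by (auto simp: inverse_laplace_distr_def)
    obtain \<sigma>2 where s2: "causal_distribution \<sigma>2 R" "\<And>s. \<sigma>2 < Re s \<Longrightarrow> R (laplace_kernel s) = FR s"
      using R by (auto simp: inverse_laplace_distr_def)
    obtain n0 :: nat where "max \<sigma>1 \<sigma>2 < real n0" using reals_Archimedean2 by blast
    define m where "m = max N n0"
    have m: "N \<le> m" "\<sigma>1 < real m" "\<sigma>2 < real m" using \<open>max \<sigma>1 \<sigma>2 < real n0\<close> by (auto simp: m_def)
    have cK: "exp_continuous (real m) K" by (rule causal_distribution_exp_continuous[OF s1(1) m(2)])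
    have cR: "exp_continuous (real m) R" by (rule causal_distribution_exp_continuous[OF s2(1) m(3)])
    have cf': "exp_continuous (real m) (fun_distr f')"
      using f'i[of m] m N by (intro fun_distr_exp_continuous) simp
    have cf: "exp_continuous (real m) (fun_distr f)"
      using fi[of m] m N by (intro fun_distr_exp_continuous) simp
    define U where "U \<phi> = (distr_conv K (fun_distr f') \<phi> + - (b - 1) * distr_conv K R \<phi>) + - (a / b - 1) * fun_distr f \<phi>" for \<phi>
    have cU: "exp_continuous (real m) U"
      unfolding U_def by (intro exp_continuous_combination distr_conv_exp_continuous cK cR cf' cf)
    show ?thesis
      unfolding evolution_eq_distr_def
    proof
      fix \<phi> assume \<phi>: "\<phi> \<in> test_functions"
      have "U \<phi> = 0"
      proof (rule exp_continuous_unique[OF cU _ _ \<phi>])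
        show "1 \<le> m" using N m by simp
        fix n assume n: "m \<le> n"
        have ns: "real m \<le> Re (of_nat n)" "\<sigma>1 < Re (of_nat n)" "\<sigma>2 < Re (of_nat n)" using n m by auto
        show "U (laplace_kernel (of_nat n)) = 0"
          unfolding U_def distr_conv_exp[OF cK cf' ns(1)] distr_conv_exp[OF cK cR ns(1)] fun_distr_exp
            s1(2)[OF ns(2)] s2(2)[OF ns(3)]
          using eq[of n] n m by (simp add: algebra_simps)
      qed
      then show "distr_conv K (fun_distr f') \<phi> = (b - 1) * distr_conv K R \<phi> + (a / b - 1) * fun_distr f \<phi>"
        by (simp add: U_def algebra_simps)
    qed
  qed
  show "evolution_eq_fun k q a b f"
    if K: "inverse_laplace_fun k FK" and R: "inverse_laplace_fun q FR"
  proof -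
    obtain \<sigma>1 where s1: "\<And>s. \<sigma>1 < Re s \<Longrightarrow>
        laplace_integrable k s \<and> laplace k s = FK s"
      using K by (auto simp: inverse_laplace_fun_def)
    obtain \<sigma>2 where s2: "\<And>s. \<sigma>2 < Re s \<Longrightarrow>
        laplace_integrable q s \<and> laplace q s = FR s"
      using R by (auto simp: inverse_laplace_fun_def)
    obtain n0 :: nat where "max \<sigma>1 \<sigma>2 < real n0" using reals_Archimedean2 by blast
    define m where "m = max N n0"
    have m: "N \<le> m" "\<sigma>1 < real m" "\<sigma>2 < real m" using \<open>max \<sigma>1 \<sigma>2 < real n0\<close> by (auto simp: m_def)
    have ki: "laplace_integrable k (of_nat n)" "laplace k (of_nat n) = FK (of_nat n)"
      and qi: "laplace_integrable q (of_nat n)" "laplace q (of_nat n) = FR (of_nat n)"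
      if "m \<le> n" for n
      using s1[of "of_nat n"] s2[of "of_nat n"] that m by auto
    define A where "A = causal_convolution k f'"
    define B where "B = causal_convolution k q"
    define h where "h t = A t - (b - 1) * B t - (a / b - 1) * f t" for t
    have CA: "AE t in lebesgue. 0 < t \<longrightarrow> set_integrable lebesgue {0..t} (\<lambda>\<tau>. k (t - \<tau>) * f' \<tau>)"
      "laplace_integrable A (of_nat n)"
      "laplace A (of_nat n) = FK (of_nat n) * laplace f' (of_nat n)" if "m \<le> n" for n
      unfolding A_def using laplace_causal_convolution[OF ki(1)[OF that] f'i[of n]] that m N by (simp_all add: ki(2))
    have CB: "AE t in lebesgue. 0 < t \<longrightarrow> set_integrable lebesgue {0..t} (\<lambda>\<tau>. k (t - \<tau>) * q \<tau>)"
      "laplace_integrable B (of_nat n)"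
      "laplace B (of_nat n) = FK (of_nat n) * FR (of_nat n)" if "m \<le> n" for n
      unfolding B_def using laplace_causal_convolution[OF ki(1)[OF that] qi(1)[OF that]] that by (simp_all add: ki(2) qi(2))
    have he: "exp (- (of_nat n * of_real t)) * h t = exp (- (of_nat n * of_real t)) * A t -
       (b - 1) * (exp (- (of_nat n * of_real t)) * B t) - (a / b - 1) * (exp (- (of_nat n * of_real t)) * f t)" for n t
      by (simp add: h_def right_diff_distrib mult.left_commute)
    have hi: "laplace_integrable h (of_nat n)"
      and hl: "laplace h (of_nat n) = 0" if n: "m \<le> n" for n
    proof -
      have n1: "1 \<le> n" "N \<le> n" using n m N by auto
      note iB = set_integrable_mult_right[OF CB(2)[OF n], of "b - 1"]
      note iF = set_integrable_mult_right[OF fi[OF n1(1)], of "a / b - 1"]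
      show "laplace_integrable h (of_nat n)"
        unfolding he by (intro set_integral_diff(1) CA(2)[OF n] iB iF)
      have "laplace h (of_nat n) = laplace A (of_nat n) - (b - 1) * laplace B (of_nat n) - (a / b - 1) * laplace f (of_nat n)"
        unfolding laplace_def he
        by (simp only: set_integral_diff(2)[OF set_integral_diff(1)[OF CA(2)[OF n] iB] iF] set_integral_diff(2)[OF CA(2)[OF n] iB]
              set_integral_mult_right)
      also have "\<dots> = 0" using eq[OF n1(2)] by (simp add: CA(3)[OF n] CB(3)[OF n])
      finally show "laplace h (of_nat n) = 0" .
    qed
    define w where "w t = indicator {0..} t *\<^sub>R (exp (- (of_nat m * of_real t)) * h t)" for t
    have "AE t in lebesgue. 0 < t \<longrightarrow> w t = 0"
    proof (rule exponential_moments_zero_AE)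
      show "integrable lebesgue w" using hi[of m] by (simp add: set_integrable_def w_def[abs_def])
      show "w t = 0" if "t < 0" for t using that by (simp add: w_def)
      fix i
      have "exp (- (of_nat i * of_real t)) * w t = indicator {0..} t *\<^sub>R (exp (- (of_nat (m + i) * of_real t)) * h t)" for t
        by (simp add: w_def exp_add[symmetric] algebra_simps)
      then have "(LINT t|lebesgue. exp (- (of_nat i * of_real t)) * w t) = laplace h (of_nat (m + i))"
        by (simp only: laplace_def set_lebesgue_integral_def)
      then show "(LINT t|lebesgue. exp (- (of_nat i * of_real t)) * w t) = 0" using hl[of "m + i"] by simp
    qed
    with CA(1)[OF order_refl] CB(1)[OF order_refl] show ?thesis
      unfolding evolution_eq_fun_def
    proof eventually_elim
      case (elim t)
      show ?case
      proof
        assume t: "0 < t"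
        then have "h t = 0" using elim(3) by (simp add: w_def)
        then have "A t = (b - 1) * B t + (a / b - 1) * f t" by (simp add: h_def algebra_simps)
        then show "set_integrable lebesgue {0..t} (\<lambda>\<tau>. k (t - \<tau>) * f' \<tau>) \<and>
          set_integrable lebesgue {0..t} (\<lambda>\<tau>. k (t - \<tau>) * q \<tau>) \<and>
          (LINT \<tau>:{0..t}|lebesgue. k (t - \<tau>) * f' \<tau>) =
          (b - 1) * (LINT \<tau>:{0..t}|lebesgue. k (t - \<tau>) * q \<tau>) + (a / b - 1) * f t"
          using elim(1,2) t by (simp add: A_def B_def causal_convolution_def)
      qed
    qed
  qed
qed

end

section \<open>The Cauchy problem for the transition function\<close>

lemma (in continuous_renewal) laplace_eta:
  "laplace (\<lambda>t. of_real (\<eta> t)) (of_nat n) = of_real (eta_transform (real n))"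
proof -
  have eq: "AE t in lborel. indicator {0..} t *\<^sub>R (exp (- (of_nat n * of_real t)) * complex_of_real (\<eta> t)) =
      of_real (\<eta> t * exp (- real n * t))"
    by (rule AE_I2) (auto simp: indicator_def eta_neg exp_of_real_product[of "real n", simplified] mult.commute)
  have "laplace (\<lambda>t. of_real (\<eta> t)) (of_nat n) = (LINT t|lborel. complex_of_real (\<eta> t * exp (- real n * t)))"
    unfolding laplace_def set_lebesgue_integral_def by (rule lebesgue_integral_transfer[OF _ eq]) measurable
  then show ?thesis by (simp only: integral_complex_of_real eta_transform_def)
qed

text \<open>
  With \<open>e\<close> and \<open>p\<close> as the transforms of \<open>\<eta>\<close> and \<open>\<psi>\<close>, the fractions \<open>(1 - p) / (s * p)\<close> and \<open>e / (1 - b * e)\<close>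
  are the transforms of the two kernels.
\<close>

lemma evolution_symbol_identity:
  fixes a b e p C s :: complex
  assumes C: "(1 - b * e) * (b - a * p) * C = b * (1 - p)"
    and nz: "b \<noteq> 0" "p \<noteq> 0" "s \<noteq> 0" "1 - b * e \<noteq> 0" "b - a * p \<noteq> 0"
    and f': "F' = (1 - e) * C - 1" and f: "s * F = 1 + F'"
  shows "(1 - p) / (s * p) * F' = (b - 1) * ((1 - p) / (s * p) * (e / (1 - b * e))) + (a / b - 1) * F"
proof -
  define u where "u = 1 - b * e"
  define v where "v = b - a * p"
  have u: "u \<noteq> 0" and v: "v \<noteq> 0" using nz by (auto simp: u_def v_def)
  have Ceq: "C = b * (1 - p) / (u * v)" 
  proof (rule eq_divide_imp)
    show "C * (u * v) = b * (1 - p)" using C by (simp only: u_def v_def mult.commute[of C])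
  qed (use u v in simp)
  have Feq: "F = (1 - e) * C / s" using f f' nz by (simp add: field_simps)
  define q where "q = 1 - p"
  have "q / (s * p) * F' = (q * ((1 - e) * (b * q) - u * v)) / (s * p * u * v)"
    unfolding f' Ceq q_def[symmetric] using nz u v by (simp add: field_simps)
  also have "q * ((1 - e) * (b * q) - u * v) = (b - 1) * q * e * v + (a - b) * (1 - e) * q * p"
    unfolding u_def v_def q_def by algebra
  also have "\<dots> / (s * p * u * v) = (b - 1) * (q / (s * p) * (e / u)) + (a / b - 1) * F"
    unfolding Feq Ceq q_def[symmetric] using nz u v by (simp add: field_simps)
  finally show ?thesis by (simp only: q_def u_def)
qed

theorem mainTheorem10:
  fixes P :: "'w measure"
    and \<Delta> :: "nat \<Rightarrow> 'w \<Rightarrow> nat" and T :: "nat \<Rightarrow> 'w \<Rightarrow> real"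
    and \<psi> :: "nat \<Rightarrow> real" and \<eta> :: "real \<Rightarrow> real"
    and a b :: complex
  assumes "prob_space P"
    and "waiting_time_density \<psi>"
    and "prob_space.indep_vars P (\<lambda>_. count_space UNIV) \<Delta> UNIV"
    and "\<And>j k. k \<ge> 1 \<Longrightarrow> measure P {\<omega> \<in> space P. \<Delta> j \<omega> = k} = \<psi> k"
    and "\<And>t. \<eta> t \<ge> 0" and "\<And>t. t < 0 \<Longrightarrow> \<eta> t = 0"
    and "prob_space.indep_vars P (\<lambda>_. borel) T UNIV"
    and "\<And>j. distributed P lborel (T j) (\<lambda>t. ennreal (\<eta> t))"
    and "prob_space.indep_var P
           (PiM UNIV (\<lambda>_. borel)) (\<lambda>\<omega> j. real (\<Delta> j \<omega>))
           (PiM UNIV (\<lambda>_. borel)) (\<lambda>\<omega> j. T j \<omega>)"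
    and "norm a \<le> 1" and "norm b \<le> 1" and "b \<noteq> 0"
  shows "transition_scalar P \<Delta> T a b 0 = 1 \<and>
    locally_abs_continuous (transition_scalar P \<Delta> T a b) \<and>
    (\<forall>K R. inverse_laplace_distr K (K_laplace \<psi> \<eta> b) \<longrightarrow>
       inverse_laplace_distr R (R_laplace \<eta> b) \<longrightarrow>
       evolution_eq_distr K R a b (transition_scalar P \<Delta> T a b)) \<and>
    (\<forall>K R. inverse_laplace_fun K (K_laplace \<psi> \<eta> b) \<longrightarrow>
       inverse_laplace_fun R (R_laplace \<eta> b) \<longrightarrow>
       evolution_eq_fun K R a b (transition_scalar P \<Delta> T a b))"
proof -
  interpret P: prob_space P by fact
  define p where "p n m = measure P {\<omega> \<in> space P. renewal_count \<Delta> m \<omega> = n}" for n m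
  interpret N: discrete_renewal \<psi> p
    unfolding p_def by (rule P.discrete_renewal_counts) (use assms(2-4) in auto)
  interpret M: continuous_renewal P T \<eta>
    by unfold_locales (use assms(5-8) in auto)
  define f where "f = transition_scalar P \<Delta> T a b"
  define c where "c = N.jump_average a b"
  have c: "norm (c n) \<le> 1" for n unfolding c_def by (rule N.norm_jump_average_le[OF assms(10,11)])
  have c0: "c 0 = 1" by (simp add: c_def N.jump_average_0)
  have f_series: "f t = 1 + (LINT x|lborel. of_real (indicator {0..t} x) * M.renewal_series c x)" if t: "0 \<le> t" for t
  proof -
    have "f t = (\<Sum>m. of_real (M.arrival_cdf m t - M.arrival_cdf (Suc m) t) * c m)"
      unfolding f_def transition_scalar_def M.prob_renewal_count_T[OF t] c_def N.jump_average_def p_def ..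
    then show ?thesis using M.renewal_mixture_eq[OF c t] c0 by simp
  qed
  interpret I: integrated_density f "M.renewal_series c"
  proof
    show "M.renewal_series c \<in> borel_measurable borel" by measurable
    show "t < 0 \<Longrightarrow> M.renewal_series c t = 0" for t by (rule M.renewal_series_neg)
    show "0 < r \<Longrightarrow> integrable lborel (\<lambda>t. of_real (exp (- r * t)) * M.renewal_series c t)" for r
      by (rule M.integrable_renewal_series_exp[OF c])
    show "integrable lborel (\<lambda>x. of_real (indicator {0..t} x) * M.renewal_series c x)" for t
      by (rule M.integrable_renewal_series_Icc[OF c])
  qed (rule f_series)
  obtain \<delta> where \<delta>: "0 < \<delta>" "\<delta> \<le> 1" "\<And>u. 0 < norm u \<Longrightarrow> norm u < \<delta> \<Longrightarrow> gen_fun \<psi> u \<noteq> 0"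
    using gen_fun_nonzero_near_0[OF assms(2)] by blast
  \<comment> \<open>Beyond \<open>n0\<close> the argument \<open>b * e\<close> lies in the punctured disc where the generating function has no zeros.\<close>
  obtain n0 where n0: "\<And>n. n0 \<le> n \<Longrightarrow> M.eta_transform (real n) < \<delta>"
    using order_tendstoD(2)[OF M.eta_transform_tendsto_0 \<delta>(1)] by (auto simp: eventually_sequentially)
  have symbol: "K_laplace \<psi> \<eta> b (of_nat n) * laplace I.f' (of_nat n) =
      (b - 1) * (K_laplace \<psi> \<eta> b (of_nat n) * R_laplace \<eta> b (of_nat n)) + (a / b - 1) * laplace f (of_nat n)"
    if n: "max 1 n0 \<le> n" for n
  proof -
    let ?e = "complex_of_real (M.eta_transform (real n))"
    let ?p = "gen_fun \<psi> (b * ?e)"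
    have n1: "0 < real n" and L: "0 < M.eta_transform (real n)" "M.eta_transform (real n) < 1" "M.eta_transform (real n) < \<delta>"
      using n n0[of n] M.eta_transform_pos[of "real n"] M.eta_transform_less_1[of "real n"] by auto
    have be: "norm (b * ?e) \<le> M.eta_transform (real n)"
      using assms(11) L mult_right_mono[of "norm b" 1 "M.eta_transform (real n)"] by (simp add: norm_mult)
    have p0: "?p \<noteq> 0" by (rule \<delta>(3)) (use assms(12) L be in auto)
    \<comment> \<open>The generating function does not exceed the modulus of its argument, which is smaller than \<open>norm b\<close>.\<close>
    have "norm (a * ?p) < norm b"
    proof -
      have "norm ?p \<le> norm b * M.eta_transform (real n)"
      proof -
        have "norm (b * ?e) \<le> 1" using be L by linarith
        from norm_gen_fun_le[OF assms(2) this] show ?thesis using L by (simp add: norm_mult)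
      qed
      also have "\<dots> < norm b * 1" using assms(12) L by (intro mult_strict_left_mono) auto
      finally have "norm ?p < norm b" by simp
      moreover have "norm (a * ?p) \<le> norm ?p"
        using assms(10) mult_right_mono[of "norm a" 1 "norm ?p"] by (simp add: norm_mult)
      ultimately show ?thesis by simp
    qed
    then have v0: "b - a * ?p \<noteq> 0" by auto
    have "norm (b * ?e) < 1" using be L by linarith
    then have u0: "1 - b * ?e \<noteq> 0" by auto
    have F': "laplace I.f' (of_nat n) = (1 - ?e) * (\<Sum>m. c m * ?e ^ m) - 1"
      using I.laplace_f'[OF n1] M.integral_renewal_series_exp[OF c n1] c0 by simp
    have F: "of_nat n * laplace f (of_nat n) = 1 + laplace I.f' (of_nat n)"
      using I.laplace_f[OF n1] by simp
    have C: "(1 - b * ?e) * (b - a * ?p) * (\<Sum>m. c m * ?e ^ m) = b * (1 - ?p)"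
      unfolding c_def by (rule N.jump_average_generating_function[OF assms(10,11)]) (use L in simp)
    show ?thesis
      unfolding K_laplace_def R_laplace_def M.laplace_eta
      by (rule evolution_symbol_identity[OF C assms(12) p0 _ u0 v0 F' F]) (use n1 in simp)
  qed
  show ?thesis
    unfolding f_def[symmetric]
    using I.f_0 I.locally_abs_continuous_f
      I.evolution_eq_of_laplace[OF max.cobounded1 symbol] by blast
qed

end
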